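(* Let $\mathbb{A}=\mathbb{A}^*=\{z\in\mathbb{R}^2: 0<|z|<1\}$ be the planar punctured unit disk. Then $$\inf_{h\in\mathcal{H}^{1,1}(\mathbb{A},\mathbb{A}^* )}\int_{\mathbb{A}}|Dh(x)|\,dx\;\leqslant\; 2\;<\;\sqrt{2}\,\pi\;=\;\mathbb{E}_1[\mathrm{Id}]\;=\;\inf_{h\in\mathcal{R}^{1,1}(\mathbb{A},\mathbb{A}^* )}\int_{\mathbb{A}}|Dh(x)|\,dx .$$ Furthermore, there exists $p_1\in(1,2)$ such that for every $p$ with $1\leqslant p<p_1$ we have $$\inf_{h\in\mathcal{H}^{1,p}(\mathbb{A},\mathbb{A}^* )}\mathbb{E}_p[h]\;<\;\inf_{h\in\mathcal{R}^{1,p}(\mathbb{A},\mathbb{A}^* )}\mathbb{E}_p[h].$$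
   Context: For planar annuli $\mathbb{A}=\{z\in\mathbb{R}^2: r<|z|<R\}$ and $\mathbb{A}^*=\{z\in\mathbb{R}^2: r_*<|z|<R_*\}$, with $0\leqslant r<R$ and $0\leqslant r_*<R_*$ (punctured disks, i.e. inner radius $0$, are allowed), and $p\geqslant 1$: - $\mathbb{E}_p[h]=\int_{\mathbb{A}}|Dh(x)|^p\,dx$, where $|Dh|^2=\operatorname{Tr}[D^*h\cdot Dh]$ is the squared Hilbert–Schmidt norm of the differential matrix. - $\mathcal{H}^{1,p}(\mathbb{A},\mathbb{A}^* )$ is the class of orientation-preserving homeomorphisms $h$ from $\mathbb{A}$ onto $\mathbb{A}^*$ which lie in the Sobolev space $W^{1,p}(\mathbb{A},\mathbb{R}^2)$ and preserve the order of the boundary components: $|h(x)|\to r_*$ as $|x|\to r$ and $|h(x)|\to R_*$ as $|x|\to R$. - $\mathcal{R}^{1,p}(\mathbb{A},\mathbb{A}^* )=\{h\in\mathcal{H}^{1,p}(\mathbb{A},\mathbb{A}^* ): h(x)=H(|x|)\frac{x}{|x|}\}$ (for some real-valued function $H$) is the subclass of radial homeomorphisms. $\mathrm{Id}$ denotes the identity map $\mathrm{Id}(x)=x$. *)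

theory Defs
  imports "HOL-Complex_Analysis.Complex_Analysis"
begin

text \<open>The plane \<open>\<real>\<^sup>2\<close> is the type \<^typ>\<open>complex\<close>, a two-dimensional real Euclidean space.\<close>

definition annulus :: "real \<Rightarrow> real \<Rightarrow> complex set" where
  "annulus r R = {z. r < norm z \<and> norm z < R}"

primrec Ck :: "nat \<Rightarrow> ('a::euclidean_space \<Rightarrow> real) \<Rightarrow> bool" where
  "Ck 0 f \<longleftrightarrow> continuous_on UNIV f"
| "Ck (Suc k) f \<longleftrightarrow> (\<forall>x. f differentiable (at x)) \<and>
     (\<forall>b\<in>Basis. Ck k (\<lambda>x. frechet_derivative f (at x) b))"

definition test_function :: "'a::euclidean_space set \<Rightarrow> ('a \<Rightarrow> real) \<Rightarrow> bool" where
  "test_function U \<phi> \<longleftrightarrow> (\<forall>k. Ck k \<phi>) \<and>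
     compact (closure {x. \<phi> x \<noteq> 0}) \<and> closure {x. \<phi> x \<noteq> 0} \<subseteq> U"

definition locally_integrable ::
    "'a::euclidean_space set \<Rightarrow> ('a \<Rightarrow> 'b::euclidean_space) \<Rightarrow> bool" where
  "locally_integrable U f \<longleftrightarrow> (\<forall>K. compact K \<and> K \<subseteq> U \<longrightarrow> set_integrable lebesgue K f)"

text \<open>\<open>D x\<close> is the differential at \<open>x\<close>, as a linear map; \<open>D x b\<close> is the weak partial derivative
  in the direction of the basis vector \<open>b\<close>.\<close>

definition has_weak_differential ::
    "('a::euclidean_space \<Rightarrow> 'b::euclidean_space) \<Rightarrow> ('a \<Rightarrow> 'a \<Rightarrow> 'b) \<Rightarrow> 'a set \<Rightarrow> bool" where
  "has_weak_differential h D U \<longleftrightarrow>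
     locally_integrable U h \<and> (\<forall>x\<in>U. linear (D x)) \<and>
     (\<forall>b\<in>Basis. locally_integrable U (\<lambda>x. D x b) \<and>
        (\<forall>\<phi>. test_function U \<phi> \<longrightarrow>
           (LINT x:U|lebesgue. frechet_derivative \<phi> (at x) b *\<^sub>R h x) =
           - (LINT x:U|lebesgue. \<phi> x *\<^sub>R D x b)))"

text \<open>The weak differential is unique only up to null sets; any choice gives the same energy.\<close>

definition weak_differential ::
    "'a::euclidean_space set \<Rightarrow> ('a \<Rightarrow> 'b::euclidean_space) \<Rightarrow> 'a \<Rightarrow> 'a \<Rightarrow> 'b" where
  "weak_differential U h = (SOME D. has_weak_differential h D U)"

definition in_Lp ::
    "real \<Rightarrow> 'a::euclidean_space set \<Rightarrow> ('a \<Rightarrow> 'b::euclidean_space) \<Rightarrow> bool" where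
  "in_Lp p U f \<longleftrightarrow> set_borel_measurable lebesgue U f \<and>
     set_integrable lebesgue U (\<lambda>x. norm (f x) powr p)"

definition sobolev_W1 ::
    "real \<Rightarrow> 'a::euclidean_space set \<Rightarrow> ('a \<Rightarrow> 'b::euclidean_space) set" where
  "sobolev_W1 p U = {h. in_Lp p U h \<and>
     (\<exists>D. has_weak_differential h D U \<and> (\<forall>b\<in>Basis. in_Lp p U (\<lambda>x. D x b)))}"

text \<open>The square root of the trace of \<open>L\<^sup>* L\<close>. Beware that \<^const>\<open>adjoint\<close> is only meaningful
  for a linear \<open>L\<close>.\<close>

definition hs_norm :: "('a::euclidean_space \<Rightarrow> 'b::euclidean_space) \<Rightarrow> real" where
  "hs_norm L = sqrt (\<Sum>b\<in>Basis. adjoint L (L b) \<bullet> b)"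

text \<open>An extended nonnegative real, so that no integrability side condition is needed.\<close>

definition energy ::
    "real \<Rightarrow> 'a::euclidean_space set \<Rightarrow> ('a \<Rightarrow> 'b::euclidean_space) \<Rightarrow> ennreal" where
  "energy p U h =
     (\<integral>\<^sup>+x\<in>U. ennreal (hs_norm (weak_differential U h x) powr p) \<partial>lebesgue)"

text \<open>Local degree \<open>1\<close>: the image of every positively oriented circle bounding a closed disk
  inside \<open>U\<close> winds once around the image of the centre.\<close>

definition orientation_preserving :: "complex set \<Rightarrow> (complex \<Rightarrow> complex) \<Rightarrow> bool" where
  "orientation_preserving U h \<longleftrightarrow>
     (\<forall>z s. 0 < s \<and> cball z s \<subseteq> U \<longrightarrow> winding_number (h \<circ> circlepath z s) (h z) = 1)"

text \<open>The filters \<open>filtercomap norm (at_right r)\<close> and \<open>filtercomap norm (at_left R)\<close> express that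
  \<open>|x|\<close> tends to the boundary radius from inside the annulus. Values of \<open>h\<close> outside
  \<^term>\<open>annulus r R\<close> are unconstrained and irrelevant.\<close>

definition annulus_homeos ::
    "real \<Rightarrow> real \<Rightarrow> real \<Rightarrow> real \<Rightarrow> real \<Rightarrow> (complex \<Rightarrow> complex) set" where
  "annulus_homeos p r R r' R' = {h.
     (\<exists>g. homeomorphism (annulus r R) (annulus r' R') h g) \<and>
     orientation_preserving (annulus r R) h \<and>
     h \<in> sobolev_W1 p (annulus r R) \<and>
     ((\<lambda>x. norm (h x)) \<longlongrightarrow> r') (filtercomap norm (at_right r)) \<and>
     ((\<lambda>x. norm (h x)) \<longlongrightarrow> R') (filtercomap norm (at_left R))}"

definition radial_homeos ::
    "real \<Rightarrow> real \<Rightarrow> real \<Rightarrow> real \<Rightarrow> real \<Rightarrow> (complex \<Rightarrow> complex) set" where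
  "radial_homeos p r R r' R' = {h \<in> annulus_homeos p r R r' R'.
     \<exists>H :: real \<Rightarrow> real. \<forall>x\<in>annulus r R. h x = H (norm x) *\<^sub>R (x /\<^sub>R norm x)}"

end

theory Submission
  imports Defs
begin

text \<open>
  Why radial maps cannot beat the identity: for any linear map \<open>L\<close> of the plane \<open>|tr L| \<le> sqrt 2 * |L|\<close>, so the energy
  of \<open>h\<close> is at least \<open>1 / sqrt 2\<close> times the integral of \<open>\<bar>div h\<bar>\<close>. The integral of the divergence
  is a null Lagrangian: it is determined by boundary values. A radial homeomorphism satisfies, up to a
  global sign \<open>\<sigma>\<close>, \<open>\<sigma> h(x) - x \<rightarrow> 0\<close> at both boundary components, whence \<open>\<sigma> div h\<close> has the same integral as
  \<open>div x = 2\<close>, namely \<open>2 \<pi>\<close>. For Sobolev maps this is done weakly, by testing with radial cutoff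
  functions (\<open>trace_integrals_tendsto\<close>, \<open>radial_map_aligned\<close>). The tangent inequality of
  \<open>y \<mapsto> y powr p\<close> at \<open>sqrt 2\<close> then gives \<open>\<pi> * sqrt 2 powr p\<close> as a lower bound for every exponent
  (\<open>radial_energy_ge\<close>); the identity attains it.

  Why other maps can do better: a nonradial map may send most points of every circle \<open>|x| = t\<close> to nearly one point
  and use a short arc to run to a neighbourhood of the origin, around it and back. The image
  of the circle is then a thin loop of length about \<open>2 t powr a\<close>, instead of a circle, and radial
  stretching costs little when \<open>a\<close> is small. With \<open>u = x / |x|\<close>, such maps are
    \<open>h(x) = |x| powr (a + c (1 - Re w)) w\<close>, where \<open>w = (u + b) / (1 + b u)\<close>.
  The Moebius transformation \<open>u \<mapsto> w\<close> pushes the circle towards \<open>1\<close> as \<open>b \<rightarrow> 1\<close>, and a large \<open>c\<close>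
  makes the loops thin. Each of these maps is an explicit homeomorphism of the punctured disk,
  smooth off the origin, and deforms to the identity through maps of the same kind, which yields the
  orientation (\<open>orientation_preserving_squeeze\<close>). In polar coordinates the energy integral is bounded in
  closed form by \<open>2 \<pi> a / (a + 1) + 4 \<pi> c (1 - b) + 2 / (1 + a) + 2 \<pi> / sqrt (1 + 2 c)\<close>
  (\<open>integral_hs_norm_squeeze_le\<close>). For \<open>a \<rightarrow> 0\<close>, \<open>c \<rightarrow> \<infinity>\<close>, \<open>c (1 - b) \<rightarrow> 0\<close> the bound
  tends to \<open>2\<close>.

  Why the gap persists for larger exponents: for \<open>a = 11/10\<close> and suitable \<open>b\<close>, \<open>c\<close> the differential is bounded, by \<open>L\<close> say, while the bound
  above is still less than \<open>sqrt 2 * \<pi>\<close>. Since the \<open>p\<close>-energy is at most \<open>L powr (p - 1)\<close> times the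
  \<open>1\<close>-energy, the strict inequality persists for \<open>p\<close> near \<open>1\<close>.

  Weak differentials are determined only almost everywhere, so two facts link the energy to classical
  derivatives: a continuously differentiable map has its derivative as a weak differential
  (\<open>C1_has_weak_differential\<close>), and any two weak differentials agree almost everywhere
  (\<open>weak_differential_unique\<close>).
\<close>

section \<open>Smooth functions built from a flat function\<close>

text \<open>For \<open>P = 1\<close> this is the standard function vanishing to infinite order at \<open>0\<close>. The polynomial
  factor makes the family closed under differentiation.\<close>

definition flat :: "real poly \<Rightarrow> real \<Rightarrow> real" where
  "flat P t = (if t > 0 then poly P (inverse t) * exp (- inverse t) else 0)"

lemma poly_times_exp_minus_tendsto_0:
  "((\<lambda>y::real. poly P y * exp (- y)) \<longlongrightarrow> 0) at_top"
proof -
  have "((\<lambda>y::real. \<Sum>i\<le>degree P. coeff P i * (y ^ i / exp y)) \<longlongrightarrow> (\<Sum>i\<le>degree P. coeff P i * 0)) at_top"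
    by (intro tendsto_intros tendsto_power_div_exp_0)
  moreover have "(\<Sum>i\<le>degree P. coeff P i * (y ^ i / exp y)) = poly P y * exp (- y)" for y
    unfolding poly_altdef exp_minus divide_inverse sum_distrib_right by (simp only: mult.assoc)
  ultimately show ?thesis by simp
qed

lemma flat_has_real_derivative:
  "(flat P has_real_derivative flat ([:0,0,1:] * (P - pderiv P)) t) (at t)"
proof -
  let ?Q = "[:0,0,1:] * (P - pderiv P)"
  consider "t > 0" | "t < 0" | "t = 0" by linarith
  then show ?thesis
  proof cases
    case 1
    have "((\<lambda>t. poly P (inverse t) * exp (- inverse t)) has_real_derivative flat ?Q t) (at t)"
      using 1 unfolding flat_def
      by (auto intro!: derivative_eq_intros poly_DERIV DERIV_chain2[OF poly_DERIV]
          simp: field_simps power2_eq_square)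
    moreover have "\<forall>\<^sub>F s in nhds t. flat P s = poly P (inverse s) * exp (- inverse s)"
      using eventually_nhds_in_open[of "{0<..}" t] 1 by (auto elim!: eventually_mono simp: flat_def)
    ultimately show ?thesis
      by (subst DERIV_cong_ev[OF refl _ refl])
  next
    case 2
    have "\<forall>\<^sub>F s in nhds t. flat P s = 0"
      using eventually_nhds_in_open[of "{..<0}" t] 2 by (auto elim!: eventually_mono simp: flat_def)
    moreover have "((\<lambda>t. 0) has_real_derivative flat ?Q t) (at t)"
      using 2 by (simp add: flat_def)
    ultimately show ?thesis
      by (subst DERIV_cong_ev[OF refl _ refl])
  next
    case 3
    have "((\<lambda>s. poly (pCons 0 P) (inverse s) * exp (- inverse s)) \<longlongrightarrow> 0) (at_right 0)"
      using filterlim_compose[OF poly_times_exp_minus_tendsto_0 filterlim_inverse_at_top_right] .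
    then have "((\<lambda>s. flat P s / s) \<longlongrightarrow> 0) (at_right 0)"
      by (rule Lim_transform_eventually)
        (auto simp: eventually_at_right_field flat_def field_simps intro!: exI[of _ 1])
    moreover have "((\<lambda>s. flat P s / s) \<longlongrightarrow> 0) (at_left 0)"
      by (rule tendsto_eventually) (auto simp: eventually_at_left_field flat_def intro!: exI[of _ "-1"])
    ultimately have "((\<lambda>s. flat P s / s) \<longlongrightarrow> 0) (at 0)"
      by (simp add: filterlim_split_at)
    then show ?thesis using 3 by (simp add: DERIV_def flat_def)
  qed
qed

text \<open>A class of functions that contains the needed cutoffs and is, by its very form, closed under
  partial derivatives; membership therefore implies differentiability of every order.\<close>

inductive smooth :: "('a::euclidean_space \<Rightarrow> real) \<Rightarrow> bool" where
  smooth_const: "smooth (\<lambda>x. c)"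
| smooth_inner: "smooth (\<lambda>x. x \<bullet> a)"
| smooth_add: "smooth f \<Longrightarrow> smooth g \<Longrightarrow> smooth (\<lambda>x. f x + g x)"
| smooth_mult: "smooth f \<Longrightarrow> smooth g \<Longrightarrow> smooth (\<lambda>x. f x * g x)"
| smooth_inverse: "smooth f \<Longrightarrow> (\<And>x. f x \<noteq> 0) \<Longrightarrow> smooth (\<lambda>x. inverse (f x))"
| smooth_flat: "smooth f \<Longrightarrow> smooth (\<lambda>x. flat P (f x))"

text \<open>Each rule of the class is matched by a differentiation rule whose result is again built by the rules.\<close>

lemma smooth_has_smooth_derivative:
  assumes "smooth f"
  shows "\<exists>f'. \<forall>x. (f has_derivative f' x) (at x) \<and> (\<forall>b. smooth (\<lambda>x. f' x b))"
  using assms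
proof induction
  case (smooth_const c)
  show ?case by (rule exI[of _ "\<lambda>x b. 0"]) (auto intro: smooth.intros)
next
  case (smooth_inner a)
  show ?case
    by (rule exI[of _ "\<lambda>x b. b \<bullet> a"]) (auto intro!: derivative_eq_intros smooth.intros)
next
  case (smooth_add f g)
  then obtain f' g' where "\<And>x. (f has_derivative f' x) (at x)" "\<And>b. smooth (\<lambda>x. f' x b)"
    "\<And>x. (g has_derivative g' x) (at x)" "\<And>b. smooth (\<lambda>x. g' x b)" by blast
  then show ?case
    by (intro exI[of _ "\<lambda>x b. f' x b + g' x b"]) (auto intro!: derivative_eq_intros smooth.intros)
next
  case (smooth_mult f g)
  then obtain f' g' where "\<And>x. (f has_derivative f' x) (at x)" "\<And>b. smooth (\<lambda>x. f' x b)"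
    "\<And>x. (g has_derivative g' x) (at x)" "\<And>b. smooth (\<lambda>x. g' x b)" by blast
  then show ?case using smooth_mult
    by (intro exI[of _ "\<lambda>x b. f x * g' x b + f' x b * g x"]) (auto intro!: derivative_eq_intros smooth.intros)
next
  case (smooth_inverse f)
  then obtain f' where f': "\<And>x. (f has_derivative f' x) (at x)" "\<And>b. smooth (\<lambda>x. f' x b)" by blast
  have "smooth (\<lambda>x. (- 1) * (inverse (f x) * f' x b * inverse (f x)))" for b
    by (intro smooth.intros smooth_inverse f')
  moreover have "((\<lambda>x. inverse (f x)) has_derivative (\<lambda>b. (- 1) * (inverse (f x) * f' x b * inverse (f x)))) (at x)" for x
    using f'(1)[of x] smooth_inverse(2)[of x] by (auto intro!: derivative_eq_intros)
  ultimately show ?case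
    by (intro exI[of _ "\<lambda>x b. (- 1) * (inverse (f x) * f' x b * inverse (f x))"]) auto
next
  case (smooth_flat f P)
  then obtain f' where f': "\<And>x. (f has_derivative f' x) (at x)" "\<And>b. smooth (\<lambda>x. f' x b)" by blast
  have "((\<lambda>x. flat P (f x)) has_derivative (\<lambda>b. f' x b * flat ([:0,0,1:] * (P - pderiv P)) (f x))) (at x)" for x
    using has_derivative_compose[OF f'(1)[of x] flat_has_real_derivative[of P "f x", unfolded has_field_derivative_def]]
    by (simp add: mult.commute)
  moreover have "smooth (\<lambda>x. f' x b * flat ([:0,0,1:] * (P - pderiv P)) (f x))" for b
    by (intro smooth.intros smooth_flat f')
  ultimately show ?case
    by (intro exI[of _ "\<lambda>x b. f' x b * flat ([:0,0,1:] * (P - pderiv P)) (f x)"]) auto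
qed

lemma smooth_imp_Ck: "smooth f \<Longrightarrow> Ck k f"
proof (induction k arbitrary: f)
  case 0
  then obtain f' where "\<And>x. (f has_derivative f' x) (at x)"
    using smooth_has_smooth_derivative by blast
  then show ?case
    by (auto intro!: continuous_at_imp_continuous_on has_derivative_continuous)
next
  case (Suc k)
  then obtain f' where f': "\<And>x. (f has_derivative f' x) (at x)" "\<And>b. smooth (\<lambda>x. f' x b)"
    using smooth_has_smooth_derivative by blast
  have "frechet_derivative f (at x) = f' x" for x
    using frechet_derivative_at[OF f'(1)] by metis
  then show ?case using f' Suc.IH by (auto simp: differentiable_def)
qed

lemma smooth_prod:
  assumes "finite A" "\<And>i. i \<in> A \<Longrightarrow> smooth (f i)"
  shows "smooth (\<lambda>x. \<Prod>i\<in>A. f i x)"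
  using assms by (induction A rule: finite_induct) (auto intro: smooth.intros)

lemma smooth_diff: "smooth f \<Longrightarrow> smooth g \<Longrightarrow> smooth (\<lambda>x. f x - g x)"
  using smooth_add[OF _ smooth_mult[OF smooth_const[of "-1"]], of f g] by simp

lemma flat_1_bounds: "0 \<le> flat 1 t" "flat 1 t \<le> 1"
  by (auto simp: flat_def)

lemma flat_1_pos_iff: "flat 1 t > 0 \<longleftrightarrow> t > 0"
  by (auto simp: flat_def)

lemma smooth_imp_test_function:
  assumes "smooth \<phi>" "compact K" "K \<subseteq> U" "\<And>x. \<phi> x \<noteq> 0 \<Longrightarrow> x \<in> K"
  shows "test_function U \<phi>"
proof -
  have "closure {x. \<phi> x \<noteq> 0} \<subseteq> K"
    using assms compact_imp_closed by (intro closure_minimal) auto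
  moreover from this have "compact (closure {x. \<phi> x \<noteq> 0})"
    using compact_Int_closed[OF assms(2) closed_closure, of "{x. \<phi> x \<noteq> 0}"] by (simp add: inf.absorb2)
  ultimately show ?thesis
    using assms(1,3) smooth_imp_Ck unfolding test_function_def by blast
qed

text \<open>Products of the functions \<open>t \<mapsto> exp (- 1 / (n t))\<close> of the distances to the faces: each factor
  increases to \<open>1\<close> on the open half-line where it is positive.\<close>

lemma indicator_box_limit_of_test_functions:
  fixes a c :: "'a::euclidean_space"
  assumes "cbox a c \<subseteq> U"
  obtains \<phi> :: "nat \<Rightarrow> 'a \<Rightarrow> real"
  where "\<And>n. test_function U (\<phi> n)"
    and "\<And>n x. 0 \<le> \<phi> n x" and "\<And>n x. \<phi> n x \<le> indicator (box a c) x"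
    and "\<And>x. (\<lambda>n. \<phi> n x) \<longlonglongrightarrow> indicator (box a c) x"
proof -
  define \<phi> where "\<phi> n x = (\<Prod>b\<in>Basis. flat 1 (real (Suc n) * (x \<bullet> b - a \<bullet> b)) * flat 1 (real (Suc n) * (c \<bullet> b - x \<bullet> b)))" for n and x :: 'a
  have out: "\<phi> n x = 0" if "x \<notin> box a c" for n x
  proof -
    obtain b where b: "b \<in> Basis" "\<not> (a \<bullet> b < x \<bullet> b \<and> x \<bullet> b < c \<bullet> b)"
      using \<open>x \<notin> box a c\<close> by (auto simp: box_def)
    then have "flat 1 (real (Suc n) * (x \<bullet> b - a \<bullet> b)) * flat 1 (real (Suc n) * (c \<bullet> b - x \<bullet> b)) = 0"
      by (auto simp: flat_def zero_less_mult_iff simp del: of_nat_Suc)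
    then show ?thesis unfolding \<phi>_def using b(1) finite_Basis by (meson prod_zero)
  qed
  have sm: "smooth (\<phi> n)" for n
    unfolding \<phi>_def by (intro smooth_prod finite_Basis smooth.intros smooth_diff)
  have "test_function U (\<phi> n)" for n
  proof (rule smooth_imp_test_function[OF sm compact_cbox assms])
    show "x \<in> cbox a c" if "\<phi> n x \<noteq> 0" for x
      using out[of x n] that box_subset_cbox by auto
  qed
  moreover have "0 \<le> \<phi> n x" for n x
    unfolding \<phi>_def by (intro prod_nonneg mult_nonneg_nonneg flat_1_bounds ballI)
  moreover have "\<phi> n x \<le> indicator (box a c) x" for n x
  proof (cases "x \<in> box a c")
    case True
    have "\<phi> n x \<le> 1"
      unfolding \<phi>_def by (intro prod_le_1 conjI mult_nonneg_nonneg mult_le_one flat_1_bounds)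
    then show ?thesis using True by simp
  qed (simp add: out)
  moreover have "(\<lambda>n. \<phi> n x) \<longlonglongrightarrow> indicator (box a c) x" for x
  proof (cases "x \<in> box a c")
    case True
    have lim: "(\<lambda>n. flat 1 (real (Suc n) * t)) \<longlonglongrightarrow> 1" if "t > 0" for t
    proof -
      have "(\<lambda>n. exp (- (inverse (real (Suc n)) * inverse t))) \<longlonglongrightarrow> exp (- (0 * inverse t))"
        by (intro tendsto_intros LIMSEQ_inverse_real_of_nat)
      then show ?thesis using that by (simp add: flat_def zero_less_mult_iff del: of_nat_Suc)
    qed
    have "(\<lambda>n. \<phi> n x) \<longlonglongrightarrow> (\<Prod>b\<in>(Basis::'a set). 1 * 1)"
      unfolding \<phi>_def using True by (intro tendsto_intros lim) (auto simp: box_def)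
    then show ?thesis using True by simp
  qed (simp add: out)
  ultimately show ?thesis by (rule that)
qed

text \<open>The usual quotient that rises smoothly from \<open>0\<close> at \<open>t = 0\<close> to \<open>1\<close> at \<open>t = 1\<close>.\<close>

definition smooth_step :: "real \<Rightarrow> real" where
  "smooth_step t = flat 1 t * inverse (flat 1 t + flat 1 (1 - t))"

lemma smooth_step_denominator_pos: "flat 1 t + flat 1 (1 - t) > 0"
  using flat_1_bounds(1)[of t] flat_1_bounds(1)[of "1-t"] flat_1_pos_iff[of t] flat_1_pos_iff[of "1-t"]
  by (cases "t > 0") (auto intro: add_pos_nonneg add_nonneg_pos)

lemma smooth_smooth_step: "smooth f \<Longrightarrow> smooth (\<lambda>x. smooth_step (f x))"
  unfolding smooth_step_def
  by (intro smooth.intros smooth_diff) (use smooth_step_denominator_pos in \<open>auto simp: less_le\<close>)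

lemma smooth_step_eq_0: "t \<le> 0 \<Longrightarrow> smooth_step t = 0"
  by (simp add: smooth_step_def flat_def)

lemma smooth_step_eq_1: "t \<ge> 1 \<Longrightarrow> smooth_step t = 1"
  by (simp add: smooth_step_def flat_def)

lemma smooth_step_bounds: "0 \<le> smooth_step t" "smooth_step t \<le> 1"
  using smooth_step_denominator_pos[of t] flat_1_bounds(1)[of t] flat_1_bounds(1)[of "1-t"]
  by (auto simp: smooth_step_def field_simps)

lemma smooth_step_derivative_bounded:
  obtains s' M where "\<And>t. (smooth_step has_real_derivative s' t) (at t)" "\<And>t. \<bar>s' t\<bar> \<le> M"
    "\<And>t. t \<notin> {0..1} \<Longrightarrow> s' t = 0"
proof -
  have "smooth (\<lambda>t::real. smooth_step (t \<bullet> 1))"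
    by (intro smooth_smooth_step smooth.intros)
  then have "smooth smooth_step" by simp
  from smooth_has_smooth_derivative[OF this]
  obtain D where D: "\<And>t. (smooth_step has_derivative D t) (at t)" "\<And>b. smooth (\<lambda>t. D t b)" by blast
  let ?s' = "\<lambda>t. D t 1"
  have der: "(smooth_step has_real_derivative ?s' t) (at t)" for t
  proof -
    have "D t x = D t 1 * x" for x
      using linear_scale[OF has_derivative_linear[OF D(1)[of t]], of x 1] by simp
    then have "D t = (*) (D t 1)" by blast
    then show ?thesis using D(1)[of t] by (simp add: has_field_derivative_def)
  qed
  have "compact (?s' ` {0..1})"
    using smooth_imp_Ck[OF D(2)[of 1], of 0]
    by (intro compact_continuous_image) (auto intro: continuous_on_subset)
  from compact_imp_bounded[OF this]
  obtain M where M: "0 < M" "\<forall>t\<in>{0..1}. \<bar>?s' t\<bar> \<le> M"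
    unfolding bounded_pos by auto
  have zero: "?s' t = 0" if "t \<notin> {0..1}" for t
  proof -
    have "\<exists>c. \<forall>\<^sub>F s in nhds t. smooth_step s = c"
    proof (cases "t < 0")
      case True
      then show ?thesis
        using eventually_nhds_in_open[of "{..<0}" t]
        by (intro exI[of _ 0]) (auto elim!: eventually_mono intro: smooth_step_eq_0)
    next
      case False
      then show ?thesis
        using eventually_nhds_in_open[of "{1<..}" t] that
        by (intro exI[of _ 1]) (auto elim!: eventually_mono intro: smooth_step_eq_1)
    qed
    then obtain c where "\<forall>\<^sub>F s in nhds t. smooth_step s = c" by blast
    then have "((\<lambda>_. c) has_real_derivative ?s' t) (at t)"
      using der[of t] by (subst (asm) DERIV_cong_ev[OF refl _ refl])
    then show ?thesis using DERIV_const DERIV_unique by blast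
  qed
  show ?thesis
    by (rule that[of ?s' M]) (use der M zero in \<open>force+\<close>)
qed

section \<open>Uniqueness of weak differentials\<close>

lemma test_function_continuous: "test_function U \<phi> \<Longrightarrow> continuous_on A \<phi>"
  unfolding test_function_def by (metis Ck.simps(1) continuous_on_subset top_greatest)

lemma test_function_has_derivative:
  assumes "test_function U \<phi>"
  shows "(\<phi> has_derivative frechet_derivative \<phi> (at x)) (at x)"
    and "b \<in> Basis \<Longrightarrow> continuous_on A (\<lambda>x. frechet_derivative \<phi> (at x) b)"
proof -
  have "Ck (Suc 0) \<phi>" using assms unfolding test_function_def by blast
  then show "(\<phi> has_derivative frechet_derivative \<phi> (at x)) (at x)"
    "b \<in> Basis \<Longrightarrow> continuous_on A (\<lambda>x. frechet_derivative \<phi> (at x) b)"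
    by (auto simp: frechet_derivative_works[symmetric] intro: continuous_on_subset)
qed

lemma test_function_support:
  assumes "test_function U \<phi>"
  obtains K where "compact K" "K \<subseteq> U" "\<And>x. x \<notin> K \<Longrightarrow> \<phi> x = 0"
proof
  show "\<phi> x = 0" if "x \<notin> closure {x. \<phi> x \<noteq> 0}" for x
    using closure_subset[of "{x. \<phi> x \<noteq> 0}"] that by blast
qed (use assms in \<open>auto simp: test_function_def\<close>)

lemma continuous_imp_locally_integrable:
  fixes f :: "'a::euclidean_space \<Rightarrow> 'b::euclidean_space"
  assumes "continuous_on U f"
  shows "locally_integrable U f"
  unfolding locally_integrable_def set_integrable_def
proof (intro allI impI, elim conjE)
  fix K assume "compact K" "K \<subseteq> U"
  then have "integrable lborel (\<lambda>x. indicator K x *\<^sub>R f x)"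
    using assms by (intro borel_integrable_compact) (auto intro: continuous_on_subset)
  then show "integrable lebesgue (\<lambda>x. indicator K x *\<^sub>R f x)"
    by (simp add: integrable_completion borel_measurable_integrable)
qed

lemma compact_support_mult_integrable:
  fixes f :: "'a::euclidean_space \<Rightarrow> 'b::euclidean_space"
  assumes \<phi>: "continuous_on UNIV \<phi>" and K: "compact K" "K \<subseteq> U" "\<And>x. x \<notin> K \<Longrightarrow> \<phi> x = 0"
    and f: "locally_integrable U f"
  shows "set_integrable lebesgue U (\<lambda>x. \<phi> x *\<^sub>R f x)"
proof -
  have "compact (\<phi> ` K)"
    by (intro compact_continuous_image continuous_on_subset[OF \<phi>] K) auto
  from compact_imp_bounded[OF this] obtain B where B: "\<And>x. x \<in> K \<Longrightarrow> \<bar>\<phi> x\<bar> \<le> B"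
    unfolding bounded_iff by auto
  have int: "integrable lebesgue (\<lambda>x. indicator K x *\<^sub>R f x)"
    using f K unfolding locally_integrable_def set_integrable_def by blast
  have eq: "indicator U x *\<^sub>R \<phi> x *\<^sub>R f x = \<phi> x *\<^sub>R indicator K x *\<^sub>R f x" for x
    using K by (auto simp: indicator_def)
  have "integrable lebesgue (\<lambda>x. \<phi> x *\<^sub>R indicator K x *\<^sub>R f x)"
  proof (rule Bochner_Integration.integrable_bound)
    show "integrable lebesgue (\<lambda>x. B *\<^sub>R indicator K x *\<^sub>R f x)"
      using int by (intro integrable_scaleR_right)
    have "\<phi> \<in> borel_measurable borel"
      by (intro borel_measurable_continuous_onI \<phi>)
    then have "\<phi> \<in> borel_measurable lebesgue"
      by (simp add: measurable_completion)
    then show "(\<lambda>x. \<phi> x *\<^sub>R indicator K x *\<^sub>R f x) \<in> borel_measurable lebesgue"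
      using borel_measurable_integrable[OF int] by (rule borel_measurable_scaleR)
    show "AE x in lebesgue. norm (\<phi> x *\<^sub>R indicator K x *\<^sub>R f x) \<le> norm (B *\<^sub>R indicator K x *\<^sub>R f x)"
    proof (rule AE_I2)
      fix x
      show "norm (\<phi> x *\<^sub>R indicator K x *\<^sub>R f x) \<le> norm (B *\<^sub>R indicator K x *\<^sub>R f x)"
        using B[of x] by (cases "x \<in> K") (auto intro!: mult_right_mono)
    qed
  qed
  then show ?thesis unfolding set_integrable_def eq .
qed

lemma test_function_mult_integrable:
  fixes f :: "'a::euclidean_space \<Rightarrow> 'b::euclidean_space"
  assumes \<phi>: "test_function U \<phi>" and f: "locally_integrable U f"
  shows "set_integrable lebesgue U (\<lambda>x. \<phi> x *\<^sub>R f x)"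
  by (rule test_function_support[OF \<phi>])
    (rule compact_support_mult_integrable[OF test_function_continuous[OF \<phi>] _ _ _ f])

text \<open>Dominated convergence, with test functions increasing to the indicator of the box.\<close>

lemma integral_box_eq_0_if_test_integrals_0:
  fixes f :: "'a::euclidean_space \<Rightarrow> 'b::euclidean_space"
  assumes f: "locally_integrable U f"
    and 0: "\<And>\<phi>. test_function U \<phi> \<Longrightarrow> (LINT x:U|lebesgue. \<phi> x *\<^sub>R f x) = 0"
    and ac: "cbox a c \<subseteq> U"
  shows "(LINT x:box a c|lebesgue. f x) = 0"
proof (rule indicator_box_limit_of_test_functions[OF ac])
  fix \<phi> :: "nat \<Rightarrow> 'a \<Rightarrow> real"
  assume \<phi>: "\<And>n. test_function U (\<phi> n)" "\<And>n x. 0 \<le> \<phi> n x"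
    "\<And>n x. \<phi> n x \<le> indicator (box a c) x" "\<And>x. (\<lambda>n. \<phi> n x) \<longlonglongrightarrow> indicator (box a c) x"
  have int: "integrable lebesgue (\<lambda>x. indicator (cbox a c) x *\<^sub>R f x)"
    using f ac compact_cbox[of a c] by (simp add: locally_integrable_def set_integrable_def)
  have "(\<lambda>n. \<integral>x. indicator U x *\<^sub>R \<phi> n x *\<^sub>R f x \<partial>lebesgue) \<longlonglongrightarrow> (\<integral>x. indicator (box a c) x *\<^sub>R f x \<partial>lebesgue)"
  proof (rule integral_dominated_convergence)
    show "integrable lebesgue (\<lambda>x. norm (indicator (cbox a c) x *\<^sub>R f x))"
      using int by (rule integrable_norm)
    show "(\<lambda>x. indicator U x *\<^sub>R \<phi> n x *\<^sub>R f x) \<in> borel_measurable lebesgue" for n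
      using test_function_mult_integrable[OF \<phi>(1) f] unfolding set_integrable_def
      by (rule borel_measurable_integrable)
    have "(\<lambda>x. indicator (box a c) x *\<^sub>R indicator (cbox a c) x *\<^sub>R f x) \<in> borel_measurable lebesgue"
      by (rule borel_measurable_scaleR[OF _ borel_measurable_integrable[OF int]])
        (simp add: borel_measurable_indicator)
    moreover have "indicator (box a c) x *\<^sub>R indicator (cbox a c) x *\<^sub>R f x = indicator (box a c) x *\<^sub>R f x" for x
      using box_subset_cbox[of a c] by (auto simp: indicator_def)
    ultimately show "(\<lambda>x. indicator (box a c) x *\<^sub>R f x) \<in> borel_measurable lebesgue"
      by (simp only:)
    have "(\<lambda>n. indicator U x *\<^sub>R \<phi> n x *\<^sub>R f x) \<longlonglongrightarrow> indicator U x *\<^sub>R indicator (box a c) x *\<^sub>R f x" for x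
      by (intro tendsto_intros \<phi>)
    moreover have "indicator U x *\<^sub>R indicator (box a c) x *\<^sub>R f x = indicator (box a c) x *\<^sub>R f x" for x
      using box_subset_cbox[of a c] ac by (auto simp: indicator_def)
    ultimately show "AE x in lebesgue. (\<lambda>n. indicator U x *\<^sub>R \<phi> n x *\<^sub>R f x) \<longlonglongrightarrow> indicator (box a c) x *\<^sub>R f x"
      by (intro AE_I2) (simp only:)
    show "AE x in lebesgue. norm (indicator U x *\<^sub>R \<phi> n x *\<^sub>R f x) \<le> norm (indicator (cbox a c) x *\<^sub>R f x)" for n
    proof (rule AE_I2)
      fix x
      show "norm (indicator U x *\<^sub>R \<phi> n x *\<^sub>R f x) \<le> norm (indicator (cbox a c) x *\<^sub>R f x)"
      proof -
        have "\<phi> n x \<le> indicator (cbox a c) x"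
          using \<phi>(3)[of n x] box_subset_cbox[of a c]
          by (cases "x \<in> box a c"; cases "x \<in> cbox a c"; auto)
        then have "\<phi> n x * norm (f x) \<le> indicator (cbox a c) x * norm (f x)"
          by (rule mult_right_mono) simp
        then show ?thesis
          using \<phi>(2)[of n x] by (cases "x \<in> U") simp_all
      qed
    qed
  qed
  moreover have "(\<integral>x. indicator U x *\<^sub>R \<phi> n x *\<^sub>R f x \<partial>lebesgue) = 0" for n
    using 0[OF \<phi>(1)] by (simp add: set_lebesgue_integral_def)
  ultimately show ?thesis
    using LIMSEQ_unique[OF _ tendsto_const] by (simp add: set_lebesgue_integral_def)
qed

lemma sigma_finite_lebesgue: "sigma_finite_measure (lebesgue :: 'a::euclidean_space measure)"
proof
  obtain A :: "'a set set" where "countable A" "A \<subseteq> sets lborel" "\<Union>A = space lborel"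
    "\<forall>a\<in>A. emeasure lborel a \<noteq> \<infinity>"
    using lborel.sigma_finite_countable by blast
  then show "\<exists>A::'a set set. countable A \<and> A \<subseteq> sets lebesgue \<and> \<Union>A = space lebesgue \<and>
      (\<forall>a\<in>A. emeasure lebesgue a \<noteq> \<infinity>)"
    by (intro exI[of _ A]) auto
qed

text \<open>Boxes form an intersection-stable generator, so the integral vanishes over all Borel sets, and hence
  over all Lebesgue measurable ones, which differ from Borel sets by null sets.\<close>

lemma AE_eq_0_if_box_integrals_0:
  fixes g :: "'a::euclidean_space \<Rightarrow> 'b::euclidean_space"
  assumes g: "integrable lebesgue g"
    and box: "\<And>a c. (LINT x:box a c|lebesgue. g x) = 0"
    and all: "(\<integral>x. g x \<partial>lebesgue) = 0"
  shows "AE x in lebesgue. g x = 0"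
proof (rule sigma_finite_measure.density_zero[OF sigma_finite_lebesgue g])
  fix A :: "'a set" assume A: "A \<in> sets lebesgue"
  have si: "set_integrable lebesgue B g" if "B \<in> sets lebesgue" for B
    unfolding set_integrable_def using that g by (rule integrable_mult_indicator)
  have sigma_box: "B \<in> sets lebesgue" if "B \<in> sigma_sets UNIV (range (\<lambda>(a, b). box a b :: 'a set))" for B
  proof -
    have "sets (borel :: 'a measure) = sigma_sets UNIV (range (\<lambda>(a, b). box a b :: 'a set))"
      by (subst borel_eq_box) simp
    then have "B \<in> sets borel" using that by simp
    then show ?thesis by auto
  qed
  have borel: "(LINT x:B|lebesgue. g x) = 0" if "B \<in> sets borel" for B
  proof -
    have "B \<in> sigma_sets UNIV (range (\<lambda>(a, b). box a b :: 'a set))"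
      using that by (simp add: borel_eq_box)
    then show ?thesis
    proof (induction rule: sigma_sets_induct_disjoint[rotated 2, consumes 1, case_names basic empty compl union Int closed])
      case (basic B)
      then show ?case using box by auto
    next
      case empty
      show ?case by (simp add: set_lebesgue_integral_def)
    next
      case (compl B)
      then have B: "B \<in> sets lebesgue" by (simp add: sigma_box)
      have "(LINT x:(UNIV - B) \<union> B|lebesgue. g x) = (LINT x:UNIV - B|lebesgue. g x) + (LINT x:B|lebesgue. g x)"
        using B by (intro set_integral_Un si) auto
      then show ?case using all compl by (simp add: set_lebesgue_integral_def)
    next
      case (union B)
      then have B: "B i \<in> sets lebesgue" for i using sigma_box by blast
      have "(LINT x:\<Union>(range B)|lebesgue. g x) = (\<Sum>i. LINT x:B i|lebesgue. g x)"
        using union B by (intro lebesgue_integral_countable_add si) (auto simp: disjoint_family_on_def)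
      then show ?case using union by simp
    next
      case Int
      show ?case by (auto simp: Int_stable_def box_Int_box)
    next
      case closed
      show ?case by auto
    qed
  qed
  \<comment> \<open>pass from Borel to Lebesgue measurable sets\<close>
  obtain C T where C: "C \<in> sets borel" and T: "negligible T" and CT: "C \<union> T = A"
    by (rule sets_lebesgue_almost_borel[OF A]) (rule that)
  have "AE x in lebesgue. x \<notin> T"
    by (intro AE_not_in) (use T in \<open>simp add: negligible_iff_null_sets\<close>)
  then have "AE x in lebesgue. indicat_real A x *\<^sub>R g x = indicat_real C x *\<^sub>R g x"
    by eventually_elim (use CT in \<open>auto simp: indicator_def\<close>)
  then have "(LINT x:A|lebesgue. g x) = (LINT x:C|lebesgue. g x)"
    using si[OF A] si[of C] C unfolding set_lebesgue_integral_def set_integrable_def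
    by (intro integral_cong_AE borel_measurable_integrable) auto
  then show "(LINT x:A|lebesgue. g x) = 0"
    using borel[OF C] by simp
qed

text \<open>The fundamental lemma of the calculus of variations: an open set is a countable union of closed
  boxes, and on each of them the two preceding lemmas apply.\<close>

lemma AE_eq_0_if_test_integrals_0:
  fixes f :: "'a::euclidean_space \<Rightarrow> 'b::euclidean_space"
  assumes "open U" and f: "locally_integrable U f"
    and 0: "\<And>\<phi>. test_function U \<phi> \<Longrightarrow> (LINT x:U|lebesgue. \<phi> x *\<^sub>R f x) = 0"
  shows "AE x in lebesgue. x \<in> U \<longrightarrow> f x = 0"
proof -
  obtain \<D> where \<D>: "countable \<D>" "\<D> \<subseteq> Pow U" "\<And>X. X \<in> \<D> \<Longrightarrow> \<exists>a b. X = cbox a b" "\<Union>\<D> = U"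
    using open_countable_Union_open_cbox[OF \<open>open U\<close>] by metis
  have "AE x in lebesgue. x \<in> X \<longrightarrow> f x = 0" if X\<D>: "X \<in> \<D>" for X
  proof -
    obtain a c where X: "X = cbox a c" using \<D>(3)[OF X\<D>] by auto
    then have ac: "cbox a c \<subseteq> U" using \<D> X\<D> by blast
    let ?g = "\<lambda>x. indicator (box a c) x *\<^sub>R f x"
    have "integrable lebesgue (\<lambda>x. indicator (box a c) x *\<^sub>R indicator (cbox a c) x *\<^sub>R f x)"
      using f ac unfolding locally_integrable_def set_integrable_def
      by (intro integrable_mult_indicator[of "box a c"]) auto
    moreover have "indicator (box a c) x *\<^sub>R indicator (cbox a c) x *\<^sub>R f x = ?g x" for x
      using box_subset_cbox[of a c] by (auto simp: indicator_def)
    ultimately have g: "integrable lebesgue ?g" by (simp only:)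
    have "AE x in lebesgue. ?g x = 0"
    proof (rule AE_eq_0_if_box_integrals_0[OF g])
      show "(\<integral>x. ?g x \<partial>lebesgue) = 0"
        using integral_box_eq_0_if_test_integrals_0[OF f 0 ac] by (simp add: set_lebesgue_integral_def)
      fix d e :: 'a
      obtain a' c' where ac': "box a c \<inter> box d e = box a' c'" "cbox a' c' \<subseteq> cbox a c"
      proof
        show "box a c \<inter> box d e = box (\<Sum>i\<in>Basis. max (a \<bullet> i) (d \<bullet> i) *\<^sub>R i) (\<Sum>i\<in>Basis. min (c \<bullet> i) (e \<bullet> i) *\<^sub>R i)"
          by (rule box_Int_box)
        show "cbox (\<Sum>i\<in>Basis. max (a \<bullet> i) (d \<bullet> i) *\<^sub>R i) (\<Sum>i\<in>Basis. min (c \<bullet> i) (e \<bullet> i) *\<^sub>R i) \<subseteq> cbox a c"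
          by (auto simp: mem_box)
      qed
      have "(LINT x:box d e|lebesgue. ?g x) = (LINT x:box a' c'|lebesgue. f x)"
        unfolding set_lebesgue_integral_def ac'(1)[symmetric]
        by (intro Bochner_Integration.integral_cong) (auto simp: indicator_def)
      also have "\<dots> = 0"
        using ac' ac by (intro integral_box_eq_0_if_test_integrals_0[OF f 0]) auto
      finally show "(LINT x:box d e|lebesgue. ?g x) = 0" .
    qed
    moreover have "AE x in lebesgue. x \<notin> cbox a c - box a c"
      using negligible_frontier_interval[of a c] by (intro AE_not_in) (simp add: negligible_iff_null_sets)
    ultimately show ?thesis
    proof eventually_elim
      case (elim x)
      then show ?case by (cases "x \<in> box a c") (simp_all add: X)
    qed
  qed
  then have "\<forall>X\<in>\<D>. AE x in lebesgue. x \<in> X \<longrightarrow> f x = 0"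
    by (rule ballI)
  then have "AE x in lebesgue. \<forall>X\<in>\<D>. x \<in> X \<longrightarrow> f x = 0"
    using AE_ball_countable[OF \<D>(1), where M = lebesgue and P = "\<lambda>x X. x \<in> X \<longrightarrow> f x = 0"] by iprover
  then show ?thesis
  proof eventually_elim
    case (elim x)
    show ?case
    proof
      assume "x \<in> U"
      then obtain X where "X \<in> \<D>" "x \<in> X" using \<D>(4) by auto
      then show "f x = 0" using elim by blast
    qed
  qed
qed

lemma locally_integrable_diff:
  "locally_integrable U f \<Longrightarrow> locally_integrable U g \<Longrightarrow> locally_integrable U (\<lambda>x. f x - g x)"
  unfolding locally_integrable_def set_integrable_def scaleR_diff_right
  by (intro allI impI Bochner_Integration.integrable_diff) simp_all

lemma weak_differential_unique:
  assumes "open U" and D: "has_weak_differential h D U" and E: "has_weak_differential h E U"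
    and b: "b \<in> Basis"
  shows "AE x in lebesgue. x \<in> U \<longrightarrow> D x b = E x b"
proof -
  have lD: "locally_integrable U (\<lambda>x. D x b)" and lE: "locally_integrable U (\<lambda>x. E x b)"
    using D E b unfolding has_weak_differential_def by blast+
  have "AE x in lebesgue. x \<in> U \<longrightarrow> D x b - E x b = 0"
  proof (rule AE_eq_0_if_test_integrals_0[OF \<open>open U\<close>])
    show "locally_integrable U (\<lambda>x. D x b - E x b)"
      using lD lE by (rule locally_integrable_diff)
    fix \<phi> assume \<phi>: "test_function U \<phi>"
    have "(LINT x:U|lebesgue. \<phi> x *\<^sub>R (D x b - E x b)) =
      (LINT x:U|lebesgue. \<phi> x *\<^sub>R D x b) - (LINT x:U|lebesgue. \<phi> x *\<^sub>R E x b)"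
      using test_function_mult_integrable[OF \<phi> lD] test_function_mult_integrable[OF \<phi> lE]
      by (simp add: scaleR_diff_right set_integral_diff)
    also have "\<dots> = 0"
    proof -
      have "(LINT x:U|lebesgue. frechet_derivative \<phi> (at x) b *\<^sub>R h x) = - (LINT x:U|lebesgue. \<phi> x *\<^sub>R D x b)"
        "(LINT x:U|lebesgue. frechet_derivative \<phi> (at x) b *\<^sub>R h x) = - (LINT x:U|lebesgue. \<phi> x *\<^sub>R E x b)"
        using D E b \<phi> unfolding has_weak_differential_def by blast+
      then show ?thesis by simp
    qed
    finally show "(LINT x:U|lebesgue. \<phi> x *\<^sub>R (D x b - E x b)) = 0" .
  qed
  then show ?thesis by simp
qed

lemma hs_norm_linear:
  assumes "linear L"
  shows "hs_norm L = sqrt (\<Sum>b\<in>Basis. (norm (L b))\<^sup>2)"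
proof -
  have "adjoint L (L b) \<bullet> b = (norm (L b))\<^sup>2" for b
    using adjoint_works[OF assms, of b "L b"] inner_commute[of "adjoint L (L b)" b]
    unfolding power2_norm_eq_inner by (simp only:)
  then show ?thesis unfolding hs_norm_def by (simp only:)
qed

text \<open>Makes the energy computable: the weak differential chosen in its definition may be replaced by any other one.\<close>

lemma energy_eq:
  assumes "open U" and D: "has_weak_differential h D U"
  shows "energy p U h = (\<integral>\<^sup>+x\<in>U. ennreal (hs_norm (D x) powr p) \<partial>lebesgue)"
proof -
  let ?E = "weak_differential U h"
  have E: "has_weak_differential h ?E U"
    unfolding weak_differential_def by (rule someI[of "\<lambda>D. has_weak_differential h D U", OF D])
  have "AE x in lebesgue. \<forall>b\<in>Basis. x \<in> U \<longrightarrow> ?E x b = D x b"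
    using weak_differential_unique[OF \<open>open U\<close> E D] by (intro AE_finite_allI finite_Basis)
  then have "AE x in lebesgue. x \<in> U \<longrightarrow> hs_norm (?E x) = hs_norm (D x)"
  proof eventually_elim
    case (elim x)
    show ?case
    proof
      assume "x \<in> U"
      then have "linear (?E x)" "linear (D x)" using D E unfolding has_weak_differential_def by blast+
      then show "hs_norm (?E x) = hs_norm (D x)" using elim \<open>x \<in> U\<close> by (simp add: hs_norm_linear)
    qed
  qed
  then have "AE x in lebesgue. ennreal (hs_norm (?E x) powr p) * indicator U x =
      ennreal (hs_norm (D x) powr p) * indicator U x"
  proof eventually_elim
    case (elim x)
    then show ?case by (cases "x \<in> U") simp_all
  qed
  then show ?thesis
    unfolding energy_def by (rule nn_integral_cong_AE)
qed

section \<open>Weak differentials of continuously differentiable maps\<close>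

lemma derivative_eq_0_off_closed_support:
  fixes f :: "'a::euclidean_space \<Rightarrow> 'b::euclidean_space"
  assumes "(f has_derivative f') (at x)" "closed K" "x \<notin> K" "\<And>y. y \<notin> K \<Longrightarrow> f y = 0"
  shows "f' = (\<lambda>v. 0)"
proof -
  have "((\<lambda>y. 0) has_derivative f') (at x)"
    by (rule has_derivative_transform_within_open[OF assms(1), of "- K"]) (use assms in auto)
  then show ?thesis
    using has_derivative_const[of 0 "at x"] has_derivative_unique by blast
qed

lemma compact_support_norm_bounded:
  fixes f :: "'a::euclidean_space \<Rightarrow> 'b::euclidean_space"
  assumes "continuous_on UNIV f" "compact K" "\<And>x. x \<notin> K \<Longrightarrow> f x = 0"
  obtains B where "B \<ge> 0" "\<And>x. norm (f x) \<le> B"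
proof -
  have "compact (f ` K)"
    using assms by (intro compact_continuous_image) (auto intro: continuous_on_subset)
  from compact_imp_bounded[OF this]
  obtain B where B: "B > 0" "\<forall>y\<in>f ` K. norm y \<le> B"
    unfolding bounded_pos by auto
  have "norm (f x) \<le> B" for x
    using B assms(3)[of x] by (cases "x \<in> K") auto
  then show ?thesis using that[of B] B(1) by simp
qed

lemma compact_support_integrable:
  fixes f :: "'a::euclidean_space \<Rightarrow> 'b::euclidean_space"
  assumes "continuous_on K f" "compact K" "\<And>x. x \<notin> K \<Longrightarrow> f x = 0"
  shows "integrable lborel f"
proof -
  have "integrable lborel (\<lambda>x. indicator K x *\<^sub>R f x)"
    using assms by (intro borel_integrable_compact)
  moreover have "indicator K x *\<^sub>R f x = f x" for x
    using assms(3)[of x] by (simp add: indicator_def)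
  ultimately show ?thesis by simp
qed

text \<open>By translation invariance of Lebesgue measure, all difference quotients have integral zero; they
  converge to the derivative and are dominated by its supremum on a compact set.\<close>

lemma integral_directional_derivative_eq_0:
  fixes f :: "'a::euclidean_space \<Rightarrow> 'b::euclidean_space"
  assumes der: "\<And>x. (f has_derivative f' x) (at x)"
    and cont: "continuous_on UNIV (\<lambda>x. f' x b)"
    and K: "compact K" "\<And>x. x \<notin> K \<Longrightarrow> f x = 0"
  shows "(\<integral>x. f' x b \<partial>lborel) = 0"
proof -
  have f'0: "f' x b = 0" if "x \<notin> K" for x
    using derivative_eq_0_off_closed_support[OF der _ that] K compact_imp_closed by metis
  obtain B where B: "B \<ge> 0" "\<And>x. norm (f' x b) \<le> B"
    using compact_support_norm_bounded[OF cont K(1) f'0] by blast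
  have contf: "continuous_on A f" for A
    using der has_derivative_continuous by (blast intro: continuous_at_imp_continuous_on)
  have fint: "integrable lborel f"
    by (rule compact_support_integrable[OF contf K])
  have quot: "norm (f (x + t *\<^sub>R b) - f x) \<le> t * B" if "t > 0" for t x
  proof -
    have "\<exists>s\<in>{0<..<t}. norm (f (x + t *\<^sub>R b) - f (x + 0 *\<^sub>R b)) \<le> norm ((t - 0) *\<^sub>R f' (x + s *\<^sub>R b) b)"
    proof (rule mvt_general[OF that])
      show "continuous_on {0..t} (\<lambda>s. f (x + s *\<^sub>R b))"
        by (intro continuous_on_compose2[OF contf[of UNIV]] continuous_intros) auto
      fix s :: real
      have "((\<lambda>s. f (x + s *\<^sub>R b)) has_derivative (\<lambda>r. f' (x + s *\<^sub>R b) (r *\<^sub>R b))) (at s)"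
        by (rule has_derivative_compose[OF _ der]) (auto intro!: derivative_eq_intros)
      then show "((\<lambda>s. f (x + s *\<^sub>R b)) has_derivative (\<lambda>r. r *\<^sub>R f' (x + s *\<^sub>R b) b)) (at s)"
        by (simp add: linear_scale[OF has_derivative_linear[OF der]])
    qed
    then obtain s where "norm (f (x + t *\<^sub>R b) - f x) \<le> t * norm (f' (x + s *\<^sub>R b) b)"
      using that by auto
    then show ?thesis using B(2)[of "x + s *\<^sub>R b"] that
      by (meson less_imp_le mult_left_mono order_trans)
  qed
  define K' where "K' = (\<lambda>(k, s). k - s *\<^sub>R b) ` (K \<times> {0..1})"
  have K': "compact K'"
    unfolding K'_def case_prod_beta
    by (intro compact_continuous_image compact_Times K continuous_intros) auto
  define t where "t n = inverse (real (Suc n))" for n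
  have t: "t n > 0" "t n \<le> 1" "t \<longlonglongrightarrow> 0" for n
    using LIMSEQ_inverse_real_of_nat unfolding t_def by (simp_all add: inverse_le_1_iff)
  define q where "q n x = inverse (t n) *\<^sub>R (f (x + t n *\<^sub>R b) - f x)" for n x
  have q0: "q n x = 0" if "x \<notin> K'" for n x
  proof -
    have "x \<notin> K" "x + t n *\<^sub>R b \<notin> K"
      using that t(1,2)[of n] unfolding K'_def
      by (force simp: image_iff intro: bexI[of _ "(x, 0)"], force simp: image_iff)
    then show ?thesis using K(2) by (simp add: q_def)
  qed
  have shift: "integrable lborel (\<lambda>x. f (x + c))" "(\<integral>x. f (x + c) \<partial>lborel) = (\<integral>x. f x \<partial>lborel)" for c
  proof -
    have mf: "f \<in> borel_measurable borel"
      by (rule borel_measurable_continuous_onI[OF contf])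
    have d: "(lborel :: 'a measure) = distr lborel borel ((+) c)" by (rule lborel_distr_plus[symmetric])
    show "integrable lborel (\<lambda>x. f (x + c))"
      using fint mf by (subst (asm) d, subst (asm) integrable_distr_eq) (auto simp: add.commute)
    show "(\<integral>x. f (x + c) \<partial>lborel) = (\<integral>x. f x \<partial>lborel)"
      using mf by (subst (2) d, subst integral_distr) (auto simp: add.commute)
  qed
  have "(\<lambda>n. \<integral>x. q n x \<partial>lborel) \<longlonglongrightarrow> (\<integral>x. f' x b \<partial>lborel)"
  proof (rule integral_dominated_convergence)
    show "(\<lambda>x. f' x b) \<in> borel_measurable lborel"
      using cont by (simp add: borel_measurable_continuous_onI)
    show "q n \<in> borel_measurable lborel" for n
      unfolding q_def using fint shift(1)
      by (intro borel_measurable_integrable Bochner_Integration.integrable_diff integrable_scaleR_right)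
    show "integrable lborel (\<lambda>x. indicator K' x *\<^sub>R B)"
      using K' by (intro borel_integrable_compact) auto
    have "norm (q n x) \<le> indicator K' x *\<^sub>R B" for n x
    proof (cases "x \<in> K'")
      case True
      have "norm (q n x) = inverse (t n) * norm (f (x + t n *\<^sub>R b) - f x)"
        using t(1)[of n] by (simp add: q_def)
      also have "\<dots> \<le> inverse (t n) * (t n * B)"
        using quot[OF t(1)[of n], of x] t(1)[of n] by (intro mult_left_mono) auto
      also have "\<dots> = B" using t(1)[of n] by (simp add: field_simps)
      finally show ?thesis using True by simp
    qed (simp add: q0)
    then show "AE x in lborel. norm (q n x) \<le> indicator K' x *\<^sub>R B" for n
      by simp
    have "(\<lambda>n. q n x) \<longlonglongrightarrow> f' x b" for x
    proof -
      have "((\<lambda>s. f (x + s *\<^sub>R b)) has_derivative (\<lambda>r. f' (x + 0 *\<^sub>R b) (r *\<^sub>R b))) (at 0)"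
        by (rule has_derivative_compose[OF _ der]) (auto intro!: derivative_eq_intros)
      then have "((\<lambda>s. f (x + s *\<^sub>R b)) has_vector_derivative f' x b) (at 0)"
        by (simp add: linear_scale[OF has_derivative_linear[OF der]] has_vector_derivative_def)
      then have "(\<lambda>s. norm (f (x + s *\<^sub>R b) - f x - s *\<^sub>R f' x b) / norm s) \<midarrow>0\<rightarrow> 0"
        by (simp add: has_vector_derivative_def has_derivative_at)
      moreover have "filterlim t (at 0) sequentially"
        using t(3) less_imp_neq[OF t(1)] by (simp add: filterlim_at)
      ultimately have "(\<lambda>n. norm (f (x + t n *\<^sub>R b) - f x - t n *\<^sub>R f' x b) / norm (t n)) \<longlonglongrightarrow> 0"
        by (rule filterlim_compose)
      moreover have "norm (f (x + t n *\<^sub>R b) - f x - t n *\<^sub>R f' x b) / norm (t n) = norm (q n x - f' x b)" for n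
      proof -
        have "q n x - f' x b = inverse (t n) *\<^sub>R (f (x + t n *\<^sub>R b) - f x - t n *\<^sub>R f' x b)"
          using t(1)[of n] by (simp add: q_def scaleR_diff_right)
        then show ?thesis by (simp add: divide_inverse)
      qed
      ultimately have "(\<lambda>n. norm (q n x - f' x b)) \<longlonglongrightarrow> 0" by (simp only:)
      then show ?thesis by (simp add: tendsto_norm_zero_iff LIM_zero_iff)
    qed
    then show "AE x in lborel. (\<lambda>n. q n x) \<longlonglongrightarrow> f' x b" by simp
  qed
  moreover have "(\<integral>x. q n x \<partial>lborel) = 0" for n
    unfolding q_def using fint shift by simp
  ultimately show ?thesis
    using LIMSEQ_unique[OF _ tendsto_const] by simp
qed

text \<open>Integration by parts: the product of \<open>h\<close> with a test function, extended by zero, is continuously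
  differentiable with compact support, so its partial derivatives integrate to zero.\<close>

lemma C1_has_weak_differential:
  fixes h :: "'a::euclidean_space \<Rightarrow> 'b::euclidean_space"
  assumes "open U"
    and der: "\<And>x. x \<in> U \<Longrightarrow> (h has_derivative D x) (at x)"
    and cont: "\<And>b. b \<in> Basis \<Longrightarrow> continuous_on U (\<lambda>x. D x b)"
  shows "has_weak_differential h D U"
  unfolding has_weak_differential_def
proof (intro conjI ballI allI impI)
  have conth: "continuous_on U h"
    using der has_derivative_continuous by (blast intro: continuous_at_imp_continuous_on)
  then show "locally_integrable U h" by (rule continuous_imp_locally_integrable)
  show "linear (D x)" if "x \<in> U" for x
    using der[OF that] by (rule has_derivative_linear)
  fix b :: 'a assume b: "b \<in> Basis"
  show lD: "locally_integrable U (\<lambda>x. D x b)"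
    using cont[OF b] by (rule continuous_imp_locally_integrable)
  fix \<phi> assume \<phi>: "test_function U \<phi>"
  obtain K where K: "compact K" "K \<subseteq> U" "\<And>x. x \<notin> K \<Longrightarrow> \<phi> x = 0"
    using test_function_support[OF \<phi>] by blast
  have cK: "closed K" using K(1) by (rule compact_imp_closed)
  let ?\<phi>' = "\<lambda>x. frechet_derivative \<phi> (at x)"
  note \<phi>' = test_function_has_derivative[OF \<phi>]
  have \<phi>'0: "?\<phi>' x = (\<lambda>v. 0)" if "x \<notin> K" for x
    by (rule derivative_eq_0_off_closed_support[OF \<phi>'(1) cK that K(3)])
  define f where "f x = (if x \<in> U then \<phi> x *\<^sub>R h x else 0)" for x
  define f' where "f' x v = (if x \<in> U then \<phi> x *\<^sub>R D x v + ?\<phi>' x v *\<^sub>R h x else 0)" for x v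
  have f0: "f x = 0" "f' x v = 0" if "x \<notin> K" for x v
    using that K(3) \<phi>'0 by (auto simp: f_def f'_def)
  have derf: "(f has_derivative f' x) (at x)" for x
  proof (cases "x \<in> U")
    case True
    have "((\<lambda>x. \<phi> x *\<^sub>R h x) has_derivative f' x) (at x)"
      using True unfolding f'_def by (auto intro!: derivative_eq_intros der \<phi>'(1))
    then show ?thesis
      by (rule has_derivative_transform_within_open[OF _ \<open>open U\<close> True]) (simp add: f_def)
  next
    case False
    then have "x \<notin> K" using K(2) by blast
    have "((\<lambda>x. 0) has_derivative f' x) (at x)"
    proof -
      have "f' x = (\<lambda>v. 0)" using f0(2)[OF \<open>x \<notin> K\<close>] by blast
      then show ?thesis by simp
    qed
    from has_derivative_transform_within_open[OF this, of "- K" f] show ?thesis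
      using \<open>x \<notin> K\<close> cK f0 by auto
  qed
  have contU: "continuous_on U (\<lambda>x. \<phi> x *\<^sub>R D x b)" "continuous_on U (\<lambda>x. ?\<phi>' x b *\<^sub>R h x)"
    by (intro continuous_intros test_function_continuous[OF \<phi>] cont b conth \<phi>'(2))+
  have "continuous_on (U \<union> - K) (\<lambda>x. f' x b)"
  proof (rule continuous_on_open_Un)
    have "continuous_on U (\<lambda>x. \<phi> x *\<^sub>R D x b + ?\<phi>' x b *\<^sub>R h x)"
      by (rule continuous_on_add[OF contU])
    then show "continuous_on U (\<lambda>x. f' x b)"
      by (rule continuous_on_eq) (simp add: f'_def)
    have "continuous_on (- K) (\<lambda>x. 0 :: 'b)" by simp
    then show "continuous_on (- K) (\<lambda>x. f' x b)"
      by (rule continuous_on_eq) (simp add: f0)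
  qed (use \<open>open U\<close> cK in auto)
  moreover have "U \<union> - K = UNIV" using K(2) by blast
  ultimately have contf': "continuous_on UNIV (\<lambda>x. f' x b)" by simp
  have zero: "(\<integral>x. f' x b \<partial>lborel) = 0"
    by (rule integral_directional_derivative_eq_0[OF derf contf' K(1) f0(1)])
  have int: "integrable lborel (\<lambda>x. indicator U x *\<^sub>R \<phi> x *\<^sub>R D x b)"
    "integrable lborel (\<lambda>x. indicator U x *\<^sub>R ?\<phi>' x b *\<^sub>R h x)"
  proof -
    have "continuous_on K (\<lambda>x. indicator U x *\<^sub>R \<phi> x *\<^sub>R D x b)"
      by (rule continuous_on_eq[OF continuous_on_subset[OF contU(1) K(2)]]) (use K(2) in auto)
    then show "integrable lborel (\<lambda>x. indicator U x *\<^sub>R \<phi> x *\<^sub>R D x b)"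
      by (rule compact_support_integrable[OF _ K(1)]) (simp add: K(3))
    have "continuous_on K (\<lambda>x. indicator U x *\<^sub>R ?\<phi>' x b *\<^sub>R h x)"
      by (rule continuous_on_eq[OF continuous_on_subset[OF contU(2) K(2)]]) (use K(2) in auto)
    then show "integrable lborel (\<lambda>x. indicator U x *\<^sub>R ?\<phi>' x b *\<^sub>R h x)"
      by (rule compact_support_integrable[OF _ K(1)]) (simp add: \<phi>'0)
  qed
  have "(\<integral>x. indicator U x *\<^sub>R \<phi> x *\<^sub>R D x b \<partial>lborel) + (\<integral>x. indicator U x *\<^sub>R ?\<phi>' x b *\<^sub>R h x \<partial>lborel) =
      (\<integral>x. indicator U x *\<^sub>R \<phi> x *\<^sub>R D x b + indicator U x *\<^sub>R ?\<phi>' x b *\<^sub>R h x \<partial>lborel)"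
    using int by simp
  also have "\<dots> = (\<integral>x. f' x b \<partial>lborel)"
    by (intro Bochner_Integration.integral_cong) (auto simp: f'_def)
  finally have "(\<integral>x. indicator U x *\<^sub>R ?\<phi>' x b *\<^sub>R h x \<partial>lborel) = - (\<integral>x. indicator U x *\<^sub>R \<phi> x *\<^sub>R D x b \<partial>lborel)"
    using zero by (simp add: eq_neg_iff_add_eq_0 add.commute)
  then show "(LINT x:U|lebesgue. ?\<phi>' x b *\<^sub>R h x) = - (LINT x:U|lebesgue. \<phi> x *\<^sub>R D x b)"
    using int unfolding set_lebesgue_integral_def
    by (simp add: integral_completion borel_measurable_integrable)
qed

section \<open>Polar coordinates\<close>

(* the infix dollar sign shall only denote vector components *)
no_notation fps_nth (infixl \<open>$\<close> 75)

abbreviation \<A> :: "complex set" where "\<A> \<equiv> annulus 0 1"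

lemma emeasure_lborel_box_real2:
  fixes l u :: "real^2"
  assumes "l $ 1 \<le> u $ 1" "l $ 2 \<le> u $ 2"
  shows "emeasure lborel (box l u) = ennreal ((u $ 1 - l $ 1) * (u $ 2 - l $ 2))"
proof -
  have B: "(Basis :: (real^2) set) = {axis 1 1, axis 2 1}"
    by (auto simp: Basis_vec_def UNIV_2)
  have ne: "axis 1 1 \<noteq> (axis 2 1 :: real^2)"
    by (simp add: axis_eq_axis)
  have "emeasure lborel (box l u) = (\<Prod>b\<in>Basis. (u - l) \<bullet> b)"
    by (rule emeasure_lborel_box) (use assms in \<open>auto simp: B inner_axis\<close>)
  then show ?thesis using ne by (simp add: B inner_axis)
qed

lemma lborel_real2_as_product:
  "distr lborel borel (\<lambda>v::real^2. (v $ 1, v $ 2)) = lborel"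
proof (rule lborel_eqI[symmetric])
  fix l u :: "real \<times> real"
  assume lu: "\<And>b. b \<in> Basis \<Longrightarrow> l \<bullet> b \<le> u \<bullet> b"
  then have le: "fst l \<le> fst u" "snd l \<le> snd u"
    by (force simp: Basis_prod_def inner_prod_def)+
  have [measurable]: "(\<lambda>v::real^2. (v $ 1, v $ 2)) \<in> borel_measurable borel"
    by (intro borel_measurable_continuous_onI continuous_intros)
  let ?l = "\<chi> i. if i = 1 then fst l else snd l" and ?u = "\<chi> i. if i = 1 then fst u else snd u"
  have "(\<lambda>v::real^2. (v $ 1, v $ 2)) -` box l u = box ?l ?u"
  proof -
    have "box l u = {fst l<..<fst u} \<times> {snd l<..<snd u}"
      by (cases l; cases u) (auto simp: box_def Basis_prod_def)
    then show ?thesis by (auto simp: mem_box_cart forall_2)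
  qed
  then show "emeasure (distr lborel borel (\<lambda>v::real^2. (v $ 1, v $ 2))) (box l u) = (\<Prod>b\<in>Basis. (u - l) \<bullet> b)"
    using le by (simp add: emeasure_distr emeasure_lborel_box_real2 Basis_prod_def inner_prod_def prod.insert)
qed simp

lemma lborel_real2_as_complex:
  "distr lborel borel (\<lambda>v::real^2. Complex (v $ 1) (v $ 2)) = lborel"
proof (rule lborel_eqI[symmetric])
  fix l u :: complex
  assume lu: "\<And>b. b \<in> Basis \<Longrightarrow> l \<bullet> b \<le> u \<bullet> b"
  then have le: "Re l \<le> Re u" "Im l \<le> Im u"
    by (force simp: Basis_complex_def)+
  have [measurable]: "(\<lambda>v::real^2. Complex (v $ 1) (v $ 2)) \<in> borel_measurable borel"
    by (intro borel_measurable_continuous_onI continuous_intros)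
  let ?l = "\<chi> i. if i = 1 then Re l else Im l" and ?u = "\<chi> i. if i = 1 then Re u else Im u"
  have "(\<lambda>v::real^2. Complex (v $ 1) (v $ 2)) -` box l u = box ?l ?u"
    by (auto simp: in_box_complex_iff mem_box_cart forall_2)
  then show "emeasure (distr lborel borel (\<lambda>v::real^2. Complex (v $ 1) (v $ 2))) (box l u) = (\<Prod>b\<in>Basis. (u - l) \<bullet> b)"
    using le by (simp add: emeasure_distr emeasure_lborel_box_real2 Basis_complex_def)
qed simp

text \<open>The polar coordinate map is studied on \<^typ>\<open>real^2\<close>, where its Jacobian is a determinant; the two
  measure isomorphisms above carry the result to \<^typ>\<open>complex\<close> and to iterated integrals.\<close>

definition polar2 :: "real^2 \<Rightarrow> real^2" where
  "polar2 v = (v $ 1 * cos (v $ 2)) *\<^sub>R axis 1 1 + (v $ 1 * sin (v $ 2)) *\<^sub>R axis 2 1"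

definition polar_strip :: "(real^2) set" where
  "polar_strip = {v. 0 < v $ 1 \<and> v $ 1 < 1 \<and> - pi < v $ 2 \<and> v $ 2 < pi}"

lemma polar2_components: "polar2 v $ 1 = v $ 1 * cos (v $ 2)" "polar2 v $ 2 = v $ 1 * sin (v $ 2)"
  by (simp_all add: polar2_def axis_def)

lemma Complex_polar2: "Complex (polar2 v $ 1) (polar2 v $ 2) = of_real (v $ 1) * cis (v $ 2)"
  by (simp add: polar2_components complex_eq_iff)

lemma polar2_has_derivative:
  obtains D where "(polar2 has_derivative D) (at v within S)" "det (matrix D) = v $ 1"
proof
  let ?D = "\<lambda>w. (w $ 1 * cos (v $ 2) - v $ 1 * sin (v $ 2) * w $ 2) *\<^sub>R axis 1 1 +
    (w $ 1 * sin (v $ 2) + v $ 1 * cos (v $ 2) * w $ 2) *\<^sub>R axis 2 1 :: real^2"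
  have nth: "((\<lambda>v::real^2. v $ i) has_derivative (\<lambda>w. w $ i)) (at v within S)" for i
    by (rule bounded_linear_imp_has_derivative[OF bounded_linear_vec_nth])
  show "(polar2 has_derivative ?D) (at v within S)"
    unfolding polar2_def
    by (auto intro!: derivative_eq_intros nth simp: algebra_simps)
  have "v $ 1 * (cos (v $ 2) * cos (v $ 2)) + v $ 1 * (sin (v $ 2) * sin (v $ 2)) = v $ 1"
    by (metis distrib_left mult.right_neutral power2_eq_square sin_cos_squared_add2)
  then show "det (matrix ?D) = v $ 1"
    by (simp add: det_2 matrix_def axis_def algebra_simps)
qed

lemma open_polar_strip: "open polar_strip"
  unfolding polar_strip_def by (intro open_Collect_conj open_Collect_less continuous_intros)

lemma bounded_polar_strip: "bounded polar_strip"
proof (rule bounded_subset[OF bounded_cbox])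
  show "polar_strip \<subseteq> cbox (\<chi> i. if i = 1 then 0 else - pi) (\<chi> i. if i = 1 then 1 else pi)"
    by (auto simp: polar_strip_def mem_box_cart forall_2)
qed

lemma continuous_on_polar2: "continuous_on S polar2"
  unfolding polar2_def by (intro continuous_intros)

lemma inj_on_polar2: "inj_on polar2 polar_strip"
proof (rule inj_onI)
  fix v w assume v: "v \<in> polar_strip" and w: "w \<in> polar_strip" and eq: "polar2 v = polar2 w"
  then have eq: "of_real (v $ 1) * cis (v $ 2) = complex_of_real (w $ 1) * cis (w $ 2)"
    using Complex_polar2 by metis
  have "norm (of_real (v $ 1) * cis (v $ 2)) = norm (complex_of_real (w $ 1) * cis (w $ 2))"
    using eq by simp
  then have 1: "v $ 1 = w $ 1" using v w by (simp add: norm_mult polar_strip_def)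
  have "Arg (of_real (v $ 1) * cis (v $ 2)) = v $ 2" if "v \<in> polar_strip" for v
    using that by (intro Arg_unique[of "v $ 1"]) (auto simp: polar_strip_def cis_conv_exp)
  then have "v $ 2 = w $ 2" using v w eq by metis
  with 1 show "v = w" by (simp add: vec_eq_iff forall_2)
qed

lemma open_polar2_image: "open (polar2 ` polar_strip)"
  by (rule invariance_of_domain[OF continuous_on_polar2 open_polar_strip inj_on_polar2])

lemma polar2_image:
  "w \<in> polar2 ` polar_strip \<Longrightarrow> Complex (w $ 1) (w $ 2) \<in> \<A>"
  "Complex (w $ 1) (w $ 2) \<in> \<A> \<Longrightarrow> w $ 2 \<noteq> 0 \<Longrightarrow> w \<in> polar2 ` polar_strip"
proof -
  show "Complex (w $ 1) (w $ 2) \<in> \<A>" if "w \<in> polar2 ` polar_strip"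
    using that by (auto simp: Complex_polar2 annulus_def polar_strip_def norm_mult)
  assume w: "Complex (w $ 1) (w $ 2) \<in> \<A>" "w $ 2 \<noteq> 0"
  let ?z = "Complex (w $ 1) (w $ 2)"
  let ?v = "\<chi> i. if i = 1 then norm ?z else Arg ?z"
  have nz: "?z \<noteq> 0" using w(2) by (auto simp: complex_eq_iff)
  have "?z = of_real (norm ?z) * cis (Arg ?z)"
    using Arg_eq[OF nz] by (simp add: cis_conv_exp)
  then have "Complex (polar2 ?v $ 1) (polar2 ?v $ 2) = ?z"
    unfolding Complex_polar2 by simp
  then have v: "polar2 ?v = w" by (simp add: vec_eq_iff forall_2)
  have "Arg ?z \<noteq> pi" using w(2) by (simp add: Arg_eq_pi)
  then have "?v \<in> polar_strip"
    using w(1) Arg_bounded[of ?z] by (auto simp: polar_strip_def annulus_def less_le)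
  then show "w \<in> polar2 ` polar_strip" by (rule imageI[of ?v polar_strip polar2, unfolded v])
qed

text \<open>Change of variables for the measure of an image, with Jacobian determinant equal to the radius.\<close>

lemma emeasure_polar2_image:
  assumes W: "W \<in> sets borel" "W \<subseteq> polar_strip"
  shows "polar2 ` W \<in> sets lebesgue"
    and "emeasure lebesgue (polar2 ` W) = (\<integral>\<^sup>+v. ennreal (v $ 1) * indicator W v \<partial>lborel)"
proof -
  have "\<exists>D. \<forall>v. (polar2 has_derivative D v) (at v within W) \<and> det (matrix (D v)) = v $ 1"
    using polar2_has_derivative[of _ W] by (intro choice allI) blast
  then obtain D where D: "\<And>v. (polar2 has_derivative D v) (at v within W)" "\<And>v. det (matrix (D v)) = v $ 1"
    by blast
  have inj: "inj_on polar2 W" using inj_on_polar2 W(2) by (rule inj_on_subset)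
  have "set_integrable lborel W (\<lambda>v. v $ 1)"
    unfolding set_integrable_def
  proof (rule Bochner_Integration.integrable_bound)
    show "integrable lborel (indicat_real W)"
      using W emeasure_bounded_finite[OF bounded_subset[OF bounded_polar_strip W(2)]]
      by (intro integrable_real_indicator) auto
    show "(\<lambda>v. indicat_real W v *\<^sub>R v $ 1) \<in> borel_measurable lborel"
      using W(1) by (auto intro!: borel_measurable_continuous_onI continuous_intros)
    show "AE v in lborel. norm (indicat_real W v *\<^sub>R v $ 1) \<le> norm (indicat_real W v)"
    proof (rule AE_I2)
      fix v
      show "norm (indicat_real W v *\<^sub>R v $ 1) \<le> norm (indicat_real W v)"
        using W(2) by (cases "v \<in> W") (auto simp: polar_strip_def)
    qed
  qed
  then have "(\<lambda>v. v $ 1) integrable_on W"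
    using set_borel_integral_eq_integral(1) by blast
  then have int: "((\<lambda>v. v $ 1) has_integral integral W (\<lambda>v. v $ 1)) W" by (rule integrable_integral)
  have "((\<lambda>v. \<bar>det (matrix (D v))\<bar>) has_integral integral W (\<lambda>v. v $ 1)) W"
    by (rule has_integral_eq[OF _ int]) (use W(2) in \<open>auto simp: D(2) polar_strip_def\<close>)
  then have *: "polar2 ` W \<in> lmeasurable" "measure lebesgue (polar2 ` W) = integral W (\<lambda>v. v $ 1)"
    using has_measure_differentiable_image[of W polar2 D "integral W (\<lambda>v. v $ 1)"] W(1) D(1) inj by auto
  show "polar2 ` W \<in> sets lebesgue" using *(1) by blast
  have "emeasure lebesgue (polar2 ` W) = ennreal (integral W (\<lambda>v. v $ 1))"
    using * by (metis emeasure_eq_measure2)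
  also have "\<dots> = (\<integral>\<^sup>+v. ennreal (v $ 1) * indicator W v \<partial>lborel)"
    by (rule nn_integral_has_integral_lebesgue'[OF _ int, symmetric])
      (use W(2) in \<open>auto simp: polar_strip_def\<close>)
  finally show "emeasure lebesgue (polar2 ` W) = (\<integral>\<^sup>+v. ennreal (v $ 1) * indicator W v \<partial>lborel)" .
qed

lemma density_polar2_image:
  "density lborel (indicator (polar2 ` polar_strip)) =
    distr (density lborel (\<lambda>v. ennreal (v $ 1) * indicator polar_strip v)) borel polar2"
proof (rule measure_eqI)
  let ?M = "density lborel (indicator (polar2 ` polar_strip))"
  let ?N = "distr (density lborel (\<lambda>v. ennreal (v $ 1) * indicator polar_strip v)) borel polar2"
  have [measurable]: "polar2 \<in> borel_measurable borel"
    by (rule borel_measurable_continuous_onI[OF continuous_on_polar2])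
  have [measurable]: "(\<lambda>v::real^2. v $ 1) \<in> borel_measurable borel"
    by (intro borel_measurable_continuous_onI continuous_intros)
  have [measurable]: "polar_strip \<in> sets borel" "polar2 ` polar_strip \<in> sets borel"
    using open_polar_strip open_polar2_image by auto
  fix A assume "A \<in> sets ?M"
  then have A[measurable]: "A \<in> sets borel" by simp
  define W where "W = polar2 -` A \<inter> polar_strip"
  have W[measurable]: "W \<in> sets borel" unfolding W_def using measurable_sets[of polar2 borel borel A] by auto
  have img: "polar2 ` W = polar2 ` polar_strip \<inter> A" by (auto simp: W_def)
  have "emeasure ?M A = emeasure lborel (polar2 ` W)"
    by (simp add: emeasure_density img indicator_inter_arith[symmetric])
  also have "\<dots> = (\<integral>\<^sup>+v. ennreal (v $ 1) * indicator W v \<partial>lborel)"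
    using emeasure_polar2_image(2)[of W] img by (simp add: W_def)
  also have "\<dots> = emeasure ?N A"
  proof -
    have [measurable]: "polar2 -` A \<in> sets borel" using measurable_sets[of polar2 borel borel A] by simp
    show ?thesis
      by (simp add: emeasure_distr emeasure_density W_def)
        (intro nn_integral_cong, auto simp: indicator_def)
  qed
  finally show "emeasure ?M A =
    emeasure ?N A" .
qed simp

text \<open>The polar strip parametrises the punctured disk up to the slit on the real axis, a null set.\<close>

lemma nn_integral_polar_coordinates:
  fixes F :: "complex \<Rightarrow> ennreal"
  assumes F[measurable]: "F \<in> borel_measurable borel"
  shows "(\<integral>\<^sup>+z\<in>\<A>. F z \<partial>lborel) =
    (\<integral>\<^sup>+\<theta>. (\<integral>\<^sup>+t. F (of_real t * cis \<theta>) * ennreal t * indicator {0<..<1} t \<partial>lborel) * indicator {-pi<..<pi} \<theta> \<partial>lborel)" (is "_ = ?rhs")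
proof -
  let ?c = "\<lambda>w::real^2. Complex (w $ 1) (w $ 2)"
  have [measurable]: "polar2 \<in> borel_measurable borel"
    by (rule borel_measurable_continuous_onI[OF continuous_on_polar2])
  have [measurable]: "?c \<in> borel_measurable borel" "(\<lambda>v::real^2. v $ 1) \<in> borel_measurable borel"
     "(\<lambda>v::real^2. (v $ 1, v $ 2)) \<in> borel_measurable borel"
    by (intro borel_measurable_continuous_onI continuous_intros)+
  have [measurable]: "polar_strip \<in> sets borel" "polar2 ` polar_strip \<in> sets borel"
    using open_polar_strip open_polar2_image by auto
  have "open \<A>" unfolding annulus_def by (intro open_Collect_conj open_Collect_less continuous_intros)
  then have [measurable]: "\<A> \<in> sets borel" by simp
  have cis[measurable]: "(\<lambda>p::real\<times>real. of_real (fst p) * cis (snd p)) \<in> borel_measurable borel"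
    by (intro borel_measurable_continuous_onI continuous_intros)
  have "{w::real^2. w $ 2 = 0} \<in> null_sets lborel"
  proof -
    have "negligible {w::real^2. axis 2 1 \<bullet> w = 0}"
      by (rule negligible_hyperplane) (simp add: axis_eq_0_iff)
    moreover have "{w::real^2. axis 2 1 \<bullet> w = 0} = {w. w $ 2 = 0}" by (simp add: inner_axis')
    moreover have "closed {w::real^2. w $ 2 = 0}" by (intro closed_Collect_eq continuous_intros)
    ultimately show ?thesis by (simp add: negligible_iff_null_sets null_sets_def)
  qed
  then have AE: "AE w::real^2 in lborel. w $ 2 \<noteq> 0" by (auto dest: AE_not_in)
  let ?G = "\<lambda>p::real\<times>real. F (of_real (fst p) * cis (snd p)) * ennreal (fst p) * indicator ({0<..<1} \<times> {-pi<..<pi}) p"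
  have [measurable]: "(fst :: real \<times> real \<Rightarrow> real) \<in> borel_measurable borel"
    by (intro borel_measurable_continuous_onI continuous_intros)
  have [measurable]: "{0<..<1::real} \<times> {-pi<..<pi} \<in> sets borel"
    by (intro borel_open open_Times) auto
  have [measurable]: "?G \<in> borel_measurable borel"
    using measurable_compose[OF cis F] by measurable
  have "(\<integral>\<^sup>+z\<in>\<A>. F z \<partial>lborel) = (\<integral>\<^sup>+w. F (?c w) * indicator \<A> (?c w) \<partial>lborel)"
    by (subst lborel_real2_as_complex[symmetric], subst nn_integral_distr) auto
  also have "\<dots> = (\<integral>\<^sup>+w. indicator (polar2 ` polar_strip) w * F (?c w) \<partial>lborel)"
  proof (rule nn_integral_cong_AE)
    show "AE w in lborel. F (?c w) * indicator \<A> (?c w) = indicator (polar2 ` polar_strip) w * F (?c w)"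
      using AE
    proof eventually_elim
      case (elim w)
      then show ?case using polar2_image[of w] by (cases "w \<in> polar2 ` polar_strip"; cases "?c w \<in> \<A>"; auto)
    qed
  qed
  also have "\<dots> = (\<integral>\<^sup>+w. F (?c w) \<partial>density lborel (indicator (polar2 ` polar_strip)))"
    by (subst nn_integral_density) auto
  also have "\<dots> = (\<integral>\<^sup>+v. ennreal (v $ 1) * indicator polar_strip v * F (?c (polar2 v)) \<partial>lborel)"
    unfolding density_polar2_image by (subst nn_integral_distr) (auto simp: nn_integral_density)
  also have "\<dots> = (\<integral>\<^sup>+v. ?G (v $ 1, v $ 2) \<partial>(lborel :: (real^2) measure))"
    unfolding Complex_polar2
    by (intro nn_integral_cong) (auto simp: polar_strip_def indicator_def mult.commute)
  also have "\<dots> = (\<integral>\<^sup>+p. ?G p \<partial>lborel)"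
    by (subst lborel_real2_as_product[symmetric], subst nn_integral_distr) auto
  also have "\<dots> = (\<integral>\<^sup>+p. ?G p \<partial>(lborel \<Otimes>\<^sub>M lborel))"
    by (simp add: lborel_prod)
  also have "\<dots> = (\<integral>\<^sup>+\<theta>. \<integral>\<^sup>+t. ?G (t, \<theta>) \<partial>lborel \<partial>lborel)"
    by (subst lborel_pair.nn_integral_snd[symmetric]) (simp_all add: lborel_prod)
  also have "\<dots> = ?rhs"
  proof (rule nn_integral_cong)
    fix \<theta> :: real
    show "(\<integral>\<^sup>+t. ?G (t, \<theta>) \<partial>lborel) = (\<integral>\<^sup>+t. F (of_real t * cis \<theta>) * ennreal t * indicator {0<..<1} t \<partial>lborel) * indicator {-pi<..<pi} \<theta>"
      by (cases "\<theta> \<in> {-pi<..<pi}") (simp_all add: indicator_times)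
  qed
  finally show ?thesis .
qed

section \<open>The lower bound for radial maps\<close>

lemma open_annulus: "open (annulus r R)"
  unfolding annulus_def by (intro open_Collect_conj open_Collect_less continuous_intros)

lemma emeasure_disc: "r \<ge> 0 \<Longrightarrow> emeasure lborel (cball (0::complex) r) = ennreal (pi * r\<^sup>2)"
  by (simp add: emeasure_cball DIM_complex unit_ball_vol_2)

lemma emeasure_annulus:
  assumes "0 \<le> r" "r \<le> R"
  shows "emeasure lborel {x::complex. r < norm x \<and> norm x \<le> R} = ennreal (pi * (R\<^sup>2 - r\<^sup>2))"
proof -
  have "{x::complex. r < norm x \<and> norm x \<le> R} = cball 0 R - cball 0 r"
    by auto
  moreover have "emeasure lborel (cball (0::complex) R - cball 0 r) = emeasure lborel (cball (0::complex) R) - emeasure lborel (cball (0::complex) r)"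
    using assms emeasure_bounded_finite[OF bounded_cball, of "0::complex" r]
    by (intro emeasure_Diff) auto
  ultimately show ?thesis
    using assms by (simp add: emeasure_disc ennreal_minus right_diff_distrib)
qed

lemma emeasure_punctured_disc: "emeasure lborel \<A> = ennreal pi"
proof -
  have "emeasure lborel \<A> = emeasure lborel {x::complex. 0 < norm x \<and> norm x \<le> 1}"
  proof (rule emeasure_eq_AE)
    have "AE x::complex in lborel. x \<notin> sphere 0 1"
      using negligible_sphere[of "0::complex" 1]
      by (intro AE_not_in) (auto simp: negligible_iff_null_sets null_sets_def)
    then show "AE x in lborel. x \<in> \<A> \<longleftrightarrow> x \<in> {x. 0 < norm x \<and> norm x \<le> 1}"
      by eventually_elim (auto simp: annulus_def less_le)
    show "\<A> \<in> sets lborel" using open_annulus[of 0 1] by simp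
    have "{x::complex. 0 < norm x \<and> norm x \<le> 1} = cball 0 1 - {0}" by auto
    then show "{x::complex. 0 < norm x \<and> norm x \<le> 1} \<in> sets lborel" by simp
  qed
  then show ?thesis using emeasure_annulus[of 0 1] by simp
qed

text \<open>A radial test function equal to \<open>1\<close> unless \<open>|x|\<^sup>2 < 2/n\<close> or \<open>1 - |x|\<^sup>2 < 2/n\<close>. Its gradient
  has size \<open>O(n)\<close> but lives on two rings of area \<open>O(1/n)\<close>, so that its integral stays bounded.\<close>

definition cutoff :: "nat \<Rightarrow> complex \<Rightarrow> real" where
  "cutoff n x = smooth_step (n * (x \<bullet> x) - 1) * smooth_step (n * (1 - x \<bullet> x) - 1)"

lemma smooth_self_inner: "smooth (\<lambda>x::complex. x \<bullet> x)"
proof -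
  have "smooth (\<lambda>x::complex. (x \<bullet> 1) * (x \<bullet> 1) + (x \<bullet> \<i>) * (x \<bullet> \<i>))"
    by (intro smooth.intros)
  then show ?thesis by (simp add: inner_complex_def)
qed

lemma smooth_cutoff: "smooth (cutoff n)"
  unfolding cutoff_def by (intro smooth.intros smooth_smooth_step smooth_diff smooth_self_inner)

lemma cutoff_bounds: "0 \<le> cutoff n x" "cutoff n x \<le> 1"
  unfolding cutoff_def using smooth_step_bounds by (auto intro!: mult_le_one)

lemma test_function_cutoff:
  assumes "n > 0" shows "test_function \<A> (cutoff n)"
proof (rule smooth_imp_test_function)
  let ?K = "{x::complex. 1 / n \<le> x \<bullet> x \<and> x \<bullet> x \<le> 1 - 1 / n}"
  show "smooth (cutoff n)" by (rule smooth_cutoff)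
  have sub: "?K \<subseteq> \<A>"
  proof
    fix x assume "x \<in> ?K"
    moreover have "1 / real n > 0" using assms by simp
    ultimately have "0 < x \<bullet> x" "x \<bullet> x < 1"
      unfolding mem_Collect_eq by (linarith, linarith)
    then show "x \<in> \<A>"
      by (simp add: annulus_def norm_eq_sqrt_inner)
  qed
  have "bounded ?K"
    by (rule bounded_subset[OF _ sub]) (auto simp: annulus_def bounded_iff intro!: exI[of _ 1])
  moreover have "closed ?K"
    by (intro closed_Collect_conj closed_Collect_le continuous_intros)
  ultimately show "compact ?K" by (simp add: compact_eq_bounded_closed)
  show "?K \<subseteq> \<A>" by (rule sub)
  fix x assume "cutoff n x \<noteq> 0"
  then have "\<not> n * (x \<bullet> x) - 1 \<le> 0" "\<not> n * (1 - x \<bullet> x) - 1 \<le> 0"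
    unfolding cutoff_def using smooth_step_eq_0 by (metis mult_eq_0_iff)+
  then show "x \<in> ?K" using assms by (simp add: field_simps)
qed

lemma cutoff_tendsto_1:
  assumes "x \<in> \<A>" shows "(\<lambda>n. cutoff n x) \<longlonglongrightarrow> 1"
proof -
  have x: "x \<bullet> x > 0" "1 - x \<bullet> x > 0"
    using assms by (auto simp: annulus_def power2_norm_eq_inner[symmetric] abs_square_less_1)
  have lim: "\<forall>\<^sub>F n in sequentially. smooth_step (real n * t - 1) = 1" if "t > 0" for t
  proof -
    have "\<forall>\<^sub>F n in sequentially. real n \<ge> 2 / t"
      using filterlim_real_sequentially by (auto simp: filterlim_at_top)
    then show ?thesis
      by eventually_elim (use that in \<open>auto intro!: smooth_step_eq_1 simp: field_simps\<close>)
  qed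
  have "\<forall>\<^sub>F n in sequentially. cutoff n x = 1"
    using lim[OF x(1)] lim[OF x(2)] by eventually_elim (simp add: cutoff_def)
  then show ?thesis by (rule tendsto_eventually)
qed

definition cutoff_shell :: "nat \<Rightarrow> complex set" where
  "cutoff_shell n = {x. 1 / n \<le> x \<bullet> x \<and> x \<bullet> x \<le> 2 / n \<or> 1 - 2 / n \<le> x \<bullet> x \<and> x \<bullet> x \<le> 1 - 1 / n}"

text \<open>The gradient of a radial function is a multiple of \<open>x\<close>; the factor is bounded by \<open>n\<close> times a constant
  and vanishes where both smooth steps are constant.\<close>

lemma cutoff_gradient:
  obtains G :: "nat \<Rightarrow> complex \<Rightarrow> real" and M :: real where "M > 0"
    "\<And>n x v. frechet_derivative (cutoff n) (at x) v = G n x * (x \<bullet> v)"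
    "\<And>n x. n \<ge> 2 \<Longrightarrow> \<bar>G n x\<bar> \<le> n * M * indicator (cutoff_shell n) x"
proof -
  obtain s' M where s': "\<And>t. (smooth_step has_real_derivative s' t) (at t)" "\<And>t. \<bar>s' t\<bar> \<le> M"
    "\<And>t. t \<notin> {0..1} \<Longrightarrow> s' t = 0"
    using smooth_step_derivative_bounded by blast
  have M: "M \<ge> 0" using s'(2)[of 0] by simp
  define a b where "a n x = s' (n * (x \<bullet> x) - 1)" and "b n x = s' (n * (1 - x \<bullet> x) - 1)"
    for n :: nat and x :: complex
  define A B where "A n x = smooth_step (n * (x \<bullet> x) - 1)" and "B n x = smooth_step (n * (1 - x \<bullet> x) - 1)"
    for n :: nat and x :: complex
  define G where "G n x = 2 * n * (a n x * B n x - A n x * b n x)" for n x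
  have der: "frechet_derivative (cutoff n) (at x) v = G n x * (x \<bullet> v)" for n x v
  proof -
    have inner: "((\<lambda>x::complex. x \<bullet> x) has_derivative (\<lambda>v. 2 * (x \<bullet> v))) (at x)"
      by (auto intro!: derivative_eq_intros simp: inner_commute)
    have "((\<lambda>x. n * (x \<bullet> x) - 1) has_derivative (\<lambda>v. n * (2 * (x \<bullet> v)) - 0)) (at x)"
      by (intro has_derivative_diff has_derivative_mult_right inner has_derivative_const)
    note 1 = has_derivative_compose[OF this s'(1)[unfolded has_field_derivative_def]]
    have "((\<lambda>x. n * (1 - x \<bullet> x) - 1) has_derivative (\<lambda>v. n * (0 - 2 * (x \<bullet> v)) - 0)) (at x)"
      by (intro has_derivative_diff has_derivative_mult_right inner has_derivative_const)
    note 2 = has_derivative_compose[OF this s'(1)[unfolded has_field_derivative_def]]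
    have "(cutoff n has_derivative (\<lambda>v. G n x * (x \<bullet> v))) (at x)"
      unfolding cutoff_def by (rule has_derivative_eq_rhs[OF has_derivative_mult[OF 1 2]])
        (simp add: G_def a_def b_def A_def B_def fun_eq_iff algebra_simps)
    then have "frechet_derivative (cutoff n) (at x) = (\<lambda>v. G n x * (x \<bullet> v))"
      by (rule frechet_derivative_at[symmetric])
    then show ?thesis by simp
  qed
  show ?thesis
  \<comment> \<open>the summand \<open>1\<close> makes the constant positive also if \<open>M = 0\<close>\<close>
  proof (rule that[of "4 * M + 1" G])
    fix n :: nat and x :: complex assume n: "n \<ge> 2"
    show "\<bar>G n x\<bar> \<le> n * (4 * M + 1) * indicator (cutoff_shell n) x"
    proof (cases "x \<in> cutoff_shell n")
      case True
      have "\<bar>a n x * B n x\<bar> \<le> M * 1" "\<bar>A n x * b n x\<bar> \<le> 1 * M"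
        unfolding abs_mult a_def b_def A_def B_def using s'(2) M smooth_step_bounds
        by (intro mult_mono; simp)+
      then have "\<bar>a n x * B n x - A n x * b n x\<bar> \<le> 2 * M" by linarith
      then have "2 * n * \<bar>a n x * B n x - A n x * b n x\<bar> \<le> 2 * n * (2 * M)"
        by (intro mult_left_mono) auto
      then have "\<bar>G n x\<bar> \<le> n * (4 * M)" by (simp add: G_def abs_mult)
      also have "\<dots> \<le> n * (4 * M + 1)" by (intro mult_left_mono) auto
      finally show ?thesis using True by simp
    next
      case False
      then have out: "n * (x \<bullet> x) - 1 \<notin> {0..1}" "n * (1 - x \<bullet> x) - 1 \<notin> {0..1}"
        using n by (auto simp: cutoff_shell_def field_simps)
      have "a n x = 0" "b n x = 0" unfolding a_def b_def using s'(3)[OF out(1)] s'(3)[OF out(2)] .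
      then show ?thesis using False by (simp add: G_def)
    qed
  qed (use M der in auto)
qed

lemma closed_cutoff_shell: "closed (cutoff_shell n)"
  unfolding cutoff_shell_def by (intro closed_Collect_disj closed_Collect_conj closed_Collect_le continuous_intros)

lemma emeasure_cutoff_shell:
  assumes n: "n \<ge> 3"
  shows "emeasure lborel (cutoff_shell n) \<le> ennreal (4 * pi / n)"
proof -
  let ?A = "cball (0::complex) (sqrt (2 / n))"
  \<comment> \<open>the closed outer ring is enlarged to a half-open one, with \<open>3/n\<close> for \<open>2/n\<close>\<close>
  let ?B = "{x::complex. sqrt (1 - 3 / n) < norm x \<and> norm x \<le> sqrt (1 - 1 / n)}"
  have n3: "3 / real n \<le> 1" "2 / real n < 3 / n" "1 / real n \<le> 3 / n" using n by (auto simp: field_simps)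
  have "emeasure lborel (cutoff_shell n) \<le> emeasure lborel (?A \<union> ?B)"
  proof (rule emeasure_mono)
    show "cutoff_shell n \<subseteq> ?A \<union> ?B"
      using n3 by (auto simp: cutoff_shell_def norm_eq_sqrt_inner)
    have "?B = cball 0 (sqrt (1 - 1 / n)) - cball 0 (sqrt (1 - 3 / n))" by auto
    then have "?B \<in> sets borel" by simp
    then show "?A \<union> ?B \<in> sets lborel" by simp
  qed
  also have "\<dots> \<le> emeasure lborel ?A + emeasure lborel ?B"
  proof (rule emeasure_subadditive)
    have "?B = cball 0 (sqrt (1 - 1 / n)) - cball 0 (sqrt (1 - 3 / n))" by auto
    then show "?B \<in> sets lborel" by simp
  qed simp
  also have "emeasure lborel ?A = ennreal (pi * (2 / n))"
    by (subst emeasure_disc) auto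
  also have "emeasure lborel ?B = ennreal (pi * (2 / n))"
    using n3 by (subst emeasure_annulus) (auto simp: field_simps)
  also have "ennreal (pi * (2 / n)) + ennreal (pi * (2 / n)) = ennreal (4 * pi / n)"
    by (subst ennreal_plus[symmetric]) (auto simp: field_simps)
  finally show ?thesis .
qed

abbreviation tr :: "(complex \<Rightarrow> complex) \<Rightarrow> real" where "tr L \<equiv> Re (L 1) + Im (L \<i>)"

text \<open>The weak form of the divergence theorem for a radial test function: add the defining identities of
  the two weak partial derivatives, paired with the two coordinates.\<close>

lemma test_integral_of_trace:
  fixes h :: "complex \<Rightarrow> complex"
  assumes h: "has_weak_differential h D U" and \<phi>: "test_function U \<phi>"
    and G: "\<And>x v. frechet_derivative \<phi> (at x) v = G x * (x \<bullet> v)"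
  shows "set_integrable lebesgue U (\<lambda>x. \<phi> x * tr (D x))"
    and "set_integrable lebesgue U (\<lambda>x. G x * (x \<bullet> h x))"
    and "(LINT x:U|lebesgue. \<phi> x * tr (D x)) = - (LINT x:U|lebesgue. G x * (x \<bullet> h x))"
proof -
  let ?P = "\<lambda>b x. indicator U x *\<^sub>R \<phi> x *\<^sub>R D x b"
  let ?G = "\<lambda>b x. indicator U x *\<^sub>R frechet_derivative \<phi> (at x) b *\<^sub>R h x"
  have B: "1 \<in> (Basis :: complex set)" "\<i> \<in> (Basis :: complex set)" by (auto simp: Basis_complex_def)
  have li: "locally_integrable U h" "locally_integrable U (\<lambda>x. D x 1)" "locally_integrable U (\<lambda>x. D x \<i>)"
    using h B unfolding has_weak_differential_def by blast+
  have D: "integrable lebesgue (?P 1)"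
    "integrable lebesgue (?P \<i>)"
    using test_function_mult_integrable[OF \<phi> li(2)] test_function_mult_integrable[OF \<phi> li(3)]
    by (simp_all add: set_integrable_def)
  have gint: "integrable lebesgue (?G b)" if b: "b \<in> Basis" for b
  proof -
    obtain K where K: "compact K" "K \<subseteq> U" "\<And>x. x \<notin> K \<Longrightarrow> \<phi> x = 0"
      using test_function_support[OF \<phi>] by blast
    have 0: "frechet_derivative \<phi> (at x) b = 0" if "x \<notin> K" for x
      using derivative_eq_0_off_closed_support[OF test_function_has_derivative(1)[OF \<phi>] _ that K(3)]
        compact_imp_closed[OF K(1)] by simp
    show ?thesis
      using compact_support_mult_integrable[OF test_function_has_derivative(2)[OF \<phi> b] K(1,2) 0 li(1)]
      unfolding set_integrable_def .
  qed
  have tr: "indicator U x *\<^sub>R (\<phi> x * tr (D x)) =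
      Re (?P 1 x) + Im (?P \<i> x)" for x
    by (simp add: algebra_simps)
  have rad: "indicator U x *\<^sub>R (G x * (x \<bullet> h x)) =
      Re (?G 1 x) +
      Im (?G \<i> x)" for x
    by (simp add: G inner_complex_def algebra_simps)
  show "set_integrable lebesgue U (\<lambda>x. \<phi> x * tr (D x))"
    unfolding set_integrable_def tr by (intro Bochner_Integration.integrable_add integrable_Re integrable_Im D)
  show "set_integrable lebesgue U (\<lambda>x. G x * (x \<bullet> h x))"
    unfolding set_integrable_def rad by (intro Bochner_Integration.integrable_add integrable_Re integrable_Im gint B)
  have weak: "(LINT x|lebesgue. ?G b x) =
      - (LINT x|lebesgue. ?P b x)" if "b \<in> Basis" for b
    using h that \<phi> unfolding has_weak_differential_def set_lebesgue_integral_def by blast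
  have "(LINT x:U|lebesgue. \<phi> x * tr (D x)) =
      Re (LINT x|lebesgue. ?P 1 x) + Im (LINT x|lebesgue. ?P \<i> x)"
    unfolding set_lebesgue_integral_def tr
    by (simp only: Bochner_Integration.integral_add[OF integrable_Re[OF D(1)] integrable_Im[OF D(2)]]
        integral_Re[OF D(1)] integral_Im[OF D(2)])
  also have "\<dots> = - (Re (LINT x|lebesgue. ?G 1 x) +
      Im (LINT x|lebesgue. ?G \<i> x))"
    by (simp only: weak[OF B(1)] weak[OF B(2)]) simp
  also have "Re (LINT x|lebesgue. ?G 1 x) +
      Im (LINT x|lebesgue. ?G \<i> x) =
      (LINT x:U|lebesgue. G x * (x \<bullet> h x))"
    unfolding set_lebesgue_integral_def rad
    by (simp only: Bochner_Integration.integral_add[OF integrable_Re[OF gint[OF B(1)]] integrable_Im[OF gint[OF B(2)]]]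
        integral_Re[OF gint[OF B(1)]] integral_Im[OF gint[OF B(2)]])
  finally show "(LINT x:U|lebesgue. \<phi> x * tr (D x)) = - (LINT x:U|lebesgue. G x * (x \<bullet> h x))" .
qed

lemma id_has_weak_differential: "open U \<Longrightarrow> has_weak_differential (\<lambda>x. x) (\<lambda>x v. v) U"
  by (rule C1_has_weak_differential) (auto intro!: derivative_eq_intros)

lemma hs_norm_complex:
  assumes "linear L"
  shows "hs_norm L = sqrt ((norm (L 1))\<^sup>2 + (norm (L \<i>))\<^sup>2)"
  by (simp add: hs_norm_linear[OF assms] Basis_complex_def)

lemma energy_id: "energy p \<A> (\<lambda>x. x) = ennreal (pi * sqrt 2 powr p)"
proof -
  have "hs_norm (\<lambda>v::complex. v) = sqrt 2"
    using hs_norm_complex[of "\<lambda>v. v"] by (simp add: linear_id[unfolded id_def])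
  then have "energy p \<A> (\<lambda>x. x) = (\<integral>\<^sup>+x\<in>\<A>. ennreal (sqrt 2 powr p) \<partial>lebesgue)"
    by (subst energy_eq[OF open_annulus id_has_weak_differential[OF open_annulus]]) simp
  also have "\<dots> = ennreal (sqrt 2 powr p) * emeasure lborel \<A>"
    using open_annulus[of 0 1] by (simp add: nn_integral_completion nn_integral_cmult_indicator)
  finally show ?thesis by (simp add: emeasure_punctured_disc ennreal_mult[symmetric] mult.commute)
qed

lemma trace_le_hs_norm:
  fixes L :: "complex \<Rightarrow> complex"
  assumes "linear L"
  shows "\<bar>Re (L 1) + Im (L \<i>)\<bar> \<le> sqrt 2 * hs_norm L"
proof -
  have "(Re (L 1) + Im (L \<i>))\<^sup>2 \<le> 2 * ((Re (L 1))\<^sup>2 + (Im (L \<i>))\<^sup>2)"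
    using sum_squares_bound[of "Re (L 1)" "Im (L \<i>)"] by (simp add: power2_sum)
  also have "\<dots> \<le> 2 * ((norm (L 1))\<^sup>2 + (norm (L \<i>))\<^sup>2)"
    by (simp add: cmod_power2)
  finally have "\<bar>Re (L 1) + Im (L \<i>)\<bar> \<le> sqrt (2 * ((norm (L 1))\<^sup>2 + (norm (L \<i>))\<^sup>2))"
    by (intro real_le_rsqrt) simp
  then show ?thesis unfolding hs_norm_complex[OF assms] real_sqrt_mult .
qed

text \<open>The graph of a convex power lies above its tangent at \<open>c\<close>. Integrating this affine minorant
  reduces the \<open>p\<close>-energy to the \<open>1\<close>-energy.\<close>

lemma powr_tangent_bound:
  fixes y c p :: real
  assumes "y \<ge> 0" "c > 0" "p \<ge> 1"
  shows "p * c powr (p - 1) * y - (p - 1) * c powr p \<le> y powr p"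
proof (cases "y = 0")
  case False
  then have y: "y > 0" using assms by simp
  have "y powr p - c powr p \<ge> (p * c powr (p - 1)) * (y - c)"
  proof (rule convex_on_imp_above_tangent[OF powr_convex[OF assms(3)]])
    show "((\<lambda>x. x powr p) has_real_derivative p * c powr (p - 1)) (at c within {0<..})"
      using has_real_derivative_powr[OF assms(2), of p] by (rule has_field_derivative_at_within)
  qed (use y assms in \<open>auto simp: interior_open\<close>)
  moreover have "p * c powr (p - 1) * c = p * c powr p"
    using assms(2) by (simp add: powr_diff)
  ultimately show ?thesis by (simp add: right_diff_distrib left_diff_distrib)
qed (use assms in auto)

lemma cutoff_integral_tendsto:
  "(\<lambda>n. LINT x:\<A>|lebesgue. cutoff n x * 2) \<longlonglongrightarrow> 2 * pi"
proof -
  have U: "\<A> \<in> sets lebesgue" using open_annulus[of 0 1] by simp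
  have fin: "emeasure lebesgue \<A> = ennreal pi"
    using emeasure_punctured_disc open_annulus[of 0 1] by simp
  have int: "integrable lebesgue (\<lambda>x. indicat_real \<A> x * 2)"
    using U fin by (intro integrable_mult_left integrable_real_indicator) auto
  have "(\<lambda>n. \<integral>x. indicator \<A> x *\<^sub>R (cutoff n x * 2) \<partial>lebesgue) \<longlonglongrightarrow>
      (\<integral>x. indicat_real \<A> x * 2 \<partial>lebesgue)"
  proof (rule integral_dominated_convergence[OF _ _ int])
    show "(\<lambda>x. indicat_real \<A> x * 2) \<in> borel_measurable lebesgue"
      using int by (rule borel_measurable_integrable)
    show "(\<lambda>x. indicator \<A> x *\<^sub>R (cutoff n x * 2)) \<in> borel_measurable lebesgue" for n
    proof -
      have "continuous_on UNIV (cutoff n)" using smooth_imp_Ck[OF smooth_cutoff, of 0] by simp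
      then have "cutoff n \<in> borel_measurable borel" by (rule borel_measurable_continuous_onI)
      then have "cutoff n \<in> borel_measurable lebesgue" by (simp add: measurable_completion)
      then show ?thesis
        using U by (intro borel_measurable_scaleR borel_measurable_times borel_measurable_indicator) auto
    qed
    show "AE x in lebesgue. (\<lambda>n. indicator \<A> x *\<^sub>R (cutoff n x * 2)) \<longlonglongrightarrow> indicat_real \<A> x * 2"
    proof (rule AE_I2)
      fix x
      show "(\<lambda>n. indicator \<A> x *\<^sub>R (cutoff n x * 2)) \<longlonglongrightarrow> indicat_real \<A> x * 2"
      proof (cases "x \<in> \<A>")
        case True
        have "(\<lambda>n. cutoff n x * 2) \<longlonglongrightarrow> 1 * 2"
          by (intro tendsto_intros cutoff_tendsto_1 True)
        then show ?thesis using True by simp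
      qed simp
    qed
    show "AE x in lebesgue. norm (indicator \<A> x *\<^sub>R (cutoff n x * 2)) \<le> indicat_real \<A> x * 2" for n
      using cutoff_bounds by (intro AE_I2) (auto simp: indicator_def)
  qed
  also have "(\<integral>x. indicat_real \<A> x * 2 \<partial>lebesgue) = 2 * pi"
    using U fin by (simp add: measure_def)
  finally show ?thesis unfolding set_lebesgue_integral_def .
qed

text \<open>The divergence integral is determined by the boundary behaviour. Testing \<open>\<sigma> h - x\<close> with the cutoffs, only
  the two rings that carry the gradient matter. There \<open>\<sigma> h - x\<close> is small, while the gradients
  have bounded integrals; the remaining term is the divergence \<open>2\<close> of the identity.\<close>

lemma trace_integrals_tendsto:
  fixes h :: "complex \<Rightarrow> complex" and \<sigma> :: real
  assumes h: "has_weak_differential h D \<A>"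
    and near: "\<And>\<epsilon>. \<epsilon> > 0 \<Longrightarrow> \<exists>\<delta>>0. \<forall>x\<in>\<A>. norm x \<le> \<delta> \<or> 1 - \<delta> \<le> norm x \<longrightarrow> norm (\<sigma> *\<^sub>R h x - x) \<le> \<epsilon>"
  shows "(\<lambda>n. LINT x:\<A>|lebesgue. cutoff n x * (\<sigma> * tr (D x))) \<longlonglongrightarrow> 2 * pi"
proof -
  obtain G :: "nat \<Rightarrow> complex \<Rightarrow> real" and M :: real where M: "M > 0"
    and G: "\<And>n x v. frechet_derivative (cutoff n) (at x) v = G n x * (x \<bullet> v)"
    and Gb: "\<And>n x. n \<ge> 2 \<Longrightarrow> \<bar>G n x\<bar> \<le> n * M * indicator (cutoff_shell n) x"
    using cutoff_gradient by metis
  define E where "E n = (LINT x:\<A>|lebesgue. G n x * (x \<bullet> (\<sigma> *\<^sub>R h x - x)))" for n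
  have id: "has_weak_differential (\<lambda>x. x) (\<lambda>x v. v) \<A>"
    by (rule id_has_weak_differential[OF open_annulus])
  have Eint: "set_integrable lebesgue \<A> (\<lambda>x. G n x * (x \<bullet> (\<sigma> *\<^sub>R h x - x)))"
    and eq: "(LINT x:\<A>|lebesgue. cutoff n x * (\<sigma> * tr (D x))) =
      (LINT x:\<A>|lebesgue. cutoff n x * 2) - E n" if "n > 0" for n
  proof -
    note t = test_integral_of_trace[OF h test_function_cutoff[OF that] G]
    note t' = test_integral_of_trace[OF id test_function_cutoff[OF that] G]
    have split: "G n x * (x \<bullet> (\<sigma> *\<^sub>R h x - x)) = \<sigma> * (G n x * (x \<bullet> h x)) - G n x * (x \<bullet> x)" for x
      by (simp add: inner_diff_right algebra_simps)
    show "set_integrable lebesgue \<A> (\<lambda>x. G n x * (x \<bullet> (\<sigma> *\<^sub>R h x - x)))"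
      unfolding split by (intro set_integral_diff set_integrable_mult_right t t')
    have "E n = \<sigma> * (LINT x:\<A>|lebesgue. G n x * (x \<bullet> h x)) - (LINT x:\<A>|lebesgue. G n x * (x \<bullet> x))"
      unfolding E_def split using t(2) t'(2) by (simp add: set_integral_diff)
    also have "\<dots> = - \<sigma> * (LINT x:\<A>|lebesgue. cutoff n x * tr (D x)) + (LINT x:\<A>|lebesgue. cutoff n x * 2)"
      using t(3) t'(3) by simp
    finally show "(LINT x:\<A>|lebesgue. cutoff n x * (\<sigma> * tr (D x))) =
      (LINT x:\<A>|lebesgue. cutoff n x * 2) - E n"
      by (simp add: mult.left_commute[of _ \<sigma>])
  qed
  have "E \<longlonglongrightarrow> 0"
  proof (rule tendstoI)
    fix e :: real assume e: "e > 0"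
    \<comment> \<open>gradient bound \<open>n M\<close> times ring area \<open>4 \<pi> / n\<close> times \<open>\<epsilon>\<close> is \<open>e / 2\<close>\<close>
    define \<epsilon> where "\<epsilon> = e / (8 * pi * M)"
    have \<epsilon>: "\<epsilon> > 0" using e M by (simp add: \<epsilon>_def)
    obtain \<delta>0 where \<delta>0: "\<delta>0 > 0" "\<And>x. x \<in> \<A> \<Longrightarrow> norm x \<le> \<delta>0 \<or> 1 - \<delta>0 \<le> norm x \<Longrightarrow> norm (\<sigma> *\<^sub>R h x - x) \<le> \<epsilon>"
      using near[OF \<epsilon>] by blast
    define \<delta> where "\<delta> = min \<delta>0 1"
    have \<delta>: "\<delta> > 0" "\<delta> \<le> 1" "\<delta> \<le> \<delta>0" using \<delta>0(1) by (auto simp: \<delta>_def)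
    have "\<forall>\<^sub>F n in sequentially. real n \<ge> max 3 (2 / \<delta>\<^sup>2)"
      using filterlim_real_sequentially unfolding filterlim_at_top by blast
    then show "\<forall>\<^sub>F n in sequentially. dist (E n) 0 < e"
    proof eventually_elim
      case (elim n)
      then have n: "n \<ge> 3" "2 / real n \<le> \<delta>\<^sup>2" using \<delta>(1) by (auto simp: field_simps)
      have S: "cutoff_shell n \<in> sets lebesgue" using closed_cutoff_shell[of n] by simp
      have mS: "emeasure lebesgue (cutoff_shell n) \<le> ennreal (4 * pi / n)"
        using emeasure_cutoff_shell[OF n(1)] closed_cutoff_shell[of n] by simp
      have Sint: "integrable lebesgue (\<lambda>x. n * M * \<epsilon> * indicat_real (cutoff_shell n) x)"
        using S le_less_trans[OF mS ennreal_less_top]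
        by (intro integrable_mult_right integrable_real_indicator) auto
      have bound: "norm (indicator \<A> x *\<^sub>R (G n x * (x \<bullet> (\<sigma> *\<^sub>R h x - x)))) \<le> n * M * \<epsilon> * indicat_real (cutoff_shell n) x" for x
      proof (cases "x \<in> \<A> \<and> x \<in> cutoff_shell n")
        case True
        have "norm x \<le> \<delta> \<or> 1 - \<delta> \<le> norm x"
        proof -
          have "x \<bullet> x \<le> 2 / n \<or> 1 - 2 / n \<le> x \<bullet> x" using True by (auto simp: cutoff_shell_def)
          moreover have "norm x \<le> \<delta>" if "x \<bullet> x \<le> 2 / n"
            using that n(2) \<delta>(1) by (simp add: norm_eq_sqrt_inner real_le_lsqrt)
          moreover have "1 - \<delta> \<le> norm x" if "1 - 2 / n \<le> x \<bullet> x"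
          proof -
            have "\<delta> * \<delta> \<le> \<delta> * 1" using \<delta> by (intro mult_left_mono) auto
            then have "(1 - \<delta>)\<^sup>2 \<le> 1 - \<delta>\<^sup>2" by (simp add: power2_eq_square algebra_simps)
            then show ?thesis using that n(2) by (simp add: norm_eq_sqrt_inner real_le_rsqrt)
          qed
          ultimately show ?thesis by blast
        qed
        then have "norm (\<sigma> *\<^sub>R h x - x) \<le> \<epsilon>" using \<delta>0(2)[of x] True \<delta>(3) by auto
        moreover have "norm x \<le> 1" using True by (simp add: annulus_def)
        ultimately have "norm x * norm (\<sigma> *\<^sub>R h x - x) \<le> 1 * \<epsilon>" by (intro mult_mono) auto
        then have "\<bar>x \<bullet> (\<sigma> *\<^sub>R h x - x)\<bar> \<le> \<epsilon>"
          using Cauchy_Schwarz_ineq2[of x "\<sigma> *\<^sub>R h x - x"] by linarith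
        moreover have "\<bar>G n x\<bar> \<le> n * M" using Gb[of n x] n(1) True by simp
        ultimately have "\<bar>G n x\<bar> * \<bar>x \<bullet> (\<sigma> *\<^sub>R h x - x)\<bar> \<le> n * M * \<epsilon>"
          using M by (intro mult_mono) auto
        then show ?thesis using True by (simp add: abs_mult)
      next
        case False
        then have "x \<notin> \<A> \<or> G n x = 0" using Gb[of n x] n(1) by auto
        then show ?thesis using M \<epsilon> by auto
      qed
      have "norm (E n) \<le> (\<integral>x. norm (indicator \<A> x *\<^sub>R (G n x * (x \<bullet> (\<sigma> *\<^sub>R h x - x)))) \<partial>lebesgue)"
        unfolding E_def set_lebesgue_integral_def by (rule integral_norm_bound)
      also have "\<dots> \<le> (\<integral>x. n * M * \<epsilon> * indicat_real (cutoff_shell n) x \<partial>lebesgue)"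
        using Eint[of n] n(1) bound unfolding set_integrable_def
        by (intro integral_mono integrable_norm Sint) auto
      also have "\<dots> = n * M * \<epsilon> * measure lebesgue (cutoff_shell n)"
        using S by simp
      also have "\<dots> \<le> n * M * \<epsilon> * (4 * pi / n)"
        using M \<epsilon> mS enn2real_mono[OF mS] by (intro mult_left_mono) (auto simp: measure_def)
      also have "\<dots> = e / 2" using n(1) M by (simp add: \<epsilon>_def)
      finally show ?case using e by simp
    qed
  qed
  from tendsto_diff[OF cutoff_integral_tendsto this]
  have lim: "(\<lambda>n. (LINT x:\<A>|lebesgue. cutoff n x * 2) - E n) \<longlonglongrightarrow> 2 * pi"
    unfolding diff_zero .
  show ?thesis
  proof (rule Lim_transform_eventually[OF lim])
    show "\<forall>\<^sub>F n in sequentially. (LINT x:\<A>|lebesgue. cutoff n x * 2) - E n =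
        (LINT x:\<A>|lebesgue. cutoff n x * (\<sigma> * tr (D x)))"
      by (rule eventually_sequentiallyI[of 1]) (simp only: eq)
  qed
qed

text \<open>The tangent bound at \<open>sqrt 2\<close>, the value of \<open>|D Id|\<close>, loses nothing for the identity; it is
  combined with \<open>|tr D| \<le> sqrt 2 * |D|\<close>.\<close>

lemma powr_energy_ge_if_trace_integrals_tendsto:
  fixes h :: "complex \<Rightarrow> complex" and \<sigma> :: real
  assumes h: "has_weak_differential h D \<A>" and p: "p \<ge> 1" and \<sigma>: "\<bar>\<sigma>\<bar> = 1"
    and lim: "(\<lambda>n. LINT x:\<A>|lebesgue. cutoff n x * (\<sigma> * tr (D x))) \<longlonglongrightarrow> 2 * pi"
  shows "ennreal (pi * sqrt 2 powr p) \<le> (\<integral>\<^sup>+x\<in>\<A>. ennreal (hs_norm (D x) powr p) \<partial>lebesgue)"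
proof -
  let ?c = "sqrt 2"
  define a where "a = p * ?c powr (p - 1) / ?c"
  define b where "b = (p - 1) * ?c powr p"
  let ?t = "\<lambda>n x. cutoff n x * (\<sigma> * tr (D x))"
  have U: "\<A> \<in> sets lebesgue" "emeasure lebesgue \<A> = ennreal pi"
    using emeasure_punctured_disc open_annulus[of 0 1] by auto
  have mU: "measure lebesgue \<A> = pi" using U(2) by (simp add: measure_def)
  have le: "ennreal (a * (LINT x:\<A>|lebesgue. ?t n x) - b * pi) \<le> (\<integral>\<^sup>+x\<in>\<A>. ennreal (hs_norm (D x) powr p) \<partial>lebesgue)"
    if n: "n > 0" for n
  proof -
    obtain G :: "nat \<Rightarrow> complex \<Rightarrow> real" where G: "\<And>n x v. frechet_derivative (cutoff n) (at x) v = G n x * (x \<bullet> v)"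
      using cutoff_gradient by metis
    let ?g = "\<lambda>x. a * (indicator \<A> x *\<^sub>R ?t n x) - b * indicat_real \<A> x"
    have "set_integrable lebesgue \<A> (\<lambda>x. \<sigma> * (cutoff n x * tr (D x)))"
      by (intro set_integrable_mult_right test_integral_of_trace(1)[OF h test_function_cutoff[OF n] G])
    then have ti: "integrable lebesgue (\<lambda>x. indicator \<A> x *\<^sub>R ?t n x)"
      by (simp add: set_integrable_def mult.left_commute)
    have bi: "integrable lebesgue (\<lambda>x. b * indicat_real \<A> x)"
      using U by (intro integrable_mult_right integrable_real_indicator) auto
    have gi: "integrable lebesgue ?g"
      by (intro Bochner_Integration.integrable_diff integrable_mult_right ti bi)
    have pt: "ennreal (max 0 (?g x)) \<le> ennreal (hs_norm (D x) powr p) * indicator \<A> x" for x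
    proof (cases "x \<in> \<A>")
      case True
      let ?y = "hs_norm (D x)"
      have lin: "linear (D x)" using h True unfolding has_weak_differential_def by blast
      have y: "?y \<ge> 0" by (simp add: hs_norm_complex[OF lin])
      have "?t n x \<le> \<bar>?t n x\<bar>" by simp
      also have "\<dots> = cutoff n x * \<bar>tr (D x)\<bar>"
        using \<sigma> cutoff_bounds(1)[of n x] by (simp add: abs_mult)
      also have "\<dots> \<le> 1 * (?c * ?y)"
        using cutoff_bounds[of n x] trace_le_hs_norm[OF lin] by (intro mult_mono) auto
      finally have "a * ?t n x \<le> a * (?c * ?y)"
        using p by (intro mult_left_mono) (auto simp: a_def)
      also have "\<dots> = p * ?c powr (p - 1) * ?y" by (simp add: a_def)
      finally have "?g x \<le> p * ?c powr (p - 1) * ?y - (p - 1) * ?c powr p"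
        using True by (simp add: b_def)
      also have "\<dots> \<le> ?y powr p" by (rule powr_tangent_bound[OF y _ p]) simp
      finally show ?thesis using True by (simp add: ennreal_leI)
    qed simp
    have "a * (LINT x:\<A>|lebesgue. ?t n x) - b * pi = (\<integral>x. ?g x \<partial>lebesgue)"
      using ti bi U mU by (simp add: set_lebesgue_integral_def)
    also have "\<dots> \<le> (\<integral>x. max 0 (?g x) \<partial>lebesgue)"
      by (intro integral_mono gi integrable_max) auto
    finally have "ennreal (a * (LINT x:\<A>|lebesgue. ?t n x) - b * pi) \<le> ennreal (\<integral>x. max 0 (?g x) \<partial>lebesgue)"
      by (rule ennreal_leI)
    also have "\<dots> = (\<integral>\<^sup>+x. ennreal (max 0 (?g x)) \<partial>lebesgue)"
      by (intro nn_integral_eq_integral[symmetric] integrable_max gi) auto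
    also have "\<dots> \<le> (\<integral>\<^sup>+x\<in>\<A>. ennreal (hs_norm (D x) powr p) \<partial>lebesgue)"
      by (intro nn_integral_mono pt)
    finally show ?thesis .
  qed
  have "(\<lambda>n. ennreal (a * (LINT x:\<A>|lebesgue. ?t n x) - b * pi)) \<longlonglongrightarrow> ennreal (a * (2 * pi) - b * pi)"
    by (intro tendsto_ennrealI tendsto_intros lim)
  moreover have "a * (2 * pi) - b * pi = pi * ?c powr p"
  proof -
    have "?c powr (p - 1) = ?c powr p / ?c" by (simp add: powr_diff)
    then have "a * 2 = p * ?c powr p" by (simp add: a_def)
    then show ?thesis by (simp add: b_def algebra_simps)
  qed
  ultimately have "(\<lambda>n. ennreal (a * (LINT x:\<A>|lebesgue. ?t n x) - b * pi)) \<longlonglongrightarrow> ennreal (pi * ?c powr p)"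
    by simp
  then show ?thesis
    by (rule LIMSEQ_le_const2) (use le in \<open>auto intro: exI[of _ 1]\<close>)
qed

text \<open>The profile \<open>H\<close> is continuous without zeros on \<open>(0,1)\<close>, so it has a constant sign \<open>\<sigma>\<close>. A negative profile
  is possible: it is a radial stretching followed by the rotation by \<open>\<pi>\<close>.\<close>

lemma radial_map_aligned:
  fixes h :: "complex \<Rightarrow> complex" and H :: "real \<Rightarrow> real"
  assumes cont: "continuous_on \<A> h" and nz: "\<And>x. x \<in> \<A> \<Longrightarrow> h x \<noteq> 0"
    and H: "\<And>x. x \<in> \<A> \<Longrightarrow> h x = H (norm x) *\<^sub>R (x /\<^sub>R norm x)"
  obtains \<sigma> :: real where "\<bar>\<sigma>\<bar> = 1" "\<And>x. x \<in> \<A> \<Longrightarrow> norm (\<sigma> *\<^sub>R h x - x) = \<bar>norm (h x) - norm x\<bar>"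
proof -
  have ann: "of_real t \<in> \<A>" if "t \<in> {0<..<1}" for t
    using that by (simp add: annulus_def)
  have Ht: "H t = Re (h (of_real t))" if "t \<in> {0<..<1}" for t
    using H[OF ann[OF that]] that by simp
  have "continuous_on {0<..<1} (\<lambda>t. Re (h (of_real t)))"
    by (intro continuous_intros continuous_on_compose2[OF cont]) (use ann in auto)
  then have contH: "continuous_on {0<..<1} H"
    by (rule continuous_on_eq) (simp add: Ht)
  have H0: "H t \<noteq> 0" if "t \<in> {0<..<1}" for t
    using H[OF ann[OF that]] nz[OF ann[OF that]] that by auto
  define \<sigma> where "\<sigma> = sgn (H (1/2))"
  have \<sigma>1: "\<bar>\<sigma>\<bar> = 1" "\<sigma> * H (1/2) > 0" using H0[of "1/2"] by (auto simp: \<sigma>_def sgn_real_def)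
  have conn: "connected ((\<lambda>t. \<sigma> * H t) ` {0<..<1})"
    by (intro connected_continuous_image continuous_intros contH) simp
  have "\<sigma> * H t > 0" if t: "t \<in> {0<..<1}" for t
  proof (rule ccontr)
    assume "\<not> \<sigma> * H t > 0"
    moreover have "\<sigma> * H s \<in> (\<lambda>t. \<sigma> * H t) ` {0<..<1}" if "s \<in> {0<..<1}" for s
      using that by (rule imageI)
    from connectedD_interval[OF conn this[OF t] this[of "1/2"], of 0]
    have "\<sigma> * H t \<le> 0 \<Longrightarrow> 0 \<in> (\<lambda>t. \<sigma> * H t) ` {0<..<1}" using \<sigma>1(2) by simp
    ultimately have "0 \<in> (\<lambda>t. \<sigma> * H t) ` {0<..<1}" by simp
    then show False using H0 \<sigma>1(1) by auto
  qed
  note \<sigma> = \<sigma>1(1) this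
  show ?thesis
  proof (rule that[OF \<sigma>(1)])
    fix x :: complex assume x: "x \<in> \<A>"
    then have nx: "norm x \<in> {0<..<1}" by (simp add: annulus_def)
    have "norm (h x) = \<bar>\<sigma> * H (norm x)\<bar>"
      using nx by (simp add: H[OF x] abs_mult \<sigma>(1))
    then have "norm (h x) = \<sigma> * H (norm x)" using \<sigma>(2)[OF nx] by simp
    then have "\<sigma> *\<^sub>R h x - x = ((norm (h x) - norm x) / norm x) *\<^sub>R x"
      using nx by (simp add: H[OF x] scaleR_diff_left divide_inverse algebra_simps)
    then show "norm (\<sigma> *\<^sub>R h x - x) = \<bar>norm (h x) - norm x\<bar>"
      using nx by simp
  qed
qed

theorem radial_energy_ge:
  assumes p: "p \<ge> 1" and h: "h \<in> radial_homeos p 0 1 0 1"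
  shows "ennreal (pi * sqrt 2 powr p) \<le> energy p \<A> h"
proof -
  obtain H g D where g: "homeomorphism \<A> \<A> h g"
    and lim: "((\<lambda>x. norm (h x)) \<longlongrightarrow> 0) (filtercomap norm (at_right 0))"
      "((\<lambda>x. norm (h x)) \<longlongrightarrow> 1) (filtercomap norm (at_left 1))"
    and H: "\<And>x. x \<in> \<A> \<Longrightarrow> h x = H (norm x) *\<^sub>R (x /\<^sub>R norm x)"
    and D0: "has_weak_differential h D \<A>"
    using h unfolding radial_homeos_def annulus_homeos_def sobolev_W1_def by blast
  have D: "has_weak_differential h (weak_differential \<A> h) \<A>"
    unfolding weak_differential_def by (rule someI[of "\<lambda>D. has_weak_differential h D \<A>", OF D0])
  have hU: "h x \<in> \<A>" if "x \<in> \<A>" for x using g that unfolding homeomorphism_def by blast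
  have cont: "continuous_on \<A> h" using g unfolding homeomorphism_def by blast
  have nz: "h x \<noteq> 0" if "x \<in> \<A>" for x using hU[OF that] by (auto simp: annulus_def)
  obtain \<sigma> :: real where \<sigma>: "\<bar>\<sigma>\<bar> = 1" "\<And>x. x \<in> \<A> \<Longrightarrow> norm (\<sigma> *\<^sub>R h x - x) = \<bar>norm (h x) - norm x\<bar>"
    using radial_map_aligned[OF cont nz H] by metis
  have near: "\<exists>\<delta>>0. \<forall>x\<in>\<A>. norm x \<le> \<delta> \<or> 1 - \<delta> \<le> norm x \<longrightarrow> norm (\<sigma> *\<^sub>R h x - x) \<le> \<epsilon>"
    if \<epsilon>: "\<epsilon> > 0" for \<epsilon>
  proof -
    have "\<forall>\<^sub>F x in filtercomap norm (at_right 0). dist (norm (h x)) 0 < \<epsilon> / 2"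
      using tendstoD[OF lim(1), of "\<epsilon> / 2"] \<epsilon> by simp
    then obtain P where P: "eventually P (at_right 0)" "\<And>x. P (norm x) \<Longrightarrow> norm (h x) < \<epsilon> / 2"
      unfolding eventually_filtercomap by auto
    then obtain d1 where d1: "d1 > 0" "\<And>t. 0 < t \<Longrightarrow> t < d1 \<Longrightarrow> P t"
      unfolding eventually_at_right_field by auto
    have "\<forall>\<^sub>F x in filtercomap norm (at_left 1). dist (norm (h x)) 1 < \<epsilon> / 2"
      using tendstoD[OF lim(2), of "\<epsilon> / 2"] \<epsilon> by simp
    then obtain Q where Q: "eventually Q (at_left 1)" "\<And>x. Q (norm x) \<Longrightarrow> \<bar>norm (h x) - 1\<bar> < \<epsilon> / 2"
      unfolding eventually_filtercomap dist_real_def by blast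
    then obtain d2 where d2: "d2 < 1" "\<And>t. d2 < t \<Longrightarrow> t < 1 \<Longrightarrow> Q t"
      unfolding eventually_at_left_field by auto
    define \<delta> where "\<delta> = min (\<epsilon> / 2) (min (d1 / 2) ((1 - d2) / 2))"
    have \<delta>: "\<delta> > 0" "\<delta> \<le> \<epsilon> / 2" "\<delta> < d1" "\<delta> < 1 - d2"
      using \<epsilon> d1(1) d2(1) by (auto simp: \<delta>_def min_def)
    have "norm (\<sigma> *\<^sub>R h x - x) \<le> \<epsilon>" if x: "x \<in> \<A>" and c: "norm x \<le> \<delta> \<or> 1 - \<delta> \<le> norm x" for x
      using c
    proof
      assume le: "norm x \<le> \<delta>"
      then have "P (norm x)" using x \<delta> by (intro d1) (auto simp: annulus_def)
      then have "norm (h x) < \<epsilon> / 2" by (rule P(2))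
      then show ?thesis unfolding \<sigma>(2)[OF x] using le \<delta> norm_ge_zero[of x] norm_ge_zero[of "h x"] by linarith
    next
      assume ge: "1 - \<delta> \<le> norm x"
      have x1: "norm x < 1" using x by (simp add: annulus_def)
      then have "Q (norm x)" using ge \<delta> by (intro d2) auto
      then have "\<bar>norm (h x) - 1\<bar> < \<epsilon> / 2" by (rule Q(2))
      then show ?thesis unfolding \<sigma>(2)[OF x] using ge \<delta> x1 by linarith
    qed
    then show ?thesis using \<delta>(1) by blast
  qed
  show ?thesis
    unfolding energy_def
    by (rule powr_energy_ge_if_trace_integrals_tendsto[OF D p \<sigma>(1) trace_integrals_tendsto[OF D near]])
qed

section \<open>Squeezing homeomorphisms of the punctured disk\<close>

text \<open>For \<open>\<bar>b\<bar> < 1\<close> a Moebius transformation that preserves the unit circle; for \<open>b\<close> near \<open>1\<close> it moves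
  almost all of the circle close to \<open>1\<close>. Its inverse has parameter \<open>- b\<close>.\<close>

definition mob :: "real \<Rightarrow> complex \<Rightarrow> complex" where
  "mob b u = (u + of_real b) / (1 + of_real b * u)"

text \<open>The exponent of the radial stretching in direction \<open>w\<close>: it equals \<open>a\<close> for \<open>w = 1\<close> and grows to
  \<open>a + 2 c\<close> at \<open>w = - 1\<close>.\<close>

definition rate :: "real \<Rightarrow> real \<Rightarrow> complex \<Rightarrow> real" where
  "rate a c w = a + c * (1 - Re w)"

definition squeeze :: "real \<Rightarrow> real \<Rightarrow> real \<Rightarrow> complex \<Rightarrow> complex" where
  "squeeze a b c z = of_real (norm z powr rate a c (mob b (sgn z))) * mob b (sgn z)"

definition unsqueeze :: "real \<Rightarrow> real \<Rightarrow> real \<Rightarrow> complex \<Rightarrow> complex" where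
  "unsqueeze a b c y = of_real (norm y powr (1 / rate a c (sgn y))) * mob (- b) (sgn y)"

lemma mob_denominator_nonzero:
  assumes "\<bar>b\<bar> < 1" "norm u \<le> 1" shows "1 + of_real b * u \<noteq> (0::complex)"
proof
  assume "1 + of_real b * u = 0"
  then have "of_real b * u = - 1" by (simp add: eq_neg_iff_add_eq_0 add.commute)
  then have "\<bar>b\<bar> * norm u = 1" by (metis norm_minus_cancel norm_mult norm_of_real norm_one)
  moreover have "\<bar>b\<bar> * norm u \<le> \<bar>b\<bar> * 1" using assms by (intro mult_left_mono) auto
  ultimately show False using assms by simp
qed

lemma mob_numerator: "norm u = 1 \<Longrightarrow> u + of_real b = u * cnj (1 + of_real b * u)"
  using complex_norm_square[of u] by (simp add: algebra_simps)

lemma norm_mob: "\<bar>b\<bar> < 1 \<Longrightarrow> norm u = 1 \<Longrightarrow> norm (mob b u) = 1"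
  using mob_denominator_nonzero[of b u]
  by (simp add: mob_def mob_numerator norm_divide norm_mult complex_mod_cnj del: complex_cnj_add)

lemma mob_uminus_mob:
  assumes "\<bar>b\<bar> < 1" "norm u = 1" shows "mob (- b) (mob b u) = u"
proof -
  let ?d = "1 + of_real b * u"
  have d: "?d \<noteq> 0" using assms by (intro mob_denominator_nonzero) auto
  have "b\<^sup>2 < 1" using assms(1) by (simp add: abs_square_less_1)
  then have b: "1 - (of_real b :: complex)\<^sup>2 \<noteq> 0"
    by (metis eq_iff_diff_eq_0 less_irrefl of_real_1 of_real_eq_iff of_real_power)
  have "mob b u - of_real b = (1 - of_real b ^ 2) * u / ?d"
    using d by (simp add: mob_def field_simps power2_eq_square)
  moreover have "1 - of_real b * mob b u = (1 - of_real b ^ 2) / ?d"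
    using d by (simp add: mob_def field_simps power2_eq_square)
  ultimately show ?thesis
    using d b unfolding mob_def[of "- b"] by simp
qed

lemma rate_ge:
  assumes "c \<ge> 0" "norm w = 1" shows "a \<le> rate a c w" "rate a c w \<le> a + 2 * c"
proof -
  have "\<bar>Re w\<bar> \<le> 1" using abs_Re_le_cmod[of w] assms(2) by simp
  then have "0 \<le> 1 - Re w" "1 - Re w \<le> 2" by auto
  then have "0 \<le> c * (1 - Re w)" "c * (1 - Re w) \<le> c * 2"
    using assms(1) by (auto intro: mult_left_mono)
  then show "a \<le> rate a c w" "rate a c w \<le> a + 2 * c" unfolding rate_def by linarith+
qed

lemma norm_squeeze:
  assumes "\<bar>b\<bar> < 1" "z \<noteq> 0"
  shows "norm (squeeze a b c z) = norm z powr rate a c (mob b (sgn z))"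
  using norm_mob[OF assms(1), of "sgn z"] assms by (simp add: squeeze_def norm_mult norm_sgn)

lemma sgn_squeeze:
  assumes "\<bar>b\<bar> < 1" "z \<noteq> 0"
  shows "sgn (squeeze a b c z) = mob b (sgn z)"
proof -
  have "norm (mob b (sgn z)) = 1" using norm_mob[OF assms(1), of "sgn z"] assms by (simp add: norm_sgn)
  then have "sgn (mob b (sgn z)) = mob b (sgn z)" by (simp add: sgn_div_norm)
  then show ?thesis using assms by (simp add: squeeze_def sgn_mult sgn_of_real)
qed

lemma unsqueeze_squeeze:
  assumes "a > 0" "\<bar>b\<bar> < 1" "c \<ge> 0" "z \<noteq> 0"
  shows "unsqueeze a b c (squeeze a b c z) = z"
proof -
  let ?w = "mob b (sgn z)"
  have s: "norm (sgn z) = 1" using assms by (simp add: norm_sgn)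
  have "rate a c ?w > 0" using rate_ge(1)[OF assms(3) norm_mob[OF assms(2) s], of a] assms(1) by linarith
  then have "unsqueeze a b c (squeeze a b c z) = of_real (norm z) * sgn z"
    using assms by (simp add: unsqueeze_def norm_squeeze sgn_squeeze powr_powr mob_uminus_mob s)
  then show ?thesis using assms(4) by (simp add: sgn_div_norm scaleR_conv_of_real)
qed

lemma squeeze_unsqueeze:
  assumes "a > 0" "\<bar>b\<bar> < 1" "c \<ge> 0" "y \<noteq> 0"
  shows "squeeze a b c (unsqueeze a b c y) = y"
proof -
  have s: "norm (sgn y) = 1" using assms by (simp add: norm_sgn)
  have r: "rate a c (sgn y) > 0" using rate_ge(1)[OF assms(3) s, of a] assms(1) by linarith
  let ?u = "mob (- b) (sgn y)"
  have u: "norm ?u = 1" using norm_mob[of "- b", OF _ s] assms by simp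
  have mu: "mob b ?u = sgn y" using mob_uminus_mob[of "- b" "sgn y"] s assms by simp
  have n: "norm (unsqueeze a b c y) = norm y powr (1 / rate a c (sgn y))"
    by (simp add: unsqueeze_def norm_mult u)
  have "sgn ?u = ?u" using u by (simp add: sgn_div_norm)
  then have sg: "sgn (unsqueeze a b c y) = ?u"
    using assms(4) by (simp add: unsqueeze_def sgn_mult sgn_of_real)
  have "squeeze a b c (unsqueeze a b c y) = of_real (norm y) * sgn y"
    using r assms(4) by (simp add: squeeze_def n sg mu powr_powr)
  then show ?thesis using assms(4) by (simp add: sgn_div_norm scaleR_conv_of_real)
qed

lemma norm_squeeze_bounds:
  assumes "a > 0" "\<bar>b\<bar> < 1" "c \<ge> 0" "z \<in> \<A>"
  shows "norm z powr (a + 2 * c) \<le> norm (squeeze a b c z)" "norm (squeeze a b c z) \<le> norm z powr a"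
proof -
  have z: "z \<noteq> 0" "norm z < 1" using assms(4) by (auto simp: annulus_def)
  have "norm (mob b (sgn z)) = 1" using z by (intro norm_mob assms) (simp add: norm_sgn)
  note r = rate_ge[OF assms(3) this, of a]
  show "norm z powr (a + 2 * c) \<le> norm (squeeze a b c z)" "norm (squeeze a b c z) \<le> norm z powr a"
    using z r by (auto simp: norm_squeeze[OF assms(2) z(1)] intro: powr_mono')
qed

lemma continuous_on_squeeze:
  assumes "continuous_on S a" "continuous_on S b" "continuous_on S c" "continuous_on S \<zeta>"
    and "\<And>x. x \<in> S \<Longrightarrow> \<zeta> x \<noteq> 0" "\<And>x. x \<in> S \<Longrightarrow> \<bar>b x\<bar> < 1"
  shows "continuous_on S (\<lambda>x. squeeze (a x) (b x) (c x) (\<zeta> x))"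
proof -
  have sg: "continuous_on S (\<lambda>x. sgn (\<zeta> x))"
    unfolding sgn_div_norm using assms by (intro continuous_intros) auto
  have m: "continuous_on S (\<lambda>x. mob (b x) (sgn (\<zeta> x)))"
    unfolding mob_def using assms
    by (intro continuous_intros sg mob_denominator_nonzero ballI) (auto simp: norm_sgn)
  show ?thesis
    unfolding squeeze_def rate_def using assms by (intro continuous_intros m) auto
qed

lemma annulus_nonzero: "z \<in> annulus 0 R \<Longrightarrow> z \<noteq> 0"
  by (auto simp: annulus_def)

lemma continuous_on_sgn_annulus: "continuous_on \<A> (sgn :: complex \<Rightarrow> complex)"
  unfolding sgn_div_norm using annulus_nonzero by (intro continuous_intros) auto

lemma mob_denominator_annulus:
  "\<bar>b\<bar> < 1 \<Longrightarrow> z \<in> \<A> \<Longrightarrow> 1 + of_real b * sgn z \<noteq> (0::complex)"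
  using annulus_nonzero[of z 1] by (intro mob_denominator_nonzero) (auto simp: norm_sgn)

lemma continuous_on_mob_sgn: "\<bar>b\<bar> < 1 \<Longrightarrow> continuous_on \<A> (\<lambda>z. mob b (sgn z))"
  unfolding mob_def by (intro continuous_intros continuous_on_sgn_annulus ballI mob_denominator_annulus)

lemma continuous_on_unsqueeze:
  assumes "a > 0" "\<bar>b\<bar> < 1" "c \<ge> 0"
  shows "continuous_on \<A> (unsqueeze a b c)"
proof -
  note nz = annulus_nonzero[of _ 1]
  have r: "rate a c (sgn y) \<noteq> 0" if "y \<in> \<A>" for y
    using rate_ge(1)[OF assms(3), of "sgn y" a] assms(1) nz[OF that] by (simp add: norm_sgn)
  have rc: "continuous_on \<A> (\<lambda>y. rate a c (sgn y))"
    unfolding rate_def by (intro continuous_intros continuous_on_sgn_annulus)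
  show ?thesis
    unfolding unsqueeze_def using nz r assms
    by (intro continuous_intros continuous_on_mob_sgn rc) auto
qed

lemma homeomorphism_squeeze:
  assumes "a > 0" "\<bar>b\<bar> < 1" "c \<ge> 0"
  shows "homeomorphism \<A> \<A> (squeeze a b c) (unsqueeze a b c)"
proof (rule homeomorphismI)
  note nz = annulus_nonzero[of _ 1]
  show "continuous_on \<A> (squeeze a b c)"
    using nz assms by (intro continuous_on_squeeze continuous_intros) auto
  show "continuous_on \<A> (unsqueeze a b c)"
    using assms by (rule continuous_on_unsqueeze)
  show "squeeze a b c ` \<A> \<subseteq> \<A>"
  proof safe
    fix z :: complex assume z: "z \<in> \<A>"
    then have "0 < norm z powr (a + 2 * c)" "norm z powr a < 1"
      using assms(1) nz[OF z] powr_less_mono2[of a "norm z" 1] by (auto simp: annulus_def)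
    then show "squeeze a b c z \<in> \<A>"
      using norm_squeeze_bounds[OF assms z] unfolding annulus_def mem_Collect_eq by linarith
  qed
  show "unsqueeze a b c ` \<A> \<subseteq> \<A>"
  proof safe
    fix y :: complex assume y: "y \<in> \<A>"
    have s: "norm (sgn y) = 1" using nz[OF y] by (simp add: norm_sgn)
    have r: "rate a c (sgn y) > 0" using rate_ge(1)[OF assms(3) s, of a] assms(1) by linarith
    have n: "norm (unsqueeze a b c y) = norm y powr (1 / rate a c (sgn y))"
      using norm_mob[of "- b", OF _ s] assms(2) by (simp add: unsqueeze_def norm_mult)
    show "unsqueeze a b c y \<in> \<A>"
      using y nz[OF y] r powr_less_mono2[of "1 / rate a c (sgn y)" "norm y" 1] by (simp add: annulus_def n del: zero_less_norm_iff)
  qed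
  show "unsqueeze a b c (squeeze a b c z) = z" if "z \<in> \<A>" for z
    by (rule unsqueeze_squeeze[OF assms nz[OF that]])
  show "squeeze a b c (unsqueeze a b c y) = y" if "y \<in> \<A>" for y
    by (rule squeeze_unsqueeze[OF assms nz[OF that]])
qed

lemma squeeze_boundary_limits:
  assumes "a > 0" "\<bar>b\<bar> < 1" "c \<ge> 0"
  shows "((\<lambda>x. norm (squeeze a b c x)) \<longlongrightarrow> 0) (filtercomap norm (at_right 0))"
    and "((\<lambda>x. norm (squeeze a b c x)) \<longlongrightarrow> 1) (filtercomap norm (at_left 1))"
proof -
  have ev0: "\<forall>\<^sub>F x::complex in filtercomap norm (at_right 0). x \<in> \<A>"
    unfolding eventually_filtercomap
    by (intro exI[of _ "\<lambda>t. 0 < t \<and> t < 1"]) (auto simp: annulus_def eventually_at_right_field intro!: exI[of _ 1])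
  have ev1: "\<forall>\<^sub>F x::complex in filtercomap norm (at_left 1). x \<in> \<A>"
    unfolding eventually_filtercomap
    by (intro exI[of _ "\<lambda>t. 0 < t \<and> t < 1"]) (auto simp: annulus_def eventually_at_left_field intro!: exI[of _ 0])
  have n0: "((\<lambda>x::complex. norm x) \<longlongrightarrow> 0) (filtercomap norm (at_right 0))"
    by (rule filterlim_mono[OF filterlim_filtercomap at_within_le_nhds order_refl])
  have n1: "((\<lambda>x::complex. norm x) \<longlongrightarrow> 1) (filtercomap norm (at_left 1))"
    by (rule filterlim_mono[OF filterlim_filtercomap at_within_le_nhds order_refl])
  have "((\<lambda>x::complex. norm x powr a) \<longlongrightarrow> 0 powr a) (filtercomap norm (at_right 0))"
    using assms(1) by (intro tendsto_powr2 n0 tendsto_const always_eventually) auto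
  then have up0: "((\<lambda>x::complex. norm x powr a) \<longlongrightarrow> 0) (filtercomap norm (at_right 0))" by simp
  show "((\<lambda>x. norm (squeeze a b c x)) \<longlongrightarrow> 0) (filtercomap norm (at_right 0))"
    by (rule tendsto_sandwich[OF _ _ tendsto_const up0])
      (use ev0 norm_squeeze_bounds[OF assms] in \<open>auto elim: eventually_mono\<close>)
  have lim1: "((\<lambda>x::complex. norm x powr k) \<longlongrightarrow> 1) (filtercomap norm (at_left 1))" for k
    using tendsto_powr[OF n1 tendsto_const[of k]] by simp
  show "((\<lambda>x. norm (squeeze a b c x)) \<longlongrightarrow> 1) (filtercomap norm (at_left 1))"
    by (rule tendsto_sandwich[OF _ _ lim1[of "a + 2 * c"] lim1[of a]])
      (use ev1 norm_squeeze_bounds[OF assms] in \<open>auto elim: eventually_mono\<close>)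
qed

lemma squeeze_trivial: "squeeze 1 0 0 z = z"
  by (cases "z = 0") (simp_all add: squeeze_def mob_def rate_def sgn_div_norm scaleR_conv_of_real)

text \<open>Interpolating the parameters linearly to \<open>a = 1\<close>, \<open>b = 0\<close>, \<open>c = 0\<close> joins the map to the
  identity. All intermediate maps are injective, so the image circles never meet the image of the
  centre and the winding number stays constant.\<close>

lemma orientation_preserving_squeeze:
  assumes "a > 0" "\<bar>b\<bar> < 1" "c \<ge> 0"
  shows "orientation_preserving \<A> (squeeze a b c)"
  unfolding orientation_preserving_def
proof (intro allI impI, elim conjE)
  fix z s assume s: "0 < s" and sub: "cball z s \<subseteq> \<A>"
  let ?C = "circlepath z s"
  let ?h = "\<lambda>\<tau>. squeeze (1 - \<tau> + \<tau> * a) (\<tau> * b) (\<tau> * c)"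
  note nz = annulus_nonzero[of _ 1]
  have zU: "z \<in> \<A>" using s sub by auto
  have CU: "?C x \<in> \<A>" and Cz: "?C x \<noteq> z" for x
  proof -
    have "dist z (?C x) = s"
      using s by (simp add: circlepath_def part_circlepath_def dist_norm norm_mult)
    then show "?C x \<in> \<A>" "?C x \<noteq> z" using sub s by auto
  qed
  have par: "0 < 1 - \<tau> + \<tau> * a" "\<bar>\<tau> * b\<bar> < 1" "0 \<le> \<tau> * c" if "\<tau> \<in> {0..1}" for \<tau>
  proof -
    show "0 < 1 - \<tau> + \<tau> * a"
      using that assms(1) by (cases "\<tau> = 1") (auto intro: add_pos_nonneg)
    have "\<bar>\<tau> * b\<bar> \<le> 1 * \<bar>b\<bar>" unfolding abs_mult using that by (intro mult_right_mono) auto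
    then show "\<bar>\<tau> * b\<bar> < 1" using assms(2) by linarith
    show "0 \<le> \<tau> * c" using that assms(3) by simp
  qed
  have contC: "continuous_on S ?C" for S
    unfolding circlepath_def part_circlepath_def linepath_def by (intro continuous_intros)
  have cont: "continuous_on ({0..1} \<times> {0..1}) (\<lambda>p. ?h (fst p) (?C (snd p)) - ?h (fst p) z)"
    using par nz CU zU
    by (intro continuous_on_diff continuous_on_squeeze continuous_intros continuous_on_compose2[OF contC[of UNIV]]) auto
  have C01: "?C 1 = ?C 0"
    by (metis pathfinish_circlepath pathstart_circlepath pathfinish_def pathstart_def)
  have inj: "?h \<tau> (?C x) \<noteq> ?h \<tau> z" if "\<tau> \<in> {0..1}" for \<tau> x
    using homeomorphism_squeeze[OF par[OF that]] CU Cz zU unfolding homeomorphism_def by metis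
  have "homotopic_loops (- {0}) (\<lambda>x. ?h 0 (?C x) - ?h 0 z) (\<lambda>x. ?h 1 (?C x) - ?h 1 z)"
    unfolding homotopic_loops
  proof (intro exI conjI)
    show "continuous_on ({0..1} \<times> {0..1}) (\<lambda>p. ?h (fst p) (?C (snd p)) - ?h (fst p) z)"
      by (rule cont)
  qed (use inj C01 in \<open>auto simp: pathfinish_def pathstart_def\<close>)
  then have "winding_number (\<lambda>x. ?h 0 (?C x) - ?h 0 z) 0 = winding_number (\<lambda>x. ?h 1 (?C x) - ?h 1 z) 0"
    by (rule winding_number_homotopic_loops)
  moreover have "winding_number (\<lambda>x. ?h 0 (?C x) - ?h 0 z) 0 = winding_number ?C z"
    by (subst winding_number_offset[of ?C]) (simp add: squeeze_trivial)
  moreover have "winding_number (\<lambda>x. ?h 1 (?C x) - ?h 1 z) 0 = winding_number (squeeze a b c \<circ> ?C) (squeeze a b c z)"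
    by (subst winding_number_offset[of "squeeze a b c \<circ> ?C"]) (simp add: comp_def)
  ultimately show "winding_number (squeeze a b c \<circ> ?C) (squeeze a b c z) = 1"
    using winding_number_circlepath_centre[OF s, of z] by simp
qed

section \<open>The differential of a squeezing homeomorphism\<close>

lemma sgn_has_derivative:
  fixes z :: complex
  assumes "z \<noteq> 0"
  shows "(sgn has_derivative (\<lambda>v. (v - (sgn z \<bullet> v) *\<^sub>R sgn z) /\<^sub>R norm z)) (at z)"
proof -
  have "((\<lambda>z. z /\<^sub>R norm z) has_derivative (\<lambda>v. (v - (sgn z \<bullet> v) *\<^sub>R sgn z) /\<^sub>R norm z)) (at z)"
    using assms
    by (auto intro!: derivative_eq_intros has_derivative_norm simp: sgn_div_norm inner_commute scaleR_diff_right field_simps power2_eq_square)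
  then show ?thesis by (simp add: sgn_div_norm[abs_def])
qed

text \<open>The derivative at \<open>z\<close> in direction \<open>v\<close>: here \<open>w'\<close> is the derivative of \<open>w\<close>, and the term with
  \<open>ln\<close> comes from differentiating the exponent.\<close>

definition squeeze_deriv :: "real \<Rightarrow> real \<Rightarrow> real \<Rightarrow> complex \<Rightarrow> complex \<Rightarrow> complex" where
  "squeeze_deriv a b c z v =
    (let u = sgn z; w = mob b u; k = rate a c w;
         w' = (1 - of_real b ^ 2) * ((v - (u \<bullet> v) *\<^sub>R u) /\<^sub>R norm z) / (1 + of_real b * u)\<^sup>2
     in of_real (norm z powr k) * (of_real (- c * Re w' * ln (norm z) + (u \<bullet> v) * k / norm z) * w + w'))"

lemma squeeze_has_derivative:
  assumes z: "z \<noteq> 0" and b: "\<bar>b\<bar> < 1"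
  shows "(squeeze a b c has_derivative squeeze_deriv a b c z) (at z)"
proof -
  let ?u = "sgn z"
  let ?w = "mob b ?u"
  let ?u' = "\<lambda>v. (v - (?u \<bullet> v) *\<^sub>R ?u) /\<^sub>R norm z"
  let ?w' = "\<lambda>v. (1 - of_real b ^ 2) * ?u' v / (1 + of_real b * ?u)\<^sup>2"
  have d: "1 + of_real b * ?u \<noteq> 0" using b z by (intro mob_denominator_nonzero) (auto simp: norm_sgn)
  have "((\<lambda>u. (u + of_real b) / (1 + of_real b * u)) has_field_derivative
      (1 - of_real b ^ 2) / (1 + of_real b * ?u)\<^sup>2) (at ?u)"
    using d by (auto intro!: derivative_eq_intros simp: field_simps power2_eq_square)
  then have m: "(mob b has_derivative (*) ((1 - of_real b ^ 2) / (1 + of_real b * ?u)\<^sup>2)) (at ?u)"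
    by (simp only: mob_def[abs_def] has_field_derivative_def)
  have w: "((\<lambda>z. mob b (sgn z)) has_derivative ?w') (at z)"
    by (rule has_derivative_eq_rhs[OF has_derivative_compose[OF sgn_has_derivative[OF z] m]])
      (simp only: times_divide_eq_left)
  have r: "((\<lambda>z. rate a c (mob b (sgn z))) has_derivative (\<lambda>v. - c * Re (?w' v))) (at z)"
    unfolding rate_def using w by (auto intro!: derivative_eq_intros simp: algebra_simps)
  have n: "(norm has_derivative (\<lambda>v. ?u \<bullet> v)) (at z)"
    using has_derivative_norm[OF z] by (simp add: inner_commute)
  have p: "((\<lambda>z. norm z powr rate a c (mob b (sgn z))) has_derivative
      (\<lambda>v. (norm z powr rate a c ?w) * (- c * Re (?w' v) * ln (norm z) + (?u \<bullet> v) * rate a c ?w / norm z))) (at z)"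
    by (rule has_derivative_powr[OF n r]) (use z in auto)
  have "((\<lambda>z. of_real (norm z powr rate a c (mob b (sgn z))) * mob b (sgn z)) has_derivative
      (\<lambda>v. of_real (norm z powr rate a c ?w) * ?w' v +
        of_real ((norm z powr rate a c ?w) * (- c * Re (?w' v) * ln (norm z) + (?u \<bullet> v) * rate a c ?w / norm z)) * ?w)) (at z)"
    by (rule has_derivative_mult[OF has_derivative_of_real[OF p] w])
  moreover have "of_real x * w' + of_real (x * r) * w = of_real x * (of_real r * w + w')" for x r :: real and w w' :: complex
    by (simp add: algebra_simps)
  ultimately show ?thesis
    unfolding squeeze_def[abs_def] squeeze_deriv_def[abs_def] Let_def by (simp only:)
qed

lemma continuous_on_squeeze_deriv:
  assumes b: "\<bar>b\<bar> < 1"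
  shows "continuous_on \<A> (\<lambda>z. squeeze_deriv a b c z v)"
proof -
  note sg = continuous_on_sgn_annulus and m = continuous_on_mob_sgn[OF b]
  show ?thesis
    unfolding squeeze_deriv_def Let_def rate_def
    using annulus_nonzero[of _ 1] mob_denominator_annulus[OF b]
    by (intro continuous_intros m sg) auto
qed

lemma squeeze_has_weak_differential:
  assumes b: "\<bar>b\<bar> < 1"
  shows "has_weak_differential (squeeze a b c) (squeeze_deriv a b c) \<A>"
proof (rule C1_has_weak_differential[OF open_annulus])
  show "(squeeze a b c has_derivative squeeze_deriv a b c z) (at z)" if "z \<in> \<A>" for z
    using that b by (intro squeeze_has_derivative) (auto simp: annulus_def)
qed (rule continuous_on_squeeze_deriv[OF b])

text \<open>The Poisson kernel; it is the speed at which \<^const>\<open>mob\<close> turns the unit circle.\<close>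

definition poisson :: "real \<Rightarrow> complex \<Rightarrow> real" where
  "poisson b u = (1 - b\<^sup>2) / (norm (1 + of_real b * u))\<^sup>2"

text \<open>An upper bound for \<open>|Dh|\<close> at \<open>z = t u\<close>: the summand \<open>k\<close> is the radial derivative, and the other
  one bounds the tangential derivative, in which the variation of the exponent and of the direction are added.\<close>

definition energy_majorant :: "real \<Rightarrow> real \<Rightarrow> real \<Rightarrow> real \<Rightarrow> complex \<Rightarrow> real" where
  "energy_majorant a b c t u = (let w = mob b u; k = rate a c w in
     t powr k / t * (k + poisson b u * (c * \<bar>Im w\<bar> * \<bar>ln t\<bar> + 1)))"

text \<open>The Hilbert-Schmidt norm may be computed in any orthonormal basis; \<open>u\<close> and \<open>\<i> u\<close> will be the
  radial and the tangential direction.\<close>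

lemma hs_norm_rotated:
  fixes L :: "complex \<Rightarrow> complex"
  assumes "linear L" "norm u = 1"
  shows "hs_norm L \<le> norm (L u) + norm (L (\<i> * u))"
proof -
  have L: "L (x *\<^sub>R 1 + y *\<^sub>R \<i>) = x *\<^sub>R L 1 + y *\<^sub>R L \<i>" for x y
    by (simp add: linear_add[OF assms(1)] linear_scale[OF assms(1)])
  have u: "u = Re u *\<^sub>R 1 + Im u *\<^sub>R \<i>" "\<i> * u = (- Im u) *\<^sub>R 1 + Re u *\<^sub>R \<i>"
    by (simp_all add: complex_eq_iff)
  have 1: "(Re u)\<^sup>2 + (Im u)\<^sup>2 = 1" using assms(2) by (simp add: cmod_def)
  have "(norm (L u))\<^sup>2 + (norm (L (\<i> * u)))\<^sup>2 = ((Re u)\<^sup>2 + (Im u)\<^sup>2) * ((norm (L 1))\<^sup>2 + (norm (L \<i>))\<^sup>2)"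
    unfolding u(2) by (subst u(1), unfold L power2_norm_eq_inner)
      (simp add: inner_add_left inner_add_right inner_commute power2_eq_square algebra_simps)
  then have "hs_norm L = sqrt ((norm (L u))\<^sup>2 + (norm (L (\<i> * u)))\<^sup>2)"
    by (simp add: hs_norm_complex[OF assms(1)] 1)
  also have "\<dots> \<le> norm (L u) + norm (L (\<i> * u))"
    by (rule sqrt_sum_squares_le_sum) auto
  finally show ?thesis .
qed

text \<open>Differentiating along the circle turns the unit vector \<open>w\<close>: the derivative is \<open>\<i> w\<close> times a positive speed.\<close>

lemma mob_tangent:
  assumes "\<bar>b\<bar> < 1" "norm u = 1"
  shows "(1 - of_real b ^ 2) * (\<i> * u) / (1 + of_real b * u)\<^sup>2 = of_real (poisson b u) * (\<i> * mob b u)"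
proof -
  let ?d = "1 + of_real b * u"
  have d: "?d \<noteq> 0" using assms by (intro mob_denominator_nonzero) auto
  have n: "of_real ((norm ?d)\<^sup>2) = ?d * cnj ?d" using complex_norm_square[of ?d] by simp
  have "of_real (poisson b u) * (\<i> * mob b u) = (1 - of_real b ^ 2) / (?d * cnj ?d) * (\<i> * (u * cnj ?d / ?d))"
    using n by (simp add: poisson_def mob_def mob_numerator[OF assms(2)])
  also have "\<dots> = (1 - of_real b ^ 2) * (\<i> * u) / ?d\<^sup>2"
  proof -
    have "x / (d * e) * (\<i> * (u * e / d)) = x * (\<i> * u) / d\<^sup>2" if "d \<noteq> 0" "e \<noteq> 0" for x d e :: complex
      using that by (simp add: power2_eq_square)
    then show ?thesis using d by (simp only: complex_cnj_zero_iff not_False_eq_True)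
  qed
  finally show ?thesis by simp
qed

lemma hs_norm_squeeze_deriv_le:
  assumes z: "z \<in> \<A>" and p: "a > 0" "\<bar>b\<bar> < 1" "c \<ge> 0"
  shows "hs_norm (squeeze_deriv a b c z) \<le> energy_majorant a b c (norm z) (sgn z)"
proof -
  let ?u = "sgn z" and ?t = "norm z"
  let ?w = "mob b ?u"
  let ?k = "rate a c ?w"
  have nz: "z \<noteq> 0" "?t > 0" using z by (auto simp: annulus_def)
  have u: "norm ?u = 1" using nz by (simp add: norm_sgn)
  have w: "norm ?w = 1" by (rule norm_mob[OF p(2) u])
  have k: "?k > 0" using rate_ge(1)[OF p(3) w, of a] p(1) by linarith
  have uu: "?u \<bullet> ?u = 1" using u by (simp add: norm_eq_1)
  have ui: "?u \<bullet> (\<i> * ?u) = 0" by (simp add: inner_complex_def)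
  have P: "poisson b ?u \<ge> 0" using p(2) by (simp add: poisson_def abs_square_le_1)
  have lin: "linear (squeeze_deriv a b c z)"
    using squeeze_has_derivative[OF nz(1) p(2)] by (rule has_derivative_linear)
  have "squeeze_deriv a b c z ?u = of_real (?t powr ?k / ?t * ?k) * ?w"
    by (simp add: squeeze_deriv_def Let_def uu)
  then have "norm (squeeze_deriv a b c z ?u) = ?t powr ?k / ?t * ?k"
    using k nz by (simp only: norm_mult w norm_of_real) simp
  moreover have "norm (squeeze_deriv a b c z (\<i> * ?u)) \<le> ?t powr ?k / ?t * (poisson b ?u * (c * \<bar>Im ?w\<bar> * \<bar>ln ?t\<bar> + 1))"
  proof -
    let ?w' = "of_real (poisson b ?u / ?t) * (\<i> * ?w)"
    have "squeeze_deriv a b c z (\<i> * ?u) = of_real (?t powr ?k) * (of_real (- c * Re ?w' * ln ?t) * ?w + ?w')"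
    proof -
      have "(1 - of_real b ^ 2) * ((\<i> * ?u - (?u \<bullet> (\<i> * ?u)) *\<^sub>R ?u) /\<^sub>R ?t) / (1 + of_real b * ?u)\<^sup>2
          = ((1 - of_real b ^ 2) * (\<i> * ?u) / (1 + of_real b * ?u)\<^sup>2) /\<^sub>R ?t"
        unfolding ui by (simp add: scaleR_conv_of_real divide_inverse mult_ac)
      also have "\<dots> = ?w'"
        unfolding mob_tangent[OF p(2) u] by (simp add: scaleR_conv_of_real divide_inverse)
      finally have e: "(1 - of_real b ^ 2) * ((\<i> * ?u - (?u \<bullet> (\<i> * ?u)) *\<^sub>R ?u) /\<^sub>R ?t) / (1 + of_real b * ?u)\<^sup>2 = ?w'" .
      show ?thesis unfolding squeeze_deriv_def Let_def e
        by (simp only: ui mult_zero_left div_0 add_0_right)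
    qed
    then have "norm (squeeze_deriv a b c z (\<i> * ?u)) \<le> ?t powr ?k * (norm (of_real (- c * Re ?w' * ln ?t) * ?w) + norm ?w')"
      by (simp add: norm_mult norm_triangle_ineq mult_left_mono)
    also have "norm (of_real (- c * Re ?w' * ln ?t) * ?w) = c * (poisson b ?u / ?t * \<bar>Im ?w\<bar>) * \<bar>ln ?t\<bar>"
    proof -
      have "Re ?w' = - (poisson b ?u / ?t * Im ?w)" by simp
      then have "- c * Re ?w' * ln ?t = c * (poisson b ?u / ?t * Im ?w) * ln ?t" by simp
      moreover have "\<bar>c * (poisson b ?u / ?t * Im ?w) * ln ?t\<bar> = c * (poisson b ?u / ?t * \<bar>Im ?w\<bar>) * \<bar>ln ?t\<bar>"
        using P nz p(3) by (simp add: abs_mult)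
      ultimately show ?thesis by (simp only: norm_mult norm_of_real w mult_1_right)
    qed
    also have "norm ?w' = poisson b ?u / ?t"
      using P nz by (simp only: norm_mult norm_of_real norm_ii w) simp
    finally show ?thesis by (simp add: algebra_simps)
  qed
  ultimately show ?thesis
    using hs_norm_rotated[OF lin u] unfolding energy_majorant_def Let_def by (simp add: algebra_simps)
qed

section \<open>Radial and angular integrals\<close>

text \<open>The primitive \<open>t powr (k+1) * (1 / (k+1)\<^sup>2 - ln t / (k+1))\<close> extends continuously to \<open>0\<close>.\<close>

lemma minus_powr_times_ln_has_integral:
  assumes k: "k > (0::real)"
  shows "((\<lambda>t. t powr k * (- ln t)) has_integral 1 / (k + 1)\<^sup>2) {0..1}"
proof -
  define F where "F t = t powr (k + 1) * (1 / (k + 1)\<^sup>2 - ln t / (k + 1))" for t :: real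
  have "((\<lambda>t. t powr k * (- ln t)) has_integral (F 1 - F 0)) {0..1}"
  proof (rule fundamental_theorem_of_calculus_interior)
    fix t :: real assume "t \<in> {0<..<1}"
    then have t: "t > 0" by simp
    have "(F has_real_derivative (t powr k * (- ln t))) (at t)"
    proof -
      have 1: "((\<lambda>t. t powr (k + 1)) has_real_derivative (k + 1) * t powr k) (at t)"
        using has_real_derivative_powr[OF t, of "k + 1"] by simp
      have 2: "((\<lambda>t. 1 / (k + 1)\<^sup>2 - ln t / (k + 1)) has_real_derivative - (1 / t / (k + 1))) (at t)"
        using t k by (auto intro!: derivative_eq_intros)
      have "(k + 1) * t powr k * (1 / (k + 1)\<^sup>2 - ln t / (k + 1)) + - (1 / t / (k + 1)) * t powr (k + 1) = t powr k * (- ln t)"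
      proof -
        have "m * X * (1 / m\<^sup>2 - l / m) + - (1 / t / m) * (X * t) = X * (- l)" if "m \<noteq> 0" for m X l :: real
          using t that by (simp add: field_simps power2_eq_square)
        moreover have "k + 1 \<noteq> 0" "t powr (k + 1) = t powr k * t" using t k by (auto simp: powr_add)
        ultimately show ?thesis by (simp only:)
      qed
      then show ?thesis
        using DERIV_mult[OF 1 2] unfolding F_def[abs_def] by (simp only:)
    qed
    then show "(F has_vector_derivative (t powr k * (- ln t))) (at t)"
      by (simp add: has_real_derivative_iff_has_vector_derivative)
  next
    have "isCont F t" if "t > 0" for t
      unfolding F_def using that k by (intro continuous_intros) auto
    moreover have "(F \<longlongrightarrow> F 0) (at_right 0)"
    proof -
      have bound: "norm (F t) \<le> t powr (k + 1) / (k + 1)\<^sup>2 + t powr k / (k + 1)" if t: "t \<in> {0<..<1}" for t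
      proof -
        have "ln (1 / t) \<le> 1 / t - 1" using t by (intro ln_le_minus_one) auto
        then have l: "- ln t \<le> 1 / t" "- ln t \<ge> 0" using t by (auto simp: ln_div)
        have "t powr (k + 1) * (- ln t / (k + 1)) \<le> t powr (k + 1) * (1 / t / (k + 1))"
          using l k t by (intro mult_left_mono divide_right_mono) auto
        also have "\<dots> = t powr k / (k + 1)" using t by (simp add: powr_add)
        finally have "F t \<le> t powr (k + 1) / (k + 1)\<^sup>2 + t powr k / (k + 1)"
          by (simp add: F_def algebra_simps)
        moreover have "F t \<ge> 0"
        proof -
          have "0 \<le> - ln t / (k + 1)" by (rule divide_nonneg_pos) (use l(2) k in linarith)+
          moreover have "0 \<le> 1 / (k + 1)\<^sup>2" by simp
          ultimately have "0 \<le> 1 / (k + 1)\<^sup>2 - ln t / (k + 1)"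
            unfolding minus_divide_left[symmetric] by linarith
          then show ?thesis unfolding F_def by (intro mult_nonneg_nonneg) auto
        qed
        ultimately show ?thesis by simp
      qed
      have lim: "((\<lambda>t::real. t powr (k + 1) / (k + 1)\<^sup>2 + t powr k / (k + 1)) \<longlongrightarrow> 0 powr (k + 1) / (k + 1)\<^sup>2 + 0 powr k / (k + 1)) (at_right 0)"
        using k by (intro tendsto_intros tendsto_powr2) (auto simp: eventually_at_filter)
      have "(F \<longlongrightarrow> 0) (at_right 0)"
      proof (rule Lim_null_comparison)
        show "\<forall>\<^sub>F t in at_right 0. norm (F t) \<le> t powr (k + 1) / (k + 1)\<^sup>2 + t powr k / (k + 1)"
          using bound by (auto simp: eventually_at_right_field intro!: exI[of _ 1])
      qed (use lim k in simp)
      then show ?thesis by (simp add: F_def)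
    qed
    ultimately show "continuous_on {0..1} F"
      by (intro continuous_on_IccI) (auto simp: isCont_def intro: tendsto_within_subset[of F _ _ UNIV])
  qed simp
  then show ?thesis by (simp add: F_def)
qed

text \<open>The result of integrating \<^const>\<open>energy_majorant\<close> against \<open>t dt\<close> over the unit interval.\<close>

definition angular_density :: "real \<Rightarrow> real \<Rightarrow> real \<Rightarrow> complex \<Rightarrow> real" where
  "angular_density a b c u = (let w = mob b u; k = rate a c w in
     k / (k + 1) + poisson b u * c * \<bar>Im w\<bar> / (k + 1)\<^sup>2 + poisson b u / (k + 1))"

lemma radial_integral_energy_majorant:
  assumes p: "a > 0" "\<bar>b\<bar> < 1" "c \<ge> 0" and u: "norm u = 1"
  shows "(\<integral>\<^sup>+t. ennreal (energy_majorant a b c t u) * ennreal t * indicator {0<..<1} t \<partial>lborel) =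
    ennreal (angular_density a b c u)"
proof -
  let ?w = "mob b u"
  let ?k = "rate a c ?w"
  let ?P = "poisson b u"
  have w: "norm ?w = 1" by (rule norm_mob[OF p(2) u])
  have k: "?k > 0" using rate_ge(1)[OF p(3) w, of a] p(1) by linarith
  have P: "?P \<ge> 0" using p(2) by (simp add: poisson_def abs_square_le_1)
  let ?f = "\<lambda>t. (?k + ?P) * t powr ?k + (?P * c * \<bar>Im ?w\<bar>) * (t powr ?k * (- ln t))"
  have "((\<lambda>t. t powr ?k) has_integral (1 powr (?k + 1) / (?k + 1))) {0..1}"
    using k by (intro has_integral_powr_from_0) auto
  then have I: "((\<lambda>t. t powr ?k) has_integral (1 / (?k + 1))) {0..1}" by simp
  have "(?f has_integral ((?k + ?P) * (1 / (?k + 1)) + (?P * c * \<bar>Im ?w\<bar>) * (1 / (?k + 1)\<^sup>2))) {0..1}"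
    by (intro has_integral_add has_integral_mult_right I minus_powr_times_ln_has_integral k)
  moreover have "(?k + ?P) * (1 / (?k + 1)) + (?P * c * \<bar>Im ?w\<bar>) * (1 / (?k + 1)\<^sup>2) = angular_density a b c u"
    by (simp add: angular_density_def Let_def add_divide_distrib)
  ultimately have "(?f has_integral angular_density a b c u) {0..1}" by simp
  then have "(?f has_integral angular_density a b c u) {0<..<1}"
    by (simp add: has_integral_Icc_iff_Ioo)
  then have "(\<integral>\<^sup>+t. ennreal (?f t) * indicator {0<..<1} t \<partial>lborel) = ennreal (angular_density a b c u)"
    by (rule nn_integral_has_integral_lebesgue'[rotated])
      (use k P p(3) in \<open>intro add_nonneg_nonneg mult_nonneg_nonneg; simp\<close>)
  moreover have "ennreal (energy_majorant a b c t u) * ennreal t * indicator {0<..<1} t = ennreal (?f t) * indicator {0<..<1} t" for t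
  proof (cases "t \<in> {0<..<1}")
    case True
    have "x / t * y * t = x * y" for x y using True by simp
    then have "energy_majorant a b c t u * t = t powr ?k * (?k + ?P * (c * \<bar>Im ?w\<bar> * \<bar>ln t\<bar> + 1))"
      unfolding energy_majorant_def Let_def by blast
    also have "\<dots> = ?f t"
      using True by (simp add: algebra_simps)
    finally have "energy_majorant a b c t u * t = ?f t" .
    moreover have "energy_majorant a b c t u \<ge> 0"
      using True k P p(3) unfolding energy_majorant_def Let_def
      by (intro mult_nonneg_nonneg add_nonneg_nonneg divide_nonneg_nonneg) auto
    ultimately show ?thesis using True by (simp add: ennreal_mult[symmetric])
  qed simp
  ultimately show ?thesis by simp
qed

lemma mob_cis:
  assumes "\<bar>b\<bar> < 1"
  shows "(norm (1 + of_real b * cis \<theta>))\<^sup>2 = 1 + b\<^sup>2 + 2 * b * cos \<theta>"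
    and "1 - Re (mob b (cis \<theta>)) = (1 - b)\<^sup>2 * (1 - cos \<theta>) / (1 + b\<^sup>2 + 2 * b * cos \<theta>)"
    and "Im (mob b (cis \<theta>)) = (1 - b\<^sup>2) * sin \<theta> / (1 + b\<^sup>2 + 2 * b * cos \<theta>)"
    and "0 < 1 + b\<^sup>2 + 2 * b * cos \<theta>"
proof -
  let ?d = "1 + of_real b * cis \<theta>" and ?N = "1 + b\<^sup>2 + 2 * b * cos \<theta>"
  have sc: "sin \<theta> * sin \<theta> = 1 - cos \<theta> * cos \<theta>"
    using sin_cos_squared_add[of \<theta>] by (simp add: power2_eq_square)
  have N: "(norm ?d)\<^sup>2 = ?N"
  proof -
    have "(norm ?d)\<^sup>2 = (1 + b * cos \<theta>) * (1 + b * cos \<theta>) + b * b * (sin \<theta> * sin \<theta>)"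
      unfolding cmod_power2 by (simp add: power2_eq_square)
    then show ?thesis unfolding sc by (simp add: power2_eq_square algebra_simps)
  qed
  then show "(norm ?d)\<^sup>2 = ?N" .
  have "?d \<noteq> 0" using assms by (intro mob_denominator_nonzero) auto
  then show Npos: "0 < ?N" using N by (metis zero_less_norm_iff zero_less_power)
  have "of_real ?N = ?d * cnj ?d" using complex_norm_square[of ?d] N by simp
  then have m: "mob b (cis \<theta>) = (cis \<theta> + of_real b) * cnj ?d / of_real ?N"
    using \<open>?d \<noteq> 0\<close> by (simp add: mob_def del: complex_cnj_add)
  have "Re (mob b (cis \<theta>)) = ((cos \<theta> + b) * (1 + b * cos \<theta>) + sin \<theta> * (b * sin \<theta>)) / ?N"
    unfolding m by (simp only: Re_divide_of_real) simp
  then have "Re (mob b (cis \<theta>)) = (cos \<theta> * (1 + b\<^sup>2) + 2 * b) / ?N"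
  proof -
    have "(cos \<theta> + b) * (1 + b * cos \<theta>) + sin \<theta> * (b * sin \<theta>) = (cos \<theta> + b) * (1 + b * cos \<theta>) + b * (sin \<theta> * sin \<theta>)"
      by simp
    also have "\<dots> = cos \<theta> * (1 + b\<^sup>2) + 2 * b"
      unfolding sc by (simp add: power2_eq_square algebra_simps)
    finally show "Re (mob b (cis \<theta>)) = ((cos \<theta> + b) * (1 + b * cos \<theta>) + sin \<theta> * (b * sin \<theta>)) / ?N \<Longrightarrow> ?thesis"
      by simp
  qed
  then show "1 - Re (mob b (cis \<theta>)) = (1 - b)\<^sup>2 * (1 - cos \<theta>) / ?N"
    using Npos by (simp add: field_simps power2_eq_square)
  have "Im (mob b (cis \<theta>)) = (sin \<theta> * (1 + b * cos \<theta>) - (cos \<theta> + b) * (b * sin \<theta>)) / ?N"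
    unfolding m by (simp only: Im_divide_of_real) simp
  then show "Im (mob b (cis \<theta>)) = (1 - b\<^sup>2) * sin \<theta> / ?N"
    by (simp add: algebra_simps power2_eq_square)
qed


text \<open>The function is a version of \<open>arctan (m * tan \<phi>)\<close> without the jumps at odd multiples of \<open>\<pi>/2\<close>: by the
  addition theorem \<open>arctan (m * tan \<phi>) = \<phi> - arctan ((1 - m) tan \<phi> / (1 + m (tan \<phi>)\<^sup>2))\<close> on
  the principal interval, and the right-hand side extends smoothly to the real line.\<close>

lemma arctan_scaled_tan_primitive:
  assumes m: "m > (0::real)"
  shows "((\<lambda>\<phi>. \<phi> - arctan ((1 - m) * (sin \<phi> * cos \<phi>) / ((cos \<phi>)\<^sup>2 + m * (sin \<phi>)\<^sup>2))) has_real_derivative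
    m / ((cos \<phi>)\<^sup>2 + m\<^sup>2 * (sin \<phi>)\<^sup>2)) (at \<phi>)"
proof -
  let ?s = "sin \<phi>" and ?c = "cos \<phi>"
  let ?D = "?c\<^sup>2 + m * ?s\<^sup>2" and ?E = "?c\<^sup>2 + m\<^sup>2 * ?s\<^sup>2"
  let ?g = "(1 - m) * (?s * ?c) / ?D"
  let ?n = "(1 - m) * (?c\<^sup>2 - m * ?s\<^sup>2)"
  have s2: "?s\<^sup>2 = 1 - ?c\<^sup>2" by (rule sin_squared_eq)
  have pos: "x * ?s\<^sup>2 + ?c\<^sup>2 > 0" if "x > 0" for x
    using that sin_cos_squared_add[of \<phi>] by (cases "?c = 0") (auto intro: add_nonneg_pos)
  have D: "?D > 0" using pos[OF m] by (simp add: add.commute)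
  have E: "?E > 0" using pos[of "m\<^sup>2"] m by (simp add: add.commute)
  have sc: "((\<lambda>\<phi>. (1 - m) * (sin \<phi> * cos \<phi>)) has_real_derivative (1 - m) * (?c\<^sup>2 - ?s\<^sup>2)) (at \<phi>)"
    by (auto intro!: derivative_eq_intros simp: power2_eq_square)
  have dd: "((\<lambda>\<phi>. (cos \<phi>)\<^sup>2 + m * (sin \<phi>)\<^sup>2) has_real_derivative 2 * (m - 1) * (?s * ?c)) (at \<phi>)"
    by (auto intro!: derivative_eq_intros simp: algebra_simps)
  have num: "(1 - m) * (?c\<^sup>2 - ?s\<^sup>2) * ?D - (1 - m) * (?s * ?c) * (2 * (m - 1) * (?s * ?c)) = ?n"
  proof -
    have "(1 - m) * (?s * ?c) * (2 * (m - 1) * (?s * ?c)) = (1 - m) * (2 * (m - 1)) * (?s\<^sup>2 * ?c\<^sup>2)"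
      by (simp add: power2_eq_square)
    then show ?thesis unfolding s2 by (simp add: power2_eq_square algebra_simps)
  qed
  have g: "((\<lambda>\<phi>. (1 - m) * (sin \<phi> * cos \<phi>) / ((cos \<phi>)\<^sup>2 + m * (sin \<phi>)\<^sup>2)) has_real_derivative ?n / (?D * ?D)) (at \<phi>)"
    using DERIV_divide[OF sc dd] D unfolding num by simp
  have g2: "1 + ?g\<^sup>2 = ?E / (?D * ?D)"
  proof -
    have "?D * ?D + ((1 - m) * (?s * ?c))\<^sup>2 = ?E"
      unfolding power_mult_distrib s2 by (simp add: power2_eq_square algebra_simps)
    then show ?thesis using D by (simp add: power_divide power2_eq_square add_divide_distrib[symmetric] divide_simps)
  qed
  have "((\<lambda>\<phi>. \<phi> - arctan ((1 - m) * (sin \<phi> * cos \<phi>) / ((cos \<phi>)\<^sup>2 + m * (sin \<phi>)\<^sup>2))) has_real_derivative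
      1 - inverse (1 + ?g\<^sup>2) * (?n / (?D * ?D))) (at \<phi>)"
    by (intro DERIV_diff DERIV_ident DERIV_chain2[OF DERIV_arctan g])
  moreover have "1 - inverse (1 + ?g\<^sup>2) * (?n / (?D * ?D)) = m / ?E"
  proof -
    have e1: "inverse (1 + ?g\<^sup>2) * (?n / (?D * ?D)) = ?n / ?E"
      unfolding g2 using D by simp
    have e2: "?E - ?n = m" unfolding s2 by (simp add: power2_eq_square algebra_simps)
    have "1 - ?n / ?E = (?E - ?n) / ?E" using E by (subst diff_divide_distrib) simp
    then show ?thesis unfolding e1 e2 .
  qed
  ultimately show ?thesis by simp
qed

text \<open>Substituting \<open>w = cis \<phi>\<close> would give the classical integral of \<open>1 / (A + C (1 - cos \<phi>))\<close>. Its primitive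
  is an arctangent of a multiple of \<open>tan (\<phi>/2)\<close>, and on half angles the Moebius transformation is
  multiplication of the tangent by \<open>q = (1 - b) / (1 + b)\<close>.\<close>

lemma poisson_quotient_has_integral:
  assumes b: "\<bar>b\<bar> < 1" and A: "A > 0" and C: "C \<ge> 0"
  shows "((\<lambda>\<theta>. poisson b (cis \<theta>) / (A + C * (1 - Re (mob b (cis \<theta>))))) has_integral 2 * pi / sqrt (A * (A + 2 * C))) {-pi..pi}"
proof -
  define q where "q = (1 - b) / (1 + b)"
  define m where "m = q * sqrt ((A + 2 * C) / A)"
  define S where "S = sqrt (A * (A + 2 * C))"
  have b': "1 - b > 0" "1 + b > 0" using b by auto
  have q: "q > 0" using b' by (simp add: q_def)
  have X: "A + 2 * C > 0" using A C by simp
  have m: "m > 0" using q A X by (simp add: m_def)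
  have S: "S > 0" using A X by (simp add: S_def)
  have mS: "m / S = q / A"
  proof -
    have "sqrt ((A + 2 * C) / A) / S = 1 / (sqrt A * sqrt A)"
      using A X by (simp add: S_def real_sqrt_divide real_sqrt_mult)
    then have "q * (sqrt ((A + 2 * C) / A) / S) = q / A" using A by simp
    then show ?thesis by (simp add: m_def)
  qed
  have m2: "m\<^sup>2 = q\<^sup>2 * ((A + 2 * C) / A)"
    using A X by (simp add: m_def power_mult_distrib)
  let ?G = "\<lambda>\<phi>. \<phi> - arctan ((1 - m) * (sin \<phi> * cos \<phi>) / ((cos \<phi>)\<^sup>2 + m * (sin \<phi>)\<^sup>2))"
  let ?f = "\<lambda>\<theta>. poisson b (cis \<theta>) / (A + C * (1 - Re (mob b (cis \<theta>))))"
  have f: "?f \<theta> = 2 / S * (m / ((cos (\<theta> / 2))\<^sup>2 + m\<^sup>2 * (sin (\<theta> / 2))\<^sup>2) * (1 / 2))" for \<theta>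
  proof -
    let ?x = "(cos (\<theta> / 2))\<^sup>2" and ?y = "(sin (\<theta> / 2))\<^sup>2" and ?N = "1 + b\<^sup>2 + 2 * b * cos \<theta>"
    have xy: "?y = 1 - ?x" by (rule sin_squared_eq)
    have c: "cos \<theta> = 2 * ?x - 1" using cos_double_cos[of "\<theta> / 2"] by simp
    have N: "?N > 0" by (rule mob_cis(4)[OF b])
    have pos: "A * (1 + b)\<^sup>2 * ?x + (A + 2 * C) * (1 - b)\<^sup>2 * ?y > 0"
    proof (cases "?x = 0")
      case True
      then show ?thesis using xy X b' by simp
    next
      case False
      then have "?x > 0" by simp
      then have "A * (1 + b)\<^sup>2 * ?x > 0" using A b' by (intro mult_pos_pos) auto
      moreover have "(A + 2 * C) * (1 - b)\<^sup>2 * ?y \<ge> 0" using X by simp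
      ultimately show ?thesis by linarith
    qed
    have den: "A * ?N + C * ((1 - b)\<^sup>2 * (1 - cos \<theta>)) = A * (1 + b)\<^sup>2 * ?x + (A + 2 * C) * (1 - b)\<^sup>2 * ?y"
      unfolding xy c by (simp add: power2_eq_square algebra_simps)
    have "?f \<theta> = ((1 - b\<^sup>2) / ?N) / (A + C * ((1 - b)\<^sup>2 * (1 - cos \<theta>) / ?N))"
      by (simp only: poisson_def mob_cis[OF b])
    also have "A + C * ((1 - b)\<^sup>2 * (1 - cos \<theta>) / ?N) = (A * ?N + C * ((1 - b)\<^sup>2 * (1 - cos \<theta>))) / ?N"
      using N by (simp add: add_divide_distrib)
    also have "((1 - b\<^sup>2) / ?N) / ((A * ?N + C * ((1 - b)\<^sup>2 * (1 - cos \<theta>))) / ?N) = (1 - b\<^sup>2) / (A * (1 + b)\<^sup>2 * ?x + (A + 2 * C) * (1 - b)\<^sup>2 * ?y)"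
      unfolding den using N by simp
    also have "A * (1 + b)\<^sup>2 * ?x + (A + 2 * C) * (1 - b)\<^sup>2 * ?y = (1 + b)\<^sup>2 * (A * (?x + m\<^sup>2 * ?y))"
    proof -
      have "(1 + b)\<^sup>2 * (A * m\<^sup>2) = (A + 2 * C) * (1 - b)\<^sup>2"
        using A b' unfolding m2 q_def by (simp add: power_divide)
      moreover have "(1 + b)\<^sup>2 * (A * (x + m\<^sup>2 * y)) = A * (1 + b)\<^sup>2 * x + ((1 + b)\<^sup>2 * (A * m\<^sup>2)) * y" for x y
        by (simp add: algebra_simps)
      ultimately show ?thesis by (simp only:)
    qed
    also have "(1 - b\<^sup>2) / ((1 + b)\<^sup>2 * (A * (?x + m\<^sup>2 * ?y))) = (q / A) / (?x + m\<^sup>2 * ?y)"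
    proof -
      have "1 - b\<^sup>2 = q * (1 + b)\<^sup>2" using b' by (simp add: q_def power2_eq_square field_simps)
      then show ?thesis using b' by simp
    qed
    also have "\<dots> = 2 / S * (m / (?x + m\<^sup>2 * ?y) * (1 / 2))"
    proof -
      have "m / S / E = 2 / S * (m / E * (1 / 2))" for E by simp
      then show ?thesis unfolding mS[symmetric] .
    qed
    finally show ?thesis .
  qed
  have "(?f has_integral (2 / S * ?G (pi / 2) - 2 / S * ?G (- pi / 2))) {-pi..pi}"
  proof (rule fundamental_theorem_of_calculus)
    fix \<theta> :: real
    have "((\<lambda>\<theta>. 2 / S * ?G (\<theta> / 2)) has_real_derivative ?f \<theta>) (at \<theta>)"
      unfolding f by (intro DERIV_cmult DERIV_chain2[OF arctan_scaled_tan_primitive[OF m]])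
        (auto intro!: derivative_eq_intros)
    then show "((\<lambda>\<theta>. 2 / S * ?G (\<theta> / 2)) has_vector_derivative ?f \<theta>) (at \<theta> within {-pi..pi})"
      by (simp add: has_real_derivative_iff_has_vector_derivative has_vector_derivative_at_within)
  qed simp
  moreover have "2 / S * ?G (pi / 2) - 2 / S * ?G (- pi / 2) = 2 * pi / S"
    by (simp add: field_simps)
  ultimately show ?thesis by (simp add: S_def)
qed

text \<open>The integrand is the absolute value of the derivative of \<open>1 / (K + 1)\<close>. The exponent \<open>K\<close> decreases from
  \<open>a + 2 c\<close> to \<open>a\<close> on the lower half circle and increases back on the upper one, so the total variation is twice
  the difference of the extreme values.\<close>

lemma rate_variation_has_integral:
  assumes b: "\<bar>b\<bar> < 1" and a: "a > 0" and c: "c \<ge> 0"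
  defines "K \<equiv> \<lambda>\<theta>. rate a c (mob b (cis \<theta>))"
  shows "((\<lambda>\<theta>. poisson b (cis \<theta>) * c * \<bar>Im (mob b (cis \<theta>))\<bar> / (K \<theta> + 1)\<^sup>2) has_integral
    2 * (1 / (1 + a) - 1 / (1 + a + 2 * c))) {-pi..pi}"
proof -
  let ?V = "\<lambda>\<theta>. poisson b (cis \<theta>) * c * \<bar>Im (mob b (cis \<theta>))\<bar> / (K \<theta> + 1)\<^sup>2"
  let ?N = "\<lambda>\<theta>. 1 + b\<^sup>2 + 2 * b * cos \<theta>"
  let ?J = "\<lambda>\<theta>. poisson b (cis \<theta>) * c * Im (mob b (cis \<theta>)) / (K \<theta> + 1)\<^sup>2"
  have b': "1 - b > 0" "1 + b > 0" "1 - b\<^sup>2 > 0" using b by (auto simp: abs_square_less_1)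
  have N: "?N \<theta> > 0" for \<theta> by (rule mob_cis(4)[OF b])
  have K: "K \<theta> = a + c * ((1 - b)\<^sup>2 * (1 - cos \<theta>) / ?N \<theta>)" for \<theta>
    unfolding K_def rate_def mob_cis(2)[OF b] ..
  have K1: "K \<theta> + 1 > 0" for \<theta>
    unfolding K_def using rate_ge(1)[OF c norm_mob[OF b], of "cis \<theta>" a] a by simp
  have dK: "(K has_real_derivative poisson b (cis \<theta>) * c * Im (mob b (cis \<theta>))) (at \<theta>)" for \<theta>
  proof -
    have "((\<lambda>\<theta>. a + c * ((1 - b)\<^sup>2 * (1 - cos \<theta>) / ?N \<theta>)) has_real_derivative
        c * (((1 - b)\<^sup>2 * sin \<theta> * ?N \<theta> - (1 - b)\<^sup>2 * (1 - cos \<theta>) * (- 2 * b * sin \<theta>)) / (?N \<theta> * ?N \<theta>))) (at \<theta>)"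
      using N[of \<theta>] by (auto intro!: derivative_eq_intros) (simp add: algebra_simps)
    moreover have "(1 - b)\<^sup>2 * sin \<theta> * ?N \<theta> - (1 - b)\<^sup>2 * (1 - cos \<theta>) * (- 2 * b * sin \<theta>) = (1 - b\<^sup>2) * ((1 - b\<^sup>2) * sin \<theta>)"
      by (simp add: power2_eq_square algebra_simps)
    ultimately show ?thesis
      unfolding K poisson_def mob_cis[OF b] by (simp add: K[abs_def] mult_ac)
  qed
  have dinv: "((\<lambda>\<theta>. - (1 / (K \<theta> + 1))) has_real_derivative ?J \<theta>) (at \<theta>)" for \<theta>
    using K1[of \<theta>] by (auto intro!: derivative_eq_intros dK simp: power2_eq_square)
  have P: "poisson b u \<ge> 0" for u using b' by (simp add: poisson_def)
  have vals: "K 0 = a" "K pi = a + 2 * c" "K (- pi) = a + 2 * c"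
  proof -
    have "1 + b\<^sup>2 - 2 * b = (1 - b)\<^sup>2" by (simp add: power2_eq_square algebra_simps)
    then show "K 0 = a" "K pi = a + 2 * c" "K (- pi) = a + 2 * c" using b' by (simp_all add: K)
  qed
  have "(?J has_integral (- (1 / (K pi + 1)) - - (1 / (K 0 + 1)))) {0..pi}"
    by (rule fundamental_theorem_of_calculus)
      (use dinv in \<open>auto simp: has_real_derivative_iff_has_vector_derivative has_vector_derivative_at_within\<close>)
  then have "(?V has_integral
      (- (1 / (K pi + 1)) - - (1 / (K 0 + 1)))) {0..pi}"
    by (rule has_integral_eq[rotated])
      (use N b' in \<open>auto simp: mob_cis[OF b] sin_ge_zero abs_of_nonneg less_imp_le\<close>)
  moreover have "((\<lambda>\<theta>. - ?J \<theta>) has_integral - (- (1 / (K 0 + 1)) - - (1 / (K (- pi) + 1)))) {-pi..0}"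
    by (intro has_integral_neg fundamental_theorem_of_calculus)
      (use dinv in \<open>auto simp: has_real_derivative_iff_has_vector_derivative has_vector_derivative_at_within\<close>)
  then have "(?V has_integral
      - (- (1 / (K 0 + 1)) - - (1 / (K (- pi) + 1)))) {-pi..0}"
  proof (rule has_integral_eq[rotated])
    fix \<theta> assume "\<theta> \<in> {-pi..0}"
    then have "sin \<theta> \<le> 0" using sin_ge_zero[of "- \<theta>"] by simp
    then have "Im (mob b (cis \<theta>)) \<le> 0"
      unfolding mob_cis(3)[OF b] using N[of \<theta>] b' by (intro divide_nonpos_pos mult_nonneg_nonpos) auto
    then show "- ?J \<theta> = ?V \<theta>" by simp
  qed
  ultimately have "(?V has_integral
      (- (- (1 / (K 0 + 1)) - - (1 / (K (- pi) + 1))) + (- (1 / (K pi + 1)) - - (1 / (K 0 + 1))))) {-pi..pi}"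
    by (intro has_integral_combine[of "-pi" 0 pi]) auto
  then show ?thesis unfolding vals by (simp add: add_ac)
qed

section \<open>Comparison of the infima\<close>

text \<open>The four summands stem from the radial stretching (two terms), the variation of the exponent, that is, the
  running of the loops towards the origin and back, and the turning of the direction around the origin.\<close>

definition energy_bound :: "real \<Rightarrow> real \<Rightarrow> real \<Rightarrow> real" where
  "energy_bound a b c = 2 * pi * (a / (a + 1)) + 4 * pi * c * (1 - b) + 2 / (1 + a) + 2 * pi / sqrt (1 + 2 * c)"

text \<open>The first term of the density is estimated by \<open>K / (K + 1) \<le> a / (a + 1) + (K - a)\<close>, where
  \<open>K - a = c (1 - Re w)\<close> is at most \<open>2 c (1 - b)\<close> times the Poisson kernel; the other two are integrated exactly.\<close>

lemma angular_density_integral_le: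
  assumes a: "a > 0" and b: "0 \<le> b" "b < 1" and c: "c \<ge> 0"
  shows "(\<integral>\<^sup>+\<theta>. ennreal (angular_density a b c (cis \<theta>)) * indicator {-pi<..<pi} \<theta> \<partial>lborel) \<le> ennreal (energy_bound a b c)"
proof -
  have ab: "\<bar>b\<bar> < 1" using b by simp
  let ?P = "\<lambda>\<theta>. poisson b (cis \<theta>)" and ?K = "\<lambda>\<theta>. rate a c (mob b (cis \<theta>))"
  let ?J = "\<lambda>\<theta>. ?P \<theta> * c * \<bar>Im (mob b (cis \<theta>))\<bar> / (?K \<theta> + 1)\<^sup>2"
  let ?Q = "\<lambda>\<theta>. ?P \<theta> / ((a + 1) + c * (1 - Re (mob b (cis \<theta>))))"
  let ?R = "\<lambda>\<theta>. ?P \<theta> / (1 + 0 * (1 - Re (mob b (cis \<theta>))))"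
  let ?f = "\<lambda>\<theta>. a / (a + 1) + 2 * c * (1 - b) * ?R \<theta> + ?J \<theta> + ?Q \<theta>"
  let ?I = "2 * pi * (a / (a + 1)) + 2 * c * (1 - b) * (2 * pi / sqrt (1 * (1 + 2 * 0))) +
    2 * (1 / (1 + a) - 1 / (1 + a + 2 * c)) + 2 * pi / sqrt ((a + 1) * ((a + 1) + 2 * c))"
  have P: "?P \<theta> \<ge> 0" for \<theta> using ab by (simp add: poisson_def abs_square_le_1)
  have K: "?K \<theta> \<ge> a" for \<theta> using rate_ge(1)[OF c norm_mob[OF ab], of "cis \<theta>" a] by simp
  have "((\<lambda>\<theta>::real. a / (a + 1)) has_integral 2 * pi * (a / (a + 1))) {-pi..pi}"
    using has_integral_const_real[of "a / (a + 1)" "- pi" pi] by (simp add: mult.commute)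
  then have I: "(?f has_integral ?I) {-pi..pi}"
    by (intro has_integral_add has_integral_mult_right rate_variation_has_integral[OF ab a c]
        poisson_quotient_has_integral[OF ab]) (use a c in auto)
  have le: "angular_density a b c (cis \<theta>) \<le> ?f \<theta>" for \<theta>
  proof -
    have "?K \<theta> / (?K \<theta> + 1) - a / (a + 1) = (?K \<theta> - a) / ((?K \<theta> + 1) * (a + 1))"
      using a K[of \<theta>] by (simp add: diff_frac_eq algebra_simps)
    also have "\<dots> \<le> (?K \<theta> - a) / 1"
    proof (rule divide_left_mono)
      have "1 * 1 \<le> (?K \<theta> + 1) * (a + 1)" using a K[of \<theta>] by (intro mult_mono) auto
      then show "1 \<le> (?K \<theta> + 1) * (a + 1)" by simp
      then show "0 < (?K \<theta> + 1) * (a + 1) * 1" by linarith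
    qed (use K[of \<theta>] in simp)
    also have "\<dots> = c * (1 - Re (mob b (cis \<theta>)))" by (simp add: rate_def)
    also have "\<dots> \<le> c * (2 * (1 - b) * ?P \<theta>)"
    proof (rule mult_left_mono[OF _ c])
      let ?N = "1 + b\<^sup>2 + 2 * b * cos \<theta>"
      have N: "?N > 0" by (rule mob_cis(4)[OF ab])
      have "(1 - b)\<^sup>2 * (1 - cos \<theta>) \<le> (1 - b)\<^sup>2 * 2"
        using cos_ge_minus_one[of \<theta>] by (intro mult_left_mono) auto
      also have "(1 - b)\<^sup>2 * 2 = 2 * (1 - b) * (1 - b)" by (simp add: power2_eq_square)
      also have "\<dots> \<le> 2 * (1 - b) * (1 - b\<^sup>2)"
        using b by (intro mult_left_mono) (auto simp: power2_eq_square mult_left_le)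
      finally have "(1 - b)\<^sup>2 * (1 - cos \<theta>) / ?N \<le> 2 * (1 - b) * (1 - b\<^sup>2) / ?N"
        using N by (intro divide_right_mono) auto
      then show "1 - Re (mob b (cis \<theta>)) \<le> 2 * (1 - b) * ?P \<theta>"
        by (simp add: mob_cis[OF ab] poisson_def)
    qed
    finally have "?K \<theta> / (?K \<theta> + 1) \<le> a / (a + 1) + 2 * c * (1 - b) * ?R \<theta>" by (simp add: algebra_simps)
    moreover have "?P \<theta> / (?K \<theta> + 1) = ?Q \<theta>" by (simp add: rate_def add_ac)
    ultimately show ?thesis unfolding angular_density_def Let_def by linarith
  qed
  have f0: "?f \<theta> \<ge> 0" for \<theta>
  proof -
    have "angular_density a b c (cis \<theta>) \<ge> 0"
      unfolding angular_density_def Let_def using P[of \<theta>] K[of \<theta>] a c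
      by (intro add_nonneg_nonneg divide_nonneg_nonneg mult_nonneg_nonneg) auto
    then show ?thesis using le[of \<theta>] by linarith
  qed
  have "(\<integral>\<^sup>+\<theta>. ennreal (angular_density a b c (cis \<theta>)) * indicator {-pi<..<pi} \<theta> \<partial>lborel)
    \<le> (\<integral>\<^sup>+\<theta>. ennreal (?f \<theta>) * indicator {-pi..pi} \<theta> \<partial>lborel)"
    using le by (intro nn_integral_mono mult_mono ennreal_leI) (auto simp: indicator_def)
  also have "\<dots> = ennreal ?I"
    by (rule nn_integral_has_integral_lebesgue'[OF f0 I])
  also have "\<dots> \<le> ennreal (energy_bound a b c)"
  proof (rule ennreal_leI)
    have "sqrt (1 + 2 * c) \<le> sqrt ((a + 1) * ((a + 1) + 2 * c))"
    proof (rule real_sqrt_le_mono)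
      have "1 * (1 + 2 * c) \<le> (a + 1) * ((a + 1) + 2 * c)" using a c by (intro mult_mono) auto
      then show "1 + 2 * c \<le> (a + 1) * ((a + 1) + 2 * c)" by simp
    qed
    then have "2 * pi / sqrt ((a + 1) * ((a + 1) + 2 * c)) \<le> 2 * pi / sqrt (1 + 2 * c)"
      using a c by (intro divide_left_mono mult_pos_pos) auto
    moreover have "2 * (1 / (1 + a) - 1 / (1 + a + 2 * c)) \<le> 2 / (1 + a)" using a c by simp
    moreover have "2 * c * (1 - b) * (2 * pi / sqrt (1 * (1 + 2 * 0))) = 4 * pi * c * (1 - b)" by simp
    ultimately show "?I \<le> energy_bound a b c" unfolding energy_bound_def by linarith
  qed
  finally show ?thesis .
qed

lemma integral_hs_norm_squeeze_le:
  assumes a: "a > 0" and b: "0 \<le> b" "b < 1" and c: "c \<ge> 0"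
  shows "(\<integral>\<^sup>+z\<in>\<A>. ennreal (hs_norm (squeeze_deriv a b c z)) \<partial>lborel) \<le> ennreal (energy_bound a b c)"
proof -
  let ?D = "squeeze_deriv a b c"
  have ab: "\<bar>b\<bar> < 1" using b by simp
  define F where "F z = ennreal (indicator (\<A>) z *\<^sub>R energy_majorant a b c (norm z) (sgn z))" for z :: complex
  note sg = continuous_on_sgn_annulus and m = continuous_on_mob_sgn[OF ab]
  have "continuous_on (\<A>) (\<lambda>z. energy_majorant a b c (norm z) (sgn z))"
    unfolding energy_majorant_def Let_def rate_def poisson_def
    using annulus_nonzero[of _ 1] mob_denominator_annulus[OF ab]
    by (intro continuous_intros m sg) auto
  then have "(\<lambda>z. indicator (\<A>) z *\<^sub>R energy_majorant a b c (norm z) (sgn z)) \<in> borel_measurable borel"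
    using open_annulus by (intro borel_measurable_continuous_on_indicator) auto
  then have F: "F \<in> borel_measurable borel" unfolding F_def by measurable
  have "(\<integral>\<^sup>+z\<in>\<A>. ennreal (hs_norm (?D z)) \<partial>lborel) \<le> (\<integral>\<^sup>+z\<in>\<A>. F z \<partial>lborel)"
  proof (rule nn_integral_mono)
    fix z
    show "ennreal (hs_norm (?D z)) * indicator (\<A>) z \<le> F z * indicator (\<A>) z"
      using hs_norm_squeeze_deriv_le[OF _ a ab c, of z]
      by (cases "z \<in> \<A>") (auto simp: F_def intro: ennreal_leI)
  qed
  also have "\<dots> = (\<integral>\<^sup>+\<theta>. (\<integral>\<^sup>+t. F (of_real t * cis \<theta>) * ennreal t * indicator {0<..<1} t \<partial>lborel) * indicator {-pi<..<pi} \<theta> \<partial>lborel)"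
    by (rule nn_integral_polar_coordinates[OF F])
  also have "\<dots> = (\<integral>\<^sup>+\<theta>. ennreal (angular_density a b c (cis \<theta>)) * indicator {-pi<..<pi} \<theta> \<partial>lborel)"
  proof -
    have "(\<integral>\<^sup>+t. F (of_real t * cis \<theta>) * ennreal t * indicator {0<..<1} t \<partial>lborel) = ennreal (angular_density a b c (cis \<theta>))" for \<theta>
    proof -
      have "F (of_real t * cis \<theta>) * ennreal t * indicator {0<..<1} t =
          ennreal (energy_majorant a b c t (cis \<theta>)) * ennreal t * indicator {0<..<1} t" for t
      proof (cases "t \<in> {0<..<1}")
        case True
        then have "of_real t * cis \<theta> \<in> \<A>" "norm (of_real t * cis \<theta>) = t" "sgn (of_real t * cis \<theta>) = cis \<theta>"
          by (auto simp: annulus_def norm_mult sgn_mult sgn_of_real sgn_cis)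
        then show ?thesis by (simp add: F_def)
      qed simp
      then show ?thesis using radial_integral_energy_majorant[OF a ab c, of "cis \<theta>"] by simp
    qed
    then show ?thesis by simp
  qed
  also have "\<dots> \<le> ennreal (energy_bound a b c)"
    by (rule angular_density_integral_le[OF a b c])
  finally show ?thesis .
qed

lemma energy_squeeze:
  assumes "\<bar>b\<bar> < 1"
  shows "energy p \<A> (squeeze a b c) = (\<integral>\<^sup>+z\<in>\<A>. ennreal (hs_norm (squeeze_deriv a b c z) powr p) \<partial>lborel)"
  unfolding energy_eq[OF open_annulus squeeze_has_weak_differential[OF assms]] nn_integral_completion ..

lemma squeeze_in_annulus_homeos:
  assumes p: "p \<ge> 1" and a: "a > 0" and b: "\<bar>b\<bar> < 1" and c: "c \<ge> 0"
    and fin: "(\<integral>\<^sup>+z\<in>\<A>. ennreal (hs_norm (squeeze_deriv a b c z) powr p) \<partial>lborel) < \<infinity>"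
  shows "squeeze a b c \<in> annulus_homeos p 0 1 0 1"
proof -
  let ?D = "squeeze_deriv a b c"
  have U: "\<A> \<in> sets borel" "\<A> \<in> sets lebesgue" using open_annulus[of 0 1] by auto
  have homeo: "homeomorphism \<A> \<A> (squeeze a b c) (unsqueeze a b c)"
    by (rule homeomorphism_squeeze[OF a b c])
  have inLp: "in_Lp p \<A> f" if f: "continuous_on \<A> f" and fin: "(\<integral>\<^sup>+z\<in>\<A>. ennreal (norm (f z) powr p) \<partial>lborel) < \<infinity>"
    for f :: "complex \<Rightarrow> complex"
  proof -
    have m: "(\<lambda>z. indicator \<A> z *\<^sub>R f z) \<in> borel_measurable borel"
      using f U by (intro borel_measurable_continuous_on_indicator) auto
    have eq: "indicator \<A> z *\<^sub>R (norm (f z) powr p) = norm (indicator \<A> z *\<^sub>R f z) powr p" for z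
      using p by (simp add: indicator_def)
    have "integrable lborel (\<lambda>z. norm (indicator \<A> z *\<^sub>R f z) powr p)"
    proof (rule integrableI_bounded)
      show "(\<lambda>z. norm (indicator \<A> z *\<^sub>R f z) powr p) \<in> borel_measurable lborel"
        using m by measurable
      have "(\<integral>\<^sup>+z. ennreal (norm (norm (indicator \<A> z *\<^sub>R f z) powr p)) \<partial>lborel) = (\<integral>\<^sup>+z\<in>\<A>. ennreal (norm (f z) powr p) \<partial>lborel)"
        using p by (intro nn_integral_cong) (auto simp: indicator_def)
      then show "(\<integral>\<^sup>+z. ennreal (norm (norm (indicator \<A> z *\<^sub>R f z) powr p)) \<partial>lborel) < \<infinity>"
        using fin by simp
    qed
    then show ?thesis
      using m unfolding in_Lp_def set_borel_measurable_def set_integrable_def eq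
      by (simp add: integrable_completion borel_measurable_integrable measurable_completion)
  qed
  have "in_Lp p \<A> (squeeze a b c)"
  proof (rule inLp)
    show "continuous_on \<A> (squeeze a b c)" using homeo unfolding homeomorphism_def by blast
    have "(\<integral>\<^sup>+z\<in>\<A>. ennreal (norm (squeeze a b c z) powr p) \<partial>lborel) \<le> (\<integral>\<^sup>+z\<in>\<A>. 1 \<partial>lborel)"
    proof (rule nn_integral_mono)
      fix z
      have "norm (squeeze a b c z) powr p \<le> 1" if "z \<in> \<A>"
      proof -
        have "squeeze a b c z \<in> \<A>" using homeo that unfolding homeomorphism_def by blast
        then have "norm (squeeze a b c z) powr p \<le> 1 powr p"
          using p by (intro powr_mono2) (auto simp: annulus_def)
        then show ?thesis by simp
      qed
      then show "ennreal (norm (squeeze a b c z) powr p) * indicator \<A> z \<le> 1 * indicator \<A> z"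
        by (cases "z \<in> \<A>") (auto simp: ennreal_le_1)
    qed
    also have "\<dots> < \<infinity>" using U(1) by (simp add: emeasure_punctured_disc)
    finally show "(\<integral>\<^sup>+z\<in>\<A>. ennreal (norm (squeeze a b c z) powr p) \<partial>lborel) < \<infinity>" .
  qed
  moreover have "in_Lp p \<A> (\<lambda>z. ?D z v)" if v: "v \<in> Basis" for v
  proof (rule inLp)
    show "continuous_on \<A> (\<lambda>z. ?D z v)" by (rule continuous_on_squeeze_deriv[OF b])
    have "(\<integral>\<^sup>+z\<in>\<A>. ennreal (norm (?D z v) powr p) \<partial>lborel) \<le> (\<integral>\<^sup>+z\<in>\<A>. ennreal (hs_norm (?D z) powr p) \<partial>lborel)"
    proof (rule nn_integral_mono)
      fix z
      have "norm (?D z v) \<le> hs_norm (?D z)" if "z \<in> \<A>"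
      proof -
        have lin: "linear (?D z)"
          using squeeze_has_weak_differential[OF b] that unfolding has_weak_differential_def by blast
        show ?thesis
          unfolding hs_norm_linear[OF lin] using v by (intro real_le_rsqrt member_le_sum) auto
      qed
      then show "ennreal (norm (?D z v) powr p) * indicator \<A> z \<le> ennreal (hs_norm (?D z) powr p) * indicator \<A> z"
        using p by (cases "z \<in> \<A>") (auto intro!: ennreal_leI powr_mono2)
    qed
    then show "(\<integral>\<^sup>+z\<in>\<A>. ennreal (norm (?D z v) powr p) \<partial>lborel) < \<infinity>" using fin by (rule le_less_trans)
  qed
  ultimately have "squeeze a b c \<in> sobolev_W1 p \<A>"
    unfolding sobolev_W1_def using squeeze_has_weak_differential[OF b] by blast
  then show ?thesis
    unfolding annulus_homeos_def
    using homeo orientation_preserving_squeeze[OF a b c] squeeze_boundary_limits[OF a b c] by blast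
qed

lemma hs_norm_squeeze_deriv_nonneg: "\<bar>b\<bar> < 1 \<Longrightarrow> z \<in> \<A> \<Longrightarrow> 0 \<le> hs_norm (squeeze_deriv a b c z)"
  using squeeze_has_weak_differential[of b a c] unfolding has_weak_differential_def
  by (auto simp: hs_norm_linear intro!: sum_nonneg)

lemma energy_1_squeeze_le:
  assumes a: "a > 0" and b: "0 \<le> b" "b < 1" and c: "c \<ge> 0"
  shows "squeeze a b c \<in> annulus_homeos 1 0 1 0 1"
    and "energy 1 \<A> (squeeze a b c) \<le> ennreal (energy_bound a b c)"
proof -
  let ?D = "squeeze_deriv a b c"
  have ab: "\<bar>b\<bar> < 1" using b by simp
  have eq: "(\<integral>\<^sup>+z\<in>\<A>. ennreal (hs_norm (?D z) powr 1) \<partial>lborel) =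
    (\<integral>\<^sup>+z\<in>\<A>. ennreal (hs_norm (?D z)) \<partial>lborel)"
    using hs_norm_squeeze_deriv_nonneg[OF ab] by (intro nn_integral_cong) (auto simp: indicator_def)
  show "energy 1 (\<A>) (squeeze a b c) \<le> ennreal (energy_bound a b c)"
    unfolding energy_squeeze[OF ab] eq by (rule integral_hs_norm_squeeze_le[OF a b c])
  show "squeeze a b c \<in> annulus_homeos 1 0 1 0 1"
  proof (rule squeeze_in_annulus_homeos[OF _ a ab c])
    show "(\<integral>\<^sup>+z\<in>\<A>. ennreal (hs_norm (?D z) powr 1) \<partial>lborel) < \<infinity>"
      unfolding eq by (rule le_less_trans[OF integral_hs_norm_squeeze_le[OF a b c]]) simp
  qed simp
qed

text \<open>For \<open>a > 1\<close> the factor \<open>t powr (a - 1)\<close> compensates the logarithm near the origin. At \<open>a = 1\<close> this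
  fails unless \<open>c = 0\<close>: the tangential derivative is unbounded, of the order of the square root of \<open>- ln t\<close>.\<close>

lemma hs_norm_squeeze_deriv_bounded:
  assumes a: "a > 1" and b: "0 \<le> b" "b < 1" and c: "c \<ge> 0"
  shows "\<exists>L\<ge>1. \<forall>z\<in>\<A>. hs_norm (squeeze_deriv a b c z) \<le> L"
proof -
  have ab: "\<bar>b\<bar> < 1" and a0: "a > 0" using a b by auto
  define M where "M = (1 - b\<^sup>2) / (1 - b)\<^sup>2"
  define L where "L = max 1 (a + 2 * c + M * (c / (a - 1) + 1))"
  have "hs_norm (squeeze_deriv a b c z) \<le> L" if z: "z \<in> \<A>" for z
  proof -
    let ?u = "sgn z" and ?t = "norm z"
    let ?w = "mob b ?u"
    let ?k = "rate a c ?w"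
    have t: "0 < ?t" "?t < 1" using z by (auto simp: annulus_def)
    have u: "norm ?u = 1" using t by (simp add: norm_sgn)
    have w: "norm ?w = 1" by (rule norm_mob[OF ab u])
    note k = rate_ge[OF c w, of a]
    have P0: "poisson b ?u \<ge> 0" using ab by (simp add: poisson_def abs_square_le_1)
    have PM: "poisson b ?u \<le> M"
    proof -
      have "1 - b \<le> norm (1 + of_real b * ?u)"
        using norm_triangle_ineq4[of "1 + of_real b * ?u" "of_real b * ?u"] b by (simp add: norm_mult u)
      then have "(1 - b)\<^sup>2 \<le> (norm (1 + of_real b * ?u))\<^sup>2" using b by (intro power_mono) auto
      then show ?thesis
        unfolding poisson_def M_def using b ab
        by (intro divide_left_mono mult_pos_pos) (auto simp: abs_square_le_1 intro: less_le_trans[of _ "(1 - b)\<^sup>2"])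
    qed
    have q: "?t powr ?k / ?t \<le> ?t powr (a - 1)"
    proof -
      have "?t powr ?k / ?t = ?t powr (?k - 1)" using t by (simp add: powr_diff)
      also have "\<dots> \<le> ?t powr (a - 1)" using t k by (intro powr_mono') auto
      finally show ?thesis .
    qed
    have q1: "?t powr (a - 1) \<le> 1" using t a by (simp add: powr_le1)
    have ql: "?t powr (a - 1) * \<bar>ln ?t\<bar> \<le> 1 / (a - 1)"
    proof -
      let ?s = "?t powr (a - 1)"
      have s: "?s > 0" using t by simp
      have "ln (1 / ?s) \<le> 1 / ?s - 1" using s by (intro ln_le_minus_one) auto
      then have "(a - 1) * (- ln ?t) \<le> 1 / ?s" using s t by (simp add: ln_div ln_powr)
      then have "?s * ((a - 1) * (- ln ?t)) \<le> ?s * (1 / ?s)" using s by (intro mult_left_mono) auto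
      then have "(a - 1) * (?s * (- ln ?t)) \<le> 1" using s by (simp add: mult.left_commute)
      then have "?s * (- ln ?t) \<le> 1 / (a - 1)" using a by (simp add: pos_le_divide_eq mult.commute)
      then show ?thesis using t by simp
    qed
    have Im: "\<bar>Im ?w\<bar> \<le> 1" using abs_Im_le_cmod[of ?w] w by simp
    have "hs_norm (squeeze_deriv a b c z) \<le> ?t powr ?k / ?t * (?k + poisson b ?u * (c * \<bar>Im ?w\<bar> * \<bar>ln ?t\<bar> + 1))"
      using hs_norm_squeeze_deriv_le[OF z a0 ab c] unfolding energy_majorant_def Let_def .
    also have "\<dots> \<le> ?t powr (a - 1) * ((a + 2 * c) + M * (c * 1 * \<bar>ln ?t\<bar> + 1))"
      using q k a c P0 PM Im by (intro mult_mono add_mono mult_nonneg_nonneg add_nonneg_nonneg) auto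
    also have "\<dots> = ?t powr (a - 1) * (a + 2 * c) + M * (c * (?t powr (a - 1) * \<bar>ln ?t\<bar>) + ?t powr (a - 1))"
      by (simp add: algebra_simps)
    also have "\<dots> \<le> 1 * (a + 2 * c) + M * (c * (1 / (a - 1)) + 1)"
      using q1 ql a c order_trans[OF P0 PM] by (intro add_mono mult_mono mult_left_mono) auto
    also have "\<dots> \<le> L" by (simp add: L_def)
    finally show ?thesis .
  qed
  then show ?thesis by (intro exI[of _ L]) (auto simp: L_def)
qed

lemma energy_powr_squeeze_le:
  assumes a: "a > 0" and b: "0 \<le> b" "b < 1" and c: "c \<ge> 0" and p: "p \<ge> 1"
    and L: "\<And>z. z \<in> \<A> \<Longrightarrow> hs_norm (squeeze_deriv a b c z) \<le> L"
  shows "squeeze a b c \<in> annulus_homeos p 0 1 0 1"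
    and "energy p \<A> (squeeze a b c) \<le> ennreal (L powr (p - 1) * energy_bound a b c)"
proof -
  have ab: "\<bar>b\<bar> < 1" using b by simp
  let ?D = "squeeze_deriv a b c"
  have "(\<integral>\<^sup>+z\<in>\<A>. ennreal (hs_norm (?D z) powr p) \<partial>lborel) \<le>
      (\<integral>\<^sup>+z. ennreal (L powr (p - 1)) * (ennreal (hs_norm (?D z)) * indicator \<A> z) \<partial>lborel)"
  proof (rule nn_integral_mono)
    fix z
    show "ennreal (hs_norm (?D z) powr p) * indicator \<A> z \<le>
        ennreal (L powr (p - 1)) * (ennreal (hs_norm (?D z)) * indicator \<A> z)"
    proof (cases "z \<in> \<A>")
      case True
      let ?y = "hs_norm (?D z)"
      have y: "0 \<le> ?y" by (rule hs_norm_squeeze_deriv_nonneg[OF ab True])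
      have "?y powr p = ?y powr (p - 1) * ?y"
        using y powr_add[of ?y "p - 1" 1] by simp
      also have "\<dots> \<le> L powr (p - 1) * ?y"
        using y p L[OF True] by (intro mult_right_mono powr_mono2) auto
      finally have "ennreal (?y powr p) \<le> ennreal (L powr (p - 1) * ?y)" by (rule ennreal_leI)
      then show ?thesis using True y by (simp add: ennreal_mult)
    qed simp
  qed
  also have "\<dots> = ennreal (L powr (p - 1)) * (\<integral>\<^sup>+z\<in>\<A>. ennreal (hs_norm (?D z)) \<partial>lborel)"
  proof (rule nn_integral_cmult)
    have "continuous_on \<A> (\<lambda>z. sqrt ((norm (?D z 1))\<^sup>2 + (norm (?D z \<i>))\<^sup>2))"
      by (intro continuous_intros continuous_on_squeeze_deriv[OF ab])
    then have "(\<lambda>z. indicator \<A> z *\<^sub>R sqrt ((norm (?D z 1))\<^sup>2 + (norm (?D z \<i>))\<^sup>2)) \<in> borel_measurable borel"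
      using open_annulus by (intro borel_measurable_continuous_on_indicator) auto
    then have "(\<lambda>z. ennreal (indicator \<A> z *\<^sub>R sqrt ((norm (?D z 1))\<^sup>2 + (norm (?D z \<i>))\<^sup>2))) \<in> borel_measurable lborel"
      by measurable
    moreover have "ennreal (indicator \<A> z *\<^sub>R sqrt ((norm (?D z 1))\<^sup>2 + (norm (?D z \<i>))\<^sup>2)) = ennreal (hs_norm (?D z)) * indicator \<A> z" for z
    proof (cases "z \<in> \<A>")
      case True
      then have "linear (?D z)"
        using squeeze_has_weak_differential[OF ab] unfolding has_weak_differential_def by blast
      then show ?thesis using True by (simp add: hs_norm_complex)
    qed simp
    ultimately show "(\<lambda>z. ennreal (hs_norm (?D z)) * indicator \<A> z) \<in> borel_measurable lborel" by (simp only:)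
  qed
  also have "\<dots> \<le> ennreal (L powr (p - 1)) * ennreal (energy_bound a b c)"
    by (intro mult_left_mono integral_hs_norm_squeeze_le a b c) simp
  also have "\<dots> = ennreal (L powr (p - 1) * energy_bound a b c)"
    by (simp add: ennreal_mult')
  finally have le: "(\<integral>\<^sup>+z\<in>\<A>. ennreal (hs_norm (?D z) powr p) \<partial>lborel) \<le> ennreal (L powr (p - 1) * energy_bound a b c)" .
  then show "energy p \<A> (squeeze a b c) \<le> ennreal (L powr (p - 1) * energy_bound a b c)"
    unfolding energy_squeeze[OF ab] .
  show "squeeze a b c \<in> annulus_homeos p 0 1 0 1"
    by (rule squeeze_in_annulus_homeos[OF p a ab c le_less_trans[OF le]]) simp
qed

text \<open>With \<open>c = n\<^sup>2\<close> and \<open>1 - b = n powr -3\<close> the loops become thin while the product \<open>c (1 - b)\<close> still tends to \<open>0\<close>.\<close>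

lemma energy_bound_le:
  assumes n: "n > (0::nat)"
  shows "energy_bound a (1 - 1 / real n ^ 3) ((real n)\<^sup>2) \<le> 2 * pi * (a / (a + 1)) + 2 / (1 + a) + 6 * pi / n"
proof -
  have "4 * pi * (real n)\<^sup>2 * (1 - (1 - 1 / real n ^ 3)) = 4 * pi / n"
    using n by (simp add: power2_eq_square power3_eq_cube)
  moreover have "real n \<le> sqrt (1 + 2 * (real n)\<^sup>2)"
    by (intro real_le_rsqrt) simp
  then have "2 * pi / sqrt (1 + 2 * (real n)\<^sup>2) \<le> 2 * pi / n"
    using n by (intro divide_left_mono mult_pos_pos) (auto intro: add_pos_nonneg)
  ultimately show ?thesis
    unfolding energy_bound_def by (simp add: add_divide_distrib[symmetric])
qed

lemma parameters_admissible:
  assumes "n > (0::nat)"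
  shows "0 \<le> 1 - 1 / real n ^ 3" "1 - 1 / real n ^ 3 < 1" "0 \<le> (real n)\<^sup>2"
  using assms by (auto simp: one_le_power)

lemma INF_energy_le_2: "(INF h\<in>annulus_homeos 1 0 1 0 1. energy 1 \<A> h) \<le> 2"
proof -
  let ?I = "INF h\<in>annulus_homeos 1 0 1 0 1. energy 1 \<A> h"
  have le: "?I \<le> ennreal (2 + 8 * pi / n)" if n: "n > 0" for n :: nat
  proof -
    let ?h = "squeeze (1 / n) (1 - 1 / real n ^ 3) ((real n)\<^sup>2)"
    have a: "1 / real n > 0" using n by simp
    note h = energy_1_squeeze_le[OF a parameters_admissible[OF n]]
    have "?I \<le> energy 1 \<A> ?h" by (rule INF_lower[OF h(1)])
    also have "\<dots> \<le> ennreal (energy_bound (1 / n) (1 - 1 / real n ^ 3) ((real n)\<^sup>2))" by (rule h(2))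
    also have "\<dots> \<le> ennreal (2 + 8 * pi / n)"
    proof (rule ennreal_leI)
      have "1 / real n / (1 / real n + 1) \<le> 1 / n" using n by (simp add: field_simps)
      then have "2 * pi * (1 / real n / (1 / real n + 1)) \<le> 2 * pi * (1 / n)" by (intro mult_left_mono) auto
      moreover have "2 / (1 + 1 / real n) \<le> 2" using n by (simp add: field_simps)
      moreover have "2 * pi * (1 / n) + 6 * pi / n = 8 * pi / n" by (simp add: add_divide_distrib[symmetric])
      ultimately show "energy_bound (1 / n) (1 - 1 / real n ^ 3) ((real n)\<^sup>2) \<le> 2 + 8 * pi / n"
        using energy_bound_le[OF n, of "1 / n"] by linarith
    qed
    finally show ?thesis .
  qed
  have "(\<lambda>n. ennreal (2 + 8 * pi / real n)) \<longlonglongrightarrow> ennreal (2 + 0)"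
    by (intro tendsto_ennrealI tendsto_add tendsto_const lim_const_over_n)
  then have "?I \<le> ennreal (2 + 0)"
    by (rule LIMSEQ_le_const) (use le in \<open>auto intro: exI[of _ 1]\<close>)
  then show ?thesis by simp
qed

text \<open>The identity is the member of the family with \<open>a = 1\<close>, \<open>b = 0\<close>, \<open>c = 0\<close> and inherits
  regularity and orientation from it.\<close>

lemma id_in_radial_homeos: "(\<lambda>z. z) \<in> radial_homeos 1 0 1 0 1"
proof -
  have "squeeze 1 0 0 \<in> annulus_homeos 1 0 1 0 1" by (rule energy_1_squeeze_le) auto
  moreover have "squeeze 1 0 0 = (\<lambda>z. z)" using squeeze_trivial by blast
  ultimately show ?thesis
    unfolding radial_homeos_def by (auto simp: annulus_def intro!: exI[of _ "\<lambda>t. t"])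
qed

lemma sqrt_2_bounds: "1.414 < sqrt 2"
  by (rule real_less_rsqrt) (simp add: power2_eq_square)

theorem theorem1p2:
  shows "(INF h\<in>annulus_homeos 1 0 1 0 1. energy 1 (annulus 0 1) h) \<le> 2 \<and>
     2 < ennreal (sqrt 2 * pi) \<and>
     ennreal (sqrt 2 * pi) = energy 1 (annulus 0 1) (id :: complex \<Rightarrow> complex) \<and>
     energy 1 (annulus 0 1) (id :: complex \<Rightarrow> complex) =
       (INF h\<in>radial_homeos 1 0 1 0 1. energy 1 (annulus 0 1) h) \<and>
     (\<exists>p\<^sub>1. 1 < p\<^sub>1 \<and> p\<^sub>1 < 2 \<and> (\<forall>p. 1 \<le> p \<and> p < p\<^sub>1 \<longrightarrow>
       (INF h\<in>annulus_homeos p 0 1 0 1. energy p (annulus 0 1) h)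
         < (INF h\<in>radial_homeos p 0 1 0 1. energy p (annulus 0 1) h)))"
proof (intro conjI)
  show "(INF h\<in>annulus_homeos 1 0 1 0 1. energy 1 \<A> h) \<le> 2" by (rule INF_energy_le_2)
  have pi3: "pi > 3" using pi_approx by simp
  have "1.414 * 3 < sqrt 2 * pi" using sqrt_2_bounds pi3 by (intro mult_strict_mono) auto
  then have "ennreal 2 < ennreal (sqrt 2 * pi)" by (intro ennreal_lessI) auto
  then show "2 < ennreal (sqrt 2 * pi)" by simp
  show id: "ennreal (sqrt 2 * pi) = energy 1 \<A> (id :: complex \<Rightarrow> complex)"
    using energy_id[of 1] by (simp add: id_def mult.commute)
  show "energy 1 \<A> (id :: complex \<Rightarrow> complex) = (INF h\<in>radial_homeos 1 0 1 0 1. energy 1 \<A> h)"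
  proof (rule antisym)
    show "energy 1 \<A> (id :: complex \<Rightarrow> complex) \<le> (INF h\<in>radial_homeos 1 0 1 0 1. energy 1 \<A> h)"
      using radial_energy_ge[of 1] unfolding id[symmetric] by (intro INF_greatest) (simp add: mult.commute)
    show "(INF h\<in>radial_homeos 1 0 1 0 1. energy 1 \<A> h) \<le> energy 1 \<A> (id :: complex \<Rightarrow> complex)"
      using id_in_radial_homeos unfolding id_def by (rule INF_lower)
  qed
  let ?n = "1000 :: nat"
  \<comment> \<open>any \<open>a > 1\<close> with \<open>2 \<pi> a / (a + 1) + 2 / (1 + a) < sqrt 2 * \<pi>\<close> would do; \<open>n\<close> makes the rest small\<close>
  let ?a = "11 / 10 :: real" and ?b = "1 - 1 / real ?n ^ 3" and ?c = "(real ?n)\<^sup>2"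
  note par = parameters_admissible[of ?n, simplified]
  define E where "E = energy_bound ?a ?b ?c"
  obtain L where L: "L \<ge> 1" "\<And>z. z \<in> \<A> \<Longrightarrow> hs_norm (squeeze_deriv ?a ?b ?c z) \<le> L"
    using hs_norm_squeeze_deriv_bounded[of ?a ?b ?c] by auto
  have "E \<le> 2 * pi * (?a / (?a + 1)) + 2 / (1 + ?a) + 6 * pi / ?n"
    unfolding E_def by (rule energy_bound_le) simp
  also have "\<dots> = pi * (22 / 21 + 6 / 1000) + 20 / 21" by (simp add: field_simps)
  also have "\<dots> < pi * sqrt 2"
  proof -
    have "0.36 * 3 < (sqrt 2 - (22 / 21 + 6 / 1000)) * pi"
      using sqrt_2_bounds pi3 by (intro mult_strict_mono) auto
    then show ?thesis by (simp add: algebra_simps)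
  qed
  finally have E: "E < pi * sqrt 2" .
  have "((\<lambda>p. L powr (p - 1) * E) \<longlongrightarrow> L powr (1 - 1) * E) (at_right 1)"
    using L(1) by (intro tendsto_intros) auto
  then have "\<forall>\<^sub>F p in at_right 1. L powr (p - 1) * E < pi * sqrt 2"
    using E L(1) by (intro order_tendstoD) auto
  then obtain q where q: "q > 1" "\<And>p. 1 < p \<Longrightarrow> p < q \<Longrightarrow> L powr (p - 1) * E < pi * sqrt 2"
    unfolding eventually_at_right_field by auto
  show "\<exists>p\<^sub>1. 1 < p\<^sub>1 \<and> p\<^sub>1 < 2 \<and> (\<forall>p. 1 \<le> p \<and> p < p\<^sub>1 \<longrightarrow>
       (INF h\<in>annulus_homeos p 0 1 0 1. energy p \<A> h)
         < (INF h\<in>radial_homeos p 0 1 0 1. energy p \<A> h))"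
  proof (intro exI conjI allI impI)
    show "1 < min q (3 / 2)" "min q (3 / 2) < (2 :: real)" using q(1) by auto
    fix p assume p: "1 \<le> p \<and> p < min q (3 / 2)"
    then have p1: "p \<ge> 1" by simp
    have "energy p \<A> (squeeze ?a ?b ?c) \<le> ennreal (L powr (p - 1) * E)"
      and mem: "squeeze ?a ?b ?c \<in> annulus_homeos p 0 1 0 1"
      using energy_powr_squeeze_le[of ?a ?b ?c p L] p1 L(2) unfolding E_def by auto
    note INF_lower[OF mem, of "energy p \<A>"]
    also note \<open>energy p \<A> (squeeze ?a ?b ?c) \<le> ennreal (L powr (p - 1) * E)\<close>
    also have "ennreal (L powr (p - 1) * E) < ennreal (pi * sqrt 2)"
    proof (rule ennreal_lessI)
      show "L powr (p - 1) * E < pi * sqrt 2"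
        using p q(2)[of p] E L(1) by (cases "p = 1") auto
    qed simp
    also have "ennreal (pi * sqrt 2) \<le> (INF h\<in>radial_homeos p 0 1 0 1. energy p \<A> h)"
    proof (rule INF_greatest)
      fix h assume h: "h \<in> radial_homeos p 0 1 0 1"
      have "sqrt 2 powr 1 \<le> sqrt 2 powr p" using p1 by (intro powr_mono) auto
      then have "pi * sqrt 2 \<le> pi * sqrt 2 powr p" by simp
      then have "ennreal (pi * sqrt 2) \<le> ennreal (pi * sqrt 2 powr p)" by (rule ennreal_leI)
      also have "\<dots> \<le> energy p \<A> h" by (rule radial_energy_ge[OF p1 h])
      finally show "ennreal (pi * sqrt 2) \<le> energy p \<A> h" .
    qed
    finally show "(INF h\<in>annulus_homeos p 0 1 0 1. energy p \<A> h)
         < (INF h\<in>radial_homeos p 0 1 0 1. energy p \<A> h)" .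
  qed
qed

end
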